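(* Let $(\Delta,\pi)$ be an $\mathbf{a}$-balanced simplicial complex and let $\Theta=\theta_1,\dots,\theta_{|\mathbf{a}|}$ be an $\mathbb{N}^m$-graded l.s.o.p.\ for $\mathbb{F}[\Delta]$. If $\Delta$ is Buchsbaum, then $$\mathrm{Hilb}(\mathbb{F}[\Delta]/\Theta \mathbb{F}[\Delta];t_1,\dots,t_m)= \sum_{\mathbf{b} \leq \mathbf{a}} h_\mathbf{b}'(\Delta,\pi) \mathbf{t}^\mathbf{b}.$$
   Context: $\mathbb{F}$ is an infinite field. For $\mathbf{a}=(a_1,\dots,a_m)\in\mathbb{N}^m$, an $\mathbf{a}$-balanced complex is a pair $(\Delta,\pi)$ with $\dim\Delta=|\mathbf{a}|-1$ and $\pi:V(\Delta)\to\{\mathbf{e}_1,\dots,\mathbf{e}_m\}$ (standard basis) such that $\pi(\sigma)=\sum_{v\in\sigma}\pi(v)\le\mathbf{a}$ componentwise for every face $\sigma$. $\mathbb{F}[\Delta]$ is $\mathbb{N}^m$-graded by $\deg x_v=\pi(v)$; an $\mathbb{N}^m$-graded l.s.o.p.\ is a linear system of parameters of $\mathbb{N}^m$-homogeneous linear forms. $\binom{\mathbf{c}}{\mathbf{b}}=\prod_i\binom{c_i}{b_i}$; $f_\mathbf{b}(\Delta,\pi)$ is the number of faces $\sigma$ with $\pi(\sigma)=\mathbf{b}$; $h_\mathbf{b}(\Delta,\pi)=\sum_{\mathbf{c}\le\mathbf{b}}(-1)^{|\mathbf{b}|-|\mathbf{c}|}\binom{\mathbf{a}-\mathbf{c}}{\mathbf{b}-\mathbf{c}}f_\mathbf{c}(\Delta,\pi)$;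 the flag $h'$-number is $h'_\mathbf{b}(\Delta,\pi)=h_\mathbf{b}(\Delta,\pi)-\binom{\mathbf{a}}{\mathbf{b}}\sum_{j=1}^{|\mathbf{b}|-1}(-1)^{|\mathbf{b}|-j}\tilde\beta_{j-1}(\Delta)$, with $\tilde\beta$ reduced Betti numbers over $\mathbb{F}$. $\mathrm{Hilb}(M;t_1,\dots,t_m)=\sum_\mathbf{b}\dim_\mathbb{F}M_\mathbf{b}\,\mathbf{t}^\mathbf{b}$ with $\mathbf{t}^\mathbf{b}=t_1^{b_1}\cdots t_m^{b_m}$. *)

theory Defs
  imports
    Complex_Main
    "HOL-Library.Poly_Mapping"
    "HOL-Algebra.QuotRing"
    "HOL-Algebra.Embedded_Algebras"
begin

section \<open>Simplicial complexes\<close>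

definition simplicial_complex :: "'v set set \<Rightarrow> bool" where
  "simplicial_complex \<Delta> \<longleftrightarrow>
     finite \<Delta> \<and> {} \<in> \<Delta> \<and> (\<forall>\<sigma>\<in>\<Delta>. finite \<sigma> \<and> (\<forall>\<tau>. \<tau> \<subseteq> \<sigma> \<longrightarrow> \<tau> \<in> \<Delta>))"

definition vertices :: "'v set set \<Rightarrow> 'v set" where
  "vertices \<Delta> = \<Union>\<Delta>"

definition face_dim :: "'v set \<Rightarrow> int" where
  "face_dim \<sigma> = int (card \<sigma>) - 1"

definition complex_dim :: "'v set set \<Rightarrow> int" where
  "complex_dim \<Delta> = Max (face_dim ` \<Delta>)"

definition link :: "'v set set \<Rightarrow> 'v set \<Rightarrow> 'v set set" where
  "link \<Delta> \<sigma> = {\<tau> \<in> \<Delta>. \<tau> \<inter> \<sigma> = {} \<and> \<tau> \<union> \<sigma> \<in> \<Delta>}"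

definition facets :: "'v set set \<Rightarrow> 'v set set" where
  "facets \<Delta> = {\<sigma> \<in> \<Delta>. \<forall>\<tau>\<in>\<Delta>. \<sigma> \<subseteq> \<tau> \<longrightarrow> \<tau> = \<sigma>}"

definition pure_complex :: "'v set set \<Rightarrow> bool" where
  "pure_complex \<Delta> \<longleftrightarrow> (\<forall>\<sigma>\<in>facets \<Delta>. face_dim \<sigma> = complex_dim \<Delta>)"


section \<open>Reduced simplicial homology\<close>

text \<open>
  A chain is a finitely supported function on finite vertex sets; the set \<open>\<sigma>\<close> stands for
  the simplex oriented by the linear order on the vertices. The empty face has dimension
  \<open>-1\<close>, so the chain complex is the augmented one.
\<close>

definition chain_scale :: "'f \<Rightarrow> ('v set \<Rightarrow>\<^sub>0 'f) \<Rightarrow> ('v set \<Rightarrow>\<^sub>0 'f::field)" where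
  "chain_scale k = Poly_Mapping.map ((*) k)"

lemma lookup_chain_scale:
  "Poly_Mapping.lookup (chain_scale k c) \<sigma> = k * Poly_Mapping.lookup c \<sigma>"
  by (simp add: chain_scale_def Poly_Mapping.map.rep_eq when_def)

global_interpretation chain: vector_space chain_scale
  by unfold_locales
    (simp_all add: poly_mapping_eq_iff fun_eq_iff lookup_add lookup_chain_scale
      distrib_left distrib_right mult.assoc)

definition chains :: "'v set set \<Rightarrow> int \<Rightarrow> ('v set \<Rightarrow>\<^sub>0 'f::field) set" where
  "chains \<Delta> i = {c. Poly_Mapping.keys c \<subseteq> {\<sigma> \<in> \<Delta>. face_dim \<sigma> = i}}"

definition boundary :: "('v::linorder set \<Rightarrow>\<^sub>0 'f::field) \<Rightarrow> ('v set \<Rightarrow>\<^sub>0 'f)" where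
  "boundary c = (\<Sum>\<sigma>\<in>Poly_Mapping.keys c. \<Sum>v\<in>\<sigma>.
     Poly_Mapping.single (\<sigma> - {v}) ((- 1) ^ card {w \<in> \<sigma>. w < v} * Poly_Mapping.lookup c \<sigma>))"

definition cycles :: "'v::linorder set set \<Rightarrow> int \<Rightarrow> ('v set \<Rightarrow>\<^sub>0 'f::field) set" where
  "cycles \<Delta> i = {c \<in> chains \<Delta> i. boundary c = 0}"

definition boundaries :: "'v::linorder set set \<Rightarrow> int \<Rightarrow> ('v set \<Rightarrow>\<^sub>0 'f::field) set" where
  "boundaries \<Delta> i = boundary ` chains \<Delta> (i + 1)"

text \<open>The dimension of the quotient of cycles by boundaries; the subtraction does not truncate,
  since boundaries are cycles.\<close>

definition reduced_betti :: "'f::field itself \<Rightarrow> 'v::linorder set set \<Rightarrow> int \<Rightarrow> nat" where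
  "reduced_betti _ \<Delta> i =
     chain.dim (cycles \<Delta> i :: ('v set \<Rightarrow>\<^sub>0 'f) set) -
     chain.dim (boundaries \<Delta> i :: ('v set \<Rightarrow>\<^sub>0 'f) set)"


section \<open>Cohen-Macaulay and Buchsbaum complexes\<close>

definition cohen_macaulay :: "'f::field itself \<Rightarrow> 'v::linorder set set \<Rightarrow> bool" where
  "cohen_macaulay F \<Delta> \<longleftrightarrow>
     (\<forall>\<sigma>\<in>\<Delta>. \<forall>i < complex_dim (link \<Delta> \<sigma>). reduced_betti F (link \<Delta> \<sigma>) i = 0)"

definition buchsbaum :: "'f::field itself \<Rightarrow> 'v::linorder set set \<Rightarrow> bool" where
  "buchsbaum F \<Delta> \<longleftrightarrow>
     pure_complex \<Delta> \<and> (\<forall>v\<in>vertices \<Delta>. cohen_macaulay F (link \<Delta> {v}))"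


section \<open>Balanced complexes\<close>

text \<open>Elements of \<open>\<nat>\<^sup>m\<close> are functions \<open>'m \<Rightarrow> nat\<close> on a finite index type, with the
  componentwise order and difference.\<close>

definition vsize :: "('m::finite \<Rightarrow> nat) \<Rightarrow> nat" where
  "vsize b = (\<Sum>i\<in>UNIV. b i)"

definition unit_vec :: "'m \<Rightarrow> 'm \<Rightarrow> nat" where
  "unit_vec i = (\<lambda>j. if j = i then 1 else 0)"

definition vbinom :: "('m::finite \<Rightarrow> nat) \<Rightarrow> ('m \<Rightarrow> nat) \<Rightarrow> nat" where
  "vbinom c b = (\<Prod>i\<in>UNIV. c i choose b i)"

definition color_sum :: "('v \<Rightarrow> 'm \<Rightarrow> nat) \<Rightarrow> 'v set \<Rightarrow> 'm \<Rightarrow> nat" where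
  "color_sum \<pi> \<sigma> = (\<lambda>i. \<Sum>v\<in>\<sigma>. \<pi> v i)"

definition balanced :: "'v set set \<Rightarrow> ('v \<Rightarrow> 'm::finite \<Rightarrow> nat) \<Rightarrow> ('m \<Rightarrow> nat) \<Rightarrow> bool" where
  "balanced \<Delta> \<pi> a \<longleftrightarrow>
     complex_dim \<Delta> = int (vsize a) - 1 \<and>
     \<pi> ` vertices \<Delta> \<subseteq> range unit_vec \<and>
     (\<forall>\<sigma>\<in>\<Delta>. color_sum \<pi> \<sigma> \<le> a)"

definition flag_f :: "'v set set \<Rightarrow> ('v \<Rightarrow> 'm \<Rightarrow> nat) \<Rightarrow> ('m \<Rightarrow> nat) \<Rightarrow> nat" where
  "flag_f \<Delta> \<pi> b = card {\<sigma> \<in> \<Delta>. color_sum \<pi> \<sigma> = b}"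

definition flag_h ::
  "'v set set \<Rightarrow> ('v \<Rightarrow> 'm::finite \<Rightarrow> nat) \<Rightarrow> ('m \<Rightarrow> nat) \<Rightarrow> ('m \<Rightarrow> nat) \<Rightarrow> int" where
  "flag_h \<Delta> \<pi> a b =
     (\<Sum>c | c \<le> b. (- 1) ^ (vsize b - vsize c) * int (vbinom (a - c) (b - c)) * int (flag_f \<Delta> \<pi> c))"

definition flag_h' ::
  "'f::field itself \<Rightarrow> 'v::linorder set set \<Rightarrow> ('v \<Rightarrow> 'm::finite \<Rightarrow> nat) \<Rightarrow>
    ('m \<Rightarrow> nat) \<Rightarrow> ('m \<Rightarrow> nat) \<Rightarrow> int" where
  "flag_h' F \<Delta> \<pi> a b =
     flag_h \<Delta> \<pi> a b -
     int (vbinom a b) *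
       (\<Sum>j = 1..<vsize b. (- 1) ^ (vsize b - j) * int (reduced_betti F \<Delta> (int j - 1)))"


section \<open>Polynomial rings\<close>

text \<open>A monomial is its exponent vector \<open>'v \<Rightarrow>\<^sub>0 nat\<close>; the carrier below consists of the
  polynomials involving only variables \<open>x\<^sub>v\<close> with \<open>v \<in> V\<close>.\<close>

type_synonym ('v, 'f) mpoly = "('v \<Rightarrow>\<^sub>0 nat) \<Rightarrow>\<^sub>0 'f"

definition poly_ring :: "'v set \<Rightarrow> ('v, 'f::field) mpoly ring" where
  "poly_ring V =
     \<lparr>carrier = {p. \<forall>\<mu>\<in>Poly_Mapping.keys p. Poly_Mapping.keys \<mu> \<subseteq> V},
      mult = (*), one = 1, zero = 0, add = (+)\<rparr>"

lemma poly_ring_simps [simp]: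
  "p \<in> carrier (poly_ring V) \<longleftrightarrow> (\<forall>\<mu>\<in>Poly_Mapping.keys p. Poly_Mapping.keys \<mu> \<subseteq> V)"
  "p \<otimes>\<^bsub>poly_ring V\<^esub> q = p * q"
  "p \<oplus>\<^bsub>poly_ring V\<^esub> q = p + q"
  "\<one>\<^bsub>poly_ring V\<^esub> = 1"
  "\<zero>\<^bsub>poly_ring V\<^esub> = 0"
  by (simp_all add: poly_ring_def)

lemma cring_poly_ring: "cring (poly_ring V :: ('v, 'f::field) mpoly ring)"
proof -
  let ?R = "poly_ring V :: ('v, 'f) mpoly ring"
  have add: "p + q \<in> carrier ?R" if "p \<in> carrier ?R" "q \<in> carrier ?R" for p q
    using that Poly_Mapping.keys_add[of p q] unfolding poly_ring_simps by blast
  have mult: "p * q \<in> carrier ?R" if p: "p \<in> carrier ?R" and q: "q \<in> carrier ?R" for p q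
    unfolding poly_ring_simps
  proof
    fix \<mu> assume "\<mu> \<in> Poly_Mapping.keys (p * q)"
    with keys_mult[of p q] obtain \<alpha> \<beta> where
      "\<mu> = \<alpha> + \<beta>" "\<alpha> \<in> Poly_Mapping.keys p" "\<beta> \<in> Poly_Mapping.keys q" by blast
    with p q Poly_Mapping.keys_add[of \<alpha> \<beta>] show "Poly_Mapping.keys \<mu> \<subseteq> V"
      unfolding poly_ring_simps by blast
  qed
  have minus: "- p \<in> carrier ?R" if "p \<in> carrier ?R" for p
    using that by simp
  have closed: "0 \<in> carrier ?R" "1 \<in> carrier ?R"
    by simp_all
  have "abelian_group ?R"
  proof (rule abelian_groupI)
    fix p assume "p \<in> carrier ?R"
    then show "\<exists>q\<in>carrier ?R. q \<oplus>\<^bsub>?R\<^esub> p = \<zero>\<^bsub>?R\<^esub>"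
      by (intro bexI[of _ "- p"] minus) (simp_all only: poly_ring_simps left_minus)
  qed (simp_all only: poly_ring_simps(2-) add closed ac_simps add_0_left add_0_right)
  moreover have "comm_monoid ?R"
    by (rule comm_monoidI) (simp_all only: poly_ring_simps(2-) mult closed ac_simps mult_1_left mult_1_right)
  ultimately show ?thesis
    by (rule cringI) (simp only: poly_ring_simps(2-) distrib_right)
qed

definition sf_monomial :: "'v set \<Rightarrow> ('v, 'f::field) mpoly" where
  "sf_monomial \<sigma> = (\<Prod>v\<in>\<sigma>. Poly_Mapping.single (Poly_Mapping.single v 1) 1)"

definition poly_constants :: "('v, 'f::field) mpoly set" where
  "poly_constants = range (Poly_Mapping.single 0)"

definition total_degree :: "('v \<Rightarrow>\<^sub>0 nat) \<Rightarrow> nat" where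
  "total_degree \<mu> = (\<Sum>v\<in>Poly_Mapping.keys \<mu>. Poly_Mapping.lookup \<mu> v)"

definition multidegree :: "('v \<Rightarrow> 'm \<Rightarrow> nat) \<Rightarrow> ('v \<Rightarrow>\<^sub>0 nat) \<Rightarrow> 'm \<Rightarrow> nat" where
  "multidegree \<pi> \<mu> = (\<lambda>i. \<Sum>v\<in>Poly_Mapping.keys \<mu>. Poly_Mapping.lookup \<mu> v * \<pi> v i)"

definition linear_polys :: "'v set \<Rightarrow> ('v, 'f::field) mpoly set" where
  "linear_polys V = {p \<in> carrier (poly_ring V). \<forall>\<mu>\<in>Poly_Mapping.keys p. total_degree \<mu> = 1}"

definition poly_component ::
  "'v set \<Rightarrow> ('v \<Rightarrow> 'm \<Rightarrow> nat) \<Rightarrow> ('m \<Rightarrow> nat) \<Rightarrow> ('v, 'f::field) mpoly set" where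
  "poly_component V \<pi> b =
     {p \<in> carrier (poly_ring V). \<forall>\<mu>\<in>Poly_Mapping.keys p. multidegree \<pi> \<mu> = b}"


section \<open>Stanley-Reisner rings and linear systems of parameters\<close>

definition quot_map :: "('a, 'b) ring_scheme \<Rightarrow> 'a set \<Rightarrow> 'a \<Rightarrow> 'a set" where
  "quot_map R I x = I +>\<^bsub>R\<^esub> x"

definition SR_ideal :: "'v set set \<Rightarrow> ('v, 'f::field) mpoly set" where
  "SR_ideal \<Delta> =
     Idl\<^bsub>poly_ring (vertices \<Delta>)\<^esub> (sf_monomial ` {\<sigma>. \<sigma> \<subseteq> vertices \<Delta> \<and> \<sigma> \<notin> \<Delta>})"

definition SR_ring :: "'v set set \<Rightarrow> ('v, 'f::field) mpoly set ring" where
  "SR_ring \<Delta> = poly_ring (vertices \<Delta>) Quot SR_ideal \<Delta>"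

definition SR_map :: "'v set set \<Rightarrow> ('v, 'f::field) mpoly \<Rightarrow> ('v, 'f) mpoly set" where
  "SR_map \<Delta> = quot_map (poly_ring (vertices \<Delta>)) (SR_ideal \<Delta>)"

definition SR_component ::
  "'v set set \<Rightarrow> ('v \<Rightarrow> 'm \<Rightarrow> nat) \<Rightarrow> ('m \<Rightarrow> nat) \<Rightarrow> ('v, 'f::field) mpoly set set" where
  "SR_component \<Delta> \<pi> b = SR_map \<Delta> ` poly_component (vertices \<Delta>) \<pi> b"

definition param_ideal ::
  "'v set set \<Rightarrow> ('v, 'f::field) mpoly set list \<Rightarrow> ('v, 'f) mpoly set set" where
  "param_ideal \<Delta> \<Theta> = Idl\<^bsub>SR_ring \<Delta>\<^esub> (set \<Theta>)"

definition SR_quot ::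
  "'v set set \<Rightarrow> ('v, 'f::field) mpoly set list \<Rightarrow> ('v, 'f) mpoly set set ring" where
  "SR_quot \<Delta> \<Theta> = SR_ring \<Delta> Quot param_ideal \<Delta> \<Theta>"

text \<open>The copy of the ground field in the quotient, over which dimensions are taken.\<close>

definition SR_quot_constants ::
  "'v set set \<Rightarrow> ('v, 'f::field) mpoly set list \<Rightarrow> ('v, 'f) mpoly set set set" where
  "SR_quot_constants \<Delta> \<Theta> =
     quot_map (SR_ring \<Delta>) (param_ideal \<Delta> \<Theta>) ` SR_map \<Delta> ` poly_constants"

definition SR_quot_component ::
  "'v set set \<Rightarrow> ('v \<Rightarrow> 'm \<Rightarrow> nat) \<Rightarrow> ('v, 'f::field) mpoly set list \<Rightarrow> ('m \<Rightarrow> nat) \<Rightarrow>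
    ('v, 'f) mpoly set set set" where
  "SR_quot_component \<Delta> \<pi> \<Theta> b =
     quot_map (SR_ring \<Delta>) (param_ideal \<Delta> \<Theta>) ` SR_component \<Delta> \<pi> b"

text \<open>The Krull dimension of the Stanley-Reisner ring is \<open>dim \<Delta> + 1\<close>, so a system of
  parameters has this length.\<close>

definition lsop :: "'v set set \<Rightarrow> ('v, 'f::field) mpoly set list \<Rightarrow> bool" where
  "lsop \<Delta> \<Theta> \<longleftrightarrow>
     int (length \<Theta>) = complex_dim \<Delta> + 1 \<and>
     set \<Theta> \<subseteq> SR_map \<Delta> ` linear_polys (vertices \<Delta>) \<and>
     ring.finite_dimension (SR_quot \<Delta> \<Theta>) (SR_quot_constants \<Delta> \<Theta>) (carrier (SR_quot \<Delta> \<Theta>))"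

definition graded_lsop ::
  "'v set set \<Rightarrow> ('v \<Rightarrow> 'm \<Rightarrow> nat) \<Rightarrow> ('v, 'f::field) mpoly set list \<Rightarrow> bool" where
  "graded_lsop \<Delta> \<pi> \<Theta> \<longleftrightarrow>
     lsop \<Delta> \<Theta> \<and> (\<forall>\<theta>\<in>set \<Theta>. \<exists>b. \<theta> \<in> SR_component \<Delta> \<pi> b)"


section \<open>Hilbert series\<close>

text \<open>A formal power series in the variables \<open>t\<^sub>i\<close>, \<open>i :: 'm\<close>, is its coefficient function.\<close>

type_synonym 'm mseries = "('m \<Rightarrow> nat) \<Rightarrow> int"

definition t_monomial :: "('m \<Rightarrow> nat) \<Rightarrow> 'm mseries" where
  "t_monomial b = (\<lambda>c. if c = b then 1 else 0)"

definition hilbert_series ::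
  "('a, 'r) ring_scheme \<Rightarrow> 'a set \<Rightarrow> (('m \<Rightarrow> nat) \<Rightarrow> 'a set) \<Rightarrow> 'm mseries" where
  "hilbert_series R K M = (\<lambda>b. int (ring.dim R K (M b)))"

end

theory Submission
  imports Defs "HOL-Library.Function_Algebras"
begin

text \<open>
  Everything is done in the dual picture: \<open>\<bbbF>[\<Delta>]/\<Theta>\<close> is replaced by its inverse system, the functions
  \<open>f\<close> on monomials with support in \<open>\<Delta>\<close> on which every form \<open>\<theta>\<^sub>k\<close> acts by zero, \<open>x\<^sub>v\<close> acting as
  \<open>(x\<^sub>v f)(\<mu>) = f (\<mu> + e\<^sub>v)\<close>. This is \<open>H\<^sup>0\<close> of a Koszul cochain complex, whose Euler characteristic in
  multidegree \<open>b\<close> is \<open>h\<^sub>b\<close>; so the higher cohomology in degree \<open>b\<close> has to be computed. Consider the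
  double complex with Koszul differential in one direction and the dual partition complex
  \<open>\<dots> \<rightarrow> \<Oplus>\<^bsub>|\<tau>| = 2\<^esub> st \<tau> \<rightarrow> \<Oplus>\<^bsub>|\<tau>| = 1\<^esub> st \<tau> \<rightarrow> \<Delta>\<close> in the other.
  Stars of nonempty faces are Koszul acyclic, by induction on the dimension of the link: the
  partition complex of a star is exact except at its end, where its cohomology is a sum of copies
  of the polynomial ring of a simplex, for which multiplication by a variable is null-homotopic.
  The rows of the double complex are simplicial chain complexes of cones, except for the monomial
  \<open>1\<close>, where the row is the reduced chain complex of \<open>\<Delta>\<close>. A monomial \<open>1\<close> in multidegree \<open>b\<close> occurs only
  at Koszul position \<open>|b|\<close>, once for each of the \<open>binom a b\<close> sets of forms of degree \<open>b\<close>; this gives the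
  correction terms \<open>binom a b * \<beta>\<^sub>j\<^sub>-\<^sub>1\<close>.
\<close>

text \<open>Rows and columns fail in complementary places. A monomial of positive degree gives its
  row a cone apex, so only the monomial \<open>1\<close> obstructs exactness of rows; since all
  forms and variables have degree a unit vector, \<open>1\<close> sits at Koszul position |b|, past
  which degree \<open>b\<close> is empty. Dimensions of cocycles are compared along the diagonal
  from (0,0) to (|b|,|b|). One step of it involves a whole column above the diagonal, and the end of
  that column at position |b| contributes one Betti number, signed by the distance to the top. For a
  star the balance is this: with e = d - |\<sigma>|, the polynomial ring on \<sigma> has Koszul
  cohomology only in positions at most e, while the zigzag enters the last column e in a position
  above e. Inverse systems turn cochains into plain functions and make every module a solution space
  of linear equations. The way back is a set of monomials that determines the inverse system in
  degree \<open>b\<close>; it is a basis of the quotient in that degree. The number of forms of each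
  colour is not part of the definition of a parameter system; it is forced by restricting the forms
  to a facet.\<close>

abbreviation keys :: "('a \<Rightarrow>\<^sub>0 'b::zero) \<Rightarrow> 'a set" where "keys \<equiv> Poly_Mapping.keys"
abbreviation lookup :: "('a \<Rightarrow>\<^sub>0 'b::zero) \<Rightarrow> 'a \<Rightarrow> 'b" where "lookup \<equiv> Poly_Mapping.lookup"
abbreviation single :: "'a \<Rightarrow> 'b \<Rightarrow> ('a \<Rightarrow>\<^sub>0 'b::zero)" where "single \<equiv> Poly_Mapping.single"

section \<open>Linear algebra of function spaces\<close>

lemma (in vector_space) finite_basis:
  assumes "U \<subseteq> span X" "finite X"
  obtains B where "B \<subseteq> U" "independent B" "U \<subseteq> span B" "card B = dim U" "finite B"
proof -
  obtain B where B: "B \<subseteq> U" "independent B" "U \<subseteq> span B" "card B = dim U"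
    using basis_exists[of U] .
  moreover have "finite B"
    using independent_span_bound[of X B] assms B by blast
  ultimately show ?thesis using that by blast
qed

text \<open>A basis \<open>A\<close> of the kernel extends to a basis \<open>B\<close> of
  \<open>U\<close>; \<open>f\<close> is injective on the span of \<open>B - A\<close>, which already
  has the full image. The ambient space may be infinite-dimensional, only \<open>U\<close> lies in
  the span of a finite set.\<close>

lemma (in vector_space_pair) dim_kernel_image:
  assumes f: "Vector_Spaces.linear s1 s2 f" and U: "vs1.subspace U" and X: "U \<subseteq> vs1.span X" "finite X"
  shows "vs1.dim U = vs1.dim {x \<in> U. f x = 0} + vs2.dim (f ` U)"
proof -
  interpret f: Vector_Spaces.linear s1 s2 f by fact
  let ?K = "{x \<in> U. f x = 0}"
  have KU: "?K \<subseteq> vs1.span X" using X by auto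
  obtain A where A: "A \<subseteq> ?K" "vs1.independent A" "?K \<subseteq> vs1.span A" "card A = vs1.dim ?K" "finite A"
    using vs1.finite_basis[OF KU X(2)] .
  obtain B where B: "A \<subseteq> B" "B \<subseteq> U" "vs1.independent B" "U \<subseteq> vs1.span B"
    using vs1.maximal_independent_subset_extend[of A U] A by blast
  have finB: "finite B"
    using vs1.independent_span_bound[of X B] X B by blast
  have inj0: "x = 0" if x: "x \<in> vs1.span (B - A)" and fx: "f x = 0" for x
  proof -
    have "x \<in> U" using x vs1.span_minimal[of "B - A" U] B U by blast
    then have "x \<in> vs1.span A" using A fx by blast
    then obtain w where w: "x = (\<Sum>a\<in>A. s1 (w a) a)"
      using vs1.span_finite[OF A(5)] by auto
    obtain u where u: "x = (\<Sum>a\<in>B - A. s1 (u a) a)"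
      using x vs1.span_finite[of "B - A"] finB by auto
    \<comment> \<open>The expansions of \<open>x\<close> over \<open>A\<close> (with a minus sign)
      and over \<open>B - A\<close> are glued into one relation on the independent set
      \<open>B\<close>.\<close>
    let ?z = "\<lambda>a. if a \<in> A then - w a else u a"
    have "(\<Sum>a\<in>B. s1 (?z a) a) = (\<Sum>a\<in>B - A. s1 (?z a) a) + (\<Sum>a\<in>A. s1 (?z a) a)"
      using sum.subset_diff[OF B(1) finB] by blast
    also have "\<dots> = x - x"
      by (simp add: u[symmetric] sum_negf w[symmetric])
    finally have "(\<Sum>a\<in>B. s1 (?z a) a) = 0" by simp
    then have "?z a = 0" if "a \<in> B" for a
      using vs1.independentD[OF B(3) finB subset_refl, of ?z a] that by simp
    then have "u a = 0" if "a \<in> B - A" for a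
      using that by fastforce
    then show "x = 0" by (simp add: u)
  qed
  have inj: "inj_on f (vs1.span (B - A))"
    using linear_inj_on_iff_eq_0[OF f vs1.subspace_span] inj0 by blast
  then have injB: "inj_on f (B - A)"
    by (rule inj_on_subset) (rule vs1.span_superset)
  have ind: "vs2.independent (f ` (B - A))"
    using linear_independent_injective_image[OF f _ inj] vs1.independent_mono[OF B(3)] by blast
  have "f ` U \<subseteq> vs2.span (f ` B)"
    using B(4) linear_span_image[OF f, of B] by blast
  also have "f ` B \<subseteq> insert 0 (f ` (B - A))" using A(1) by auto
  then have "vs2.span (f ` B) \<subseteq> vs2.span (f ` (B - A))"
    using vs2.span_mono vs2.span_insert_0 by metis
  finally have sp: "f ` U \<subseteq> vs2.span (f ` (B - A))" .
  have "vs2.dim (f ` U) = card (f ` (B - A))"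
    by (rule vs2.basis_card_eq_dim[symmetric, OF _ sp ind]) (use B in auto)
  also have "\<dots> = card B - card A"
    using card_image[OF injB] card_Diff_subset[OF A(5) B(1)] by simp
  finally have "vs2.dim (f ` U) = card B - card A" .
  moreover have "card B = vs1.dim U"
    using vs1.basis_card_eq_dim B by blast
  moreover have "card A \<le> card B" by (rule card_mono[OF finB B(1)])
  ultimately show ?thesis using A(4) by simp
qed

lemma (in vector_space_pair) dim_injective_image:
  assumes "Vector_Spaces.linear s1 s2 f" "vs1.subspace U" "U \<subseteq> vs1.span X" "finite X"
    and "\<And>x. x \<in> U \<Longrightarrow> f x = 0 \<Longrightarrow> x = 0"
  shows "vs2.dim (f ` U) = vs1.dim U"
proof -
  interpret Vector_Spaces.linear s1 s2 f by fact
  have "{x \<in> U. f x = 0} = {0}"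
    using assms vs1.subspace_0 zero by auto
  then show ?thesis
    using dim_kernel_image[OF assms(1-4)] vs1.dim_eq_card_independent[of "{}"]
      vs1.dim_span[of "{}"] vs1.independent_empty by simp
qed

lemma (in vector_space) subspace_eq_if_dim_le:
  assumes "subspace U" "U \<subseteq> W" "W \<subseteq> span X" "finite X" "dim W \<le> dim U"
  shows "U = W"
proof -
  have UX: "U \<subseteq> span X" using assms by blast
  obtain A where A: "A \<subseteq> U" "independent A" "U \<subseteq> span A" "card A = dim U" "finite A"
    using finite_basis[OF UX assms(4)] .
  obtain B where B: "A \<subseteq> B" "B \<subseteq> W" "independent B" "W \<subseteq> span B"
    using maximal_independent_subset_extend[of A W] A assms(2) by blast
  have "finite B" using independent_span_bound[of X B] assms B by blast
  moreover have "card B \<le> card A" using basis_card_eq_dim B A assms(5) by metis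
  ultimately have "A = B" using B(1) card_seteq by blast
  then show ?thesis using B A span_minimal[OF A(1) assms(1)] assms(2) by blast
qed

lemma vector_space_field: "vector_space ((*) :: 'f::field \<Rightarrow> 'f \<Rightarrow> 'f)"
  by unfold_locales (simp_all add: algebra_simps)

text \<open>A basis of \<open>J\<close> stays independent when \<open>p\<close> is added, so a
  functional can be prescribed on it. No finiteness enters; the lemma is applied to the space of all
  functions on monomials.\<close>

lemma (in vector_space) functional_separating:
  assumes "subspace J" "p \<notin> J"
  obtains \<phi> where "Vector_Spaces.linear scale (*) \<phi>" "\<And>x. x \<in> J \<Longrightarrow> \<phi> x = 0" "\<phi> p = 1"
proof -
  interpret F: vector_space "(*) :: 'a \<Rightarrow> 'a \<Rightarrow> 'a" by (rule vector_space_field)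
  interpret vector_space_pair scale "(*) :: 'a \<Rightarrow> 'a \<Rightarrow> 'a" ..
  obtain B where B: "B \<subseteq> J" "independent B" "J \<subseteq> span B"
    using maximal_independent_subset[of J] by blast
  have "span B = J" using B span_minimal[OF B(1) assms(1)] by blast
  then have ind: "independent (insert p B)"
    using independent_insertI[of p B] assms(2) B(2) by blast
  obtain g where g: "Vector_Spaces.linear scale (*) g" "\<forall>x\<in>insert p B. g x = (if x = p then 1 else 0)"
    using linear_independent_extend[OF ind, of "\<lambda>x. if x = p then 1 else 0"] by blast
  have "g x = 0" if "x \<in> J" for x
  proof (rule linear_eq_0_on_span[OF g(1)])
    show "x \<in> span B" using that B by blast
    show "g b = 0" if "b \<in> B" for b using g(2) that B assms(2) by auto
  qed
  then show ?thesis using that g by auto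
qed

section \<open>Functions as vectors: supports, unit functions, dual bases\<close>

definition fscale :: "'f \<Rightarrow> ('x \<Rightarrow> 'f) \<Rightarrow> 'x \<Rightarrow> 'f::field" where
  "fscale k c = (\<lambda>x. k * c x)"

lemma fscale_apply: "fscale k c x = k * c x"
  by (simp add: fscale_def)

global_interpretation fn: vector_space fscale
  by unfold_locales (simp_all add: fscale_apply fun_eq_iff algebra_simps)

global_interpretation fn_pair: vector_space_pair fscale fscale ..

definition supported :: "'x set \<Rightarrow> ('x \<Rightarrow> 'f::field) set" where
  "supported X = {c. \<forall>x. c x \<noteq> 0 \<longrightarrow> x \<in> X}"

definition unit_fun :: "'x \<Rightarrow> 'x \<Rightarrow> 'f::field" where
  "unit_fun x = (\<lambda>y. if y = x then 1 else 0)"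

lemma sum_fun_apply: "(\<Sum>i\<in>I. g i) x = (\<Sum>i\<in>I. g i x)"
  by (induction I rule: infinite_finite_induct) auto

lemma supported_eq_sum:
  assumes "finite X" "c \<in> supported X"
  shows "c = (\<Sum>x\<in>X. fscale (c x) (unit_fun x))"
proof
  fix y
  have "(\<Sum>x\<in>X. fscale (c x) (unit_fun x)) y = (\<Sum>x\<in>X. if x = y then c y else 0)"
    unfolding sum_fun_apply by (rule sum.cong) (auto simp: unit_fun_def fscale_apply)
  also have "\<dots> = c y" using assms by (auto simp: supported_def)
  finally show "c y = (\<Sum>x\<in>X. fscale (c x) (unit_fun x)) y" by simp
qed

lemma supported_subset_span:
  assumes "finite X"
  shows "supported X \<subseteq> fn.span (unit_fun ` X)"
proof
  fix c assume "c \<in> supported X"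
  from supported_eq_sum[OF assms this] show "c \<in> fn.span (unit_fun ` X)"
    by (metis (no_types, lifting) fn.span_scale fn.span_base fn.span_sum imageI)
qed

lemma subspace_supported: "fn.subspace (supported X)"
  unfolding fn.subspace_def supported_def by (auto simp: fscale_apply) (metis add_0)

lemma inj_unit_fun: "inj (unit_fun :: 'x \<Rightarrow> 'x \<Rightarrow> 'f::field)"
  by (rule injI) (metis unit_fun_def zero_neq_one)

lemma independent_unit_fun: "fn.independent (unit_fun ` X :: ('x \<Rightarrow> 'f::field) set)"
  unfolding fn.independent_explicit_finite_subsets
proof (intro allI impI ballI)
  fix S :: "('x \<Rightarrow> 'f) set" and u v
  assume S: "S \<subseteq> unit_fun ` X" "finite S" and z: "(\<Sum>v\<in>S. fscale (u v) v) = 0" and v: "v \<in> S"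
  obtain x where x: "v = unit_fun x" using S v by blast
  have "0 = (\<Sum>v\<in>S. fscale (u v) v) x" by (simp add: z)
  also have "\<dots> = (\<Sum>w\<in>S. u w * w x)" by (simp add: sum_fun_apply fscale_apply)
  also have "\<dots> = (\<Sum>w\<in>S. if w = v then u v else 0)"
  proof (rule sum.cong)
    fix w assume "w \<in> S"
    then obtain y where "w = unit_fun y" using S(1) by blast
    then show "u w * w x = (if w = v then u v else 0)"
      using x injD[OF inj_unit_fun, of y x] by (cases "x = y") (auto simp: unit_fun_def)
  qed simp
  also have "\<dots> = u v" using S v by simp
  finally show "u v = 0" by simp
qed

lemma dim_supported:
  assumes "finite X"
  shows "fn.dim (supported X :: ('x \<Rightarrow> 'f::field) set) = card X"
proof -
  have "unit_fun ` X \<subseteq> (supported X :: ('x \<Rightarrow> 'f) set)"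
    by (auto simp: unit_fun_def supported_def split: if_splits)
  then have "fn.dim (supported X :: ('x \<Rightarrow> 'f) set) = card (unit_fun ` X :: ('x \<Rightarrow> 'f) set)"
    by (rule fn.basis_card_eq_dim[symmetric, OF _ supported_subset_span[OF assms] independent_unit_fun])
  also have "\<dots> = card X"
    by (rule card_image) (rule inj_on_subset[OF inj_unit_fun], simp)
  finally show ?thesis .
qed

lemma dim_kernel_image_fn:
  assumes "Vector_Spaces.linear fscale fscale f" "fn.subspace U" "U \<subseteq> supported X" "finite X"
  shows "fn.dim U = fn.dim {x \<in> U. f x = 0} + fn.dim (f ` U)"
  using fn_pair.dim_kernel_image[OF assms(1,2) _ finite_imageI[OF assms(4)], of unit_fun]
    supported_subset_span[OF assms(4)] assms(3) by blast

lemma fn_dim_zero: "fn.dim {0} = 0"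
  by (metis fn.dim_eq_card_independent fn.dim_span fn.independent_empty fn.span_empty card.empty)

text \<open>The space is a direct sum of copies of \<open>U\<close>, one for each index in
  \<open>A\<close>; evaluation at a new index splits off one copy.\<close>

lemma dim_slices:
  fixes U :: "('y \<Rightarrow> 'f::field) set"
  assumes "finite A" "fn.subspace U" "U \<subseteq> supported Y" "finite Y"
  shows "fn.dim {c :: 's \<times> 'y \<Rightarrow> 'f. \<forall>s. (\<lambda>y. c (s, y)) \<in> U \<and> (s \<notin> A \<longrightarrow> (\<forall>y. c (s, y) = 0))}
    = card A * fn.dim U"
  using assms(1)
proof (induction A rule: finite_induct)
  case empty
  have "{c :: 's \<times> 'y \<Rightarrow> 'f. \<forall>s. (\<lambda>y. c (s, y)) \<in> U \<and> (\<forall>y. c (s, y) = 0)} = {0}"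
    using fn.subspace_0[OF assms(2)] by (auto simp: fun_eq_iff zero_fun_def)
  then show ?case by (simp add: fn_dim_zero)
next
  case (insert s A)
  let ?M = "\<lambda>A. {c :: 's \<times> 'y \<Rightarrow> 'f. \<forall>s. (\<lambda>y. c (s, y)) \<in> U \<and> (s \<notin> A \<longrightarrow> (\<forall>y. c (s, y) = 0))}"
  let ?f = "\<lambda>(c :: 's \<times> 'y \<Rightarrow> 'f) y. c (s, y)"
  have lin: "Vector_Spaces.linear fscale fscale ?f"
    by unfold_locales (auto simp: fun_eq_iff fscale_apply)
  have sub: "fn.subspace (?M (insert s A))"
  proof (rule fn.subspaceI)
    fix c d :: "'s \<times> 'y \<Rightarrow> 'f" and k
    assume c: "c \<in> ?M (insert s A)"
    have "(\<lambda>y. (fscale k c) (t, y)) = fscale k (\<lambda>y. c (t, y))" for t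
      by (auto simp: fscale_apply)
    then show "fscale k c \<in> ?M (insert s A)"
      using c fn.subspace_scale[OF assms(2), of _ k] by (auto simp: fscale_apply)
    assume d: "d \<in> ?M (insert s A)"
    have "(\<lambda>y. (c + d) (t, y)) = (\<lambda>y. c (t, y)) + (\<lambda>y. d (t, y))" for t by auto
    then show "c + d \<in> ?M (insert s A)"
      using c d fn.subspace_add[OF assms(2)] by auto
  qed (use fn.subspace_0[OF assms(2)] in \<open>auto simp: zero_fun_def\<close>)
  have fin: "?M (insert s A) \<subseteq> supported (insert s A \<times> Y)"
    using assms(3) unfolding supported_def by fastforce
  have ker: "{c \<in> ?M (insert s A). ?f c = 0} = ?M A"
    using insert(2) by (auto simp: fun_eq_iff)
  have img: "?f ` ?M (insert s A) = U"
  proof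
    show "U \<subseteq> ?f ` ?M (insert s A)"
    proof
      fix u assume u: "u \<in> U"
      have "(\<lambda>y. if t = s then u y else 0) \<in> U" for t
        using u fn.subspace_0[OF assms(2)] by (cases "t = s") (auto simp: zero_fun_def)
      then have "(\<lambda>(t, y). if t = s then u y else 0) \<in> ?M (insert s A)" by auto
      then show "u \<in> ?f ` ?M (insert s A)" by (rule rev_image_eqI) auto
    qed
  qed auto
  show ?case
    using dim_kernel_image_fn[OF lin sub fin] insert assms(4) unfolding ker img by simp
qed

text \<open>Take a smallest set \<open>B\<close> of points on which elements of \<open>A\<close> are
  determined. By minimality some nonzero element of \<open>A\<close> vanishes on
  \<open>B - {x}\<close>, hence not at \<open>x\<close>; rescaled, it is \<open>g x\<close>. For the
  inverse system the points become monomials that form a basis of the quotient.\<close>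

lemma dual_basis_on_points:
  fixes A :: "('x \<Rightarrow> 'f::field) set"
  assumes "finite X" "fn.subspace A" "A \<subseteq> supported X"
  obtains B g where "B \<subseteq> X" "card B = fn.dim A" "\<And>x. x \<in> B \<Longrightarrow> g x \<in> A"
    "\<And>x y. x \<in> B \<Longrightarrow> y \<in> B \<Longrightarrow> g x y = (if x = y then 1 else 0)"
    "\<And>f. f \<in> A \<Longrightarrow> f = (\<Sum>x\<in>B. fscale (f x) (g x))"
proof -
  let ?det = "\<lambda>B. B \<subseteq> X \<and> (\<forall>f\<in>A. (\<forall>x\<in>B. f x = 0) \<longrightarrow> f = 0)"
  have "?det X" using assms(3) by (auto simp: supported_def fun_eq_iff)
  then obtain B where B: "?det B" and min: "\<And>C. ?det C \<Longrightarrow> card B \<le> card C"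
    using ex_has_least_nat[of ?det X card] by blast
  have finB: "finite B" using B assms(1) finite_subset by blast
  have "\<exists>f\<in>A. \<forall>y\<in>B. f y = (if x = y then 1 else 0)" if x: "x \<in> B" for x
  proof -
    have "\<not> ?det (B - {x})" using min[of "B - {x}"] finB x card_Diff1_less[OF finB x] by linarith
    then obtain f where f: "f \<in> A" "\<forall>y\<in>B - {x}. f y = 0" "f \<noteq> 0" using B by blast
    then have "f x \<noteq> 0" using B by (metis DiffI singletonD)
    then show ?thesis
      using f fn.subspace_scale[OF assms(2) f(1), of "inverse (f x)"]
      by (intro bexI[of _ "fscale (inverse (f x)) f"]) (auto simp: fscale_apply)
  qed
  then obtain g where g: "\<And>x. x \<in> B \<Longrightarrow> g x \<in> A"
    "\<And>x y. x \<in> B \<Longrightarrow> y \<in> B \<Longrightarrow> g x y = (if x = y then 1 else 0)" by metis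
  have exp: "f = (\<Sum>x\<in>B. fscale (f x) (g x))" if f: "f \<in> A" for f
  proof -
    let ?h = "f - (\<Sum>x\<in>B. fscale (f x) (g x))"
    have "?h \<in> A"
      using f g(1) by (intro fn.subspace_diff fn.subspace_sum fn.subspace_scale assms(2))
    moreover have "?h y = 0" if y: "y \<in> B" for y
    proof -
      have "(\<Sum>x\<in>B. fscale (f x) (g x)) y = (\<Sum>x\<in>B. if x = y then f y else 0)"
        unfolding sum_fun_apply by (rule sum.cong) (use g(2) y in \<open>auto simp: fscale_apply\<close>)
      also have "\<dots> = f y" using finB y by simp
      finally show ?thesis by simp
    qed
    ultimately have "?h = 0" using B by blast
    then show ?thesis by simp
  qed
  have inj: "inj_on g B" using g(2) by (metis inj_onI zero_neq_one)
  have "fn.independent (g ` B)"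
    unfolding fn.independent_explicit_finite_subsets
  proof (intro allI impI ballI)
    fix S :: "('x \<Rightarrow> 'f) set" and u v assume S: "S \<subseteq> g ` B" "finite S" "(\<Sum>v\<in>S. fscale (u v) v) = 0" "v \<in> S"
    then obtain x where x: "x \<in> B" "v = g x" by blast
    have "0 = (\<Sum>w\<in>S. fscale (u w) w) x" by (simp add: S)
    also have "\<dots> = (\<Sum>w\<in>S. u w * w x)" by (simp add: sum_fun_apply fscale_apply)
    also have "\<dots> = (\<Sum>w\<in>S. if w = v then u v else 0)"
    proof (rule sum.cong)
      fix w assume "w \<in> S"
      then obtain y where "y \<in> B" "w = g y" using S(1) by blast
      then show "u w * w x = (if w = v then u v else 0)"
        using g(2)[of y x] g(2)[of x x] x by (cases "x = y") auto
    qed simp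
    also have "\<dots> = u v" using S by simp
    finally show "u v = 0" by simp
  qed
  moreover have "A \<subseteq> fn.span (g ` B)"
    using exp by (metis (no_types, lifting) fn.span_base fn.span_scale fn.span_sum imageI subsetI)
  ultimately have "fn.dim A = card (g ` B)"
    by (intro fn.basis_card_eq_dim[symmetric]) (use g(1) in auto)
  then have "card B = fn.dim A" by (simp add: card_image[OF inj])
  then show ?thesis using that B g exp by blast
qed

lemma linear_fscaleI:
  assumes "\<And>x y p. f (x + y) p = f x p + f y p" "\<And>k x p. f (fscale k x) p = k * f x p"
  shows "Vector_Spaces.linear fscale fscale f"
  by unfold_locales (simp_all add: fun_eq_iff assms fscale_apply)

section \<open>Signs and the two differentials\<close>

text \<open>The sign of moving \<open>v\<close> to its place in the ordered set \<open>S\<close>. As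
  \<open>v\<close> itself is not counted, it makes no difference whether \<open>S\<close> contains
  it.\<close>

definition sg :: "'a::linorder \<Rightarrow> 'a set \<Rightarrow> 'f::comm_ring_1" where
  "sg v S = (- 1) ^ card {w \<in> S. w < v}"

lemma sg_sq: "sg v S * sg v S = (1 :: 'f::comm_ring_1)"
  by (simp add: sg_def flip: power_add mult_2)

lemma sg_insert_self [simp]: "sg v (insert v S) = sg v S"
proof -
  have "{w \<in> insert v S. w < v} = {w \<in> S. w < v}" by auto
  then show ?thesis by (simp add: sg_def)
qed

lemma sg_remove_self [simp]: "sg v (S - {v}) = sg v S"
  by (metis insert_Diff_single sg_insert_self)

lemma sg_insert:
  assumes "finite S" "u \<notin> S" "u \<noteq> v"
  shows "sg v (insert u S) = (if u < v then - sg v S else sg v S :: 'f::comm_ring_1)"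
proof (cases "u < v")
  case True
  then have "{w \<in> insert u S. w < v} = insert u {w \<in> S. w < v}" by auto
  then show ?thesis using True assms by (simp add: sg_def)
next
  case False
  then have "{w \<in> insert u S. w < v} = {w \<in> S. w < v}" by auto
  then show ?thesis using False by (simp add: sg_def)
qed

text \<open>Inserting \<open>u\<close> and \<open>v\<close> in the two possible orders differs by a
  transposition. The first form serves the homotopy formulas, the second the vanishing of the
  squares of the differentials.\<close>

lemma sg_swap:
  assumes "finite S" "u \<notin> S" "v \<notin> S" "u \<noteq> v"
  shows "sg v (insert u S) * sg u (insert v S) = - (sg u S * sg v S :: 'f::comm_ring_1)"
    and "sg u S * sg v (insert u S) = - (sg v S * sg u (insert v S) :: 'f)"
  using assms by (auto simp: sg_insert less_not_sym mult.commute not_less)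

lemma sum_antisymmetric_eq_0:
  fixes g :: "'a::linorder \<Rightarrow> 'a \<Rightarrow> 'f::ab_group_add"
  assumes "finite A" and anti: "\<And>x y. x \<in> A \<Longrightarrow> y \<in> A \<Longrightarrow> x < y \<Longrightarrow> g x y = - g y x"
  shows "(\<Sum>x\<in>A. \<Sum>y\<in>A - {x}. g x y) = 0"
proof -
  have "(\<Sum>x\<in>A. \<Sum>y\<in>A - {x}. g x y) =
      (\<Sum>x\<in>A. (\<Sum>y\<in>A. if x < y then g x y else 0) + (\<Sum>y\<in>A. if y < x then g x y else 0))"
  proof (rule sum.cong[OF refl])
    fix x assume x: "x \<in> A"
    have "(\<Sum>y\<in>A - {x}. g x y) = (\<Sum>y\<in>A. if y \<noteq> x then g x y else 0)"
      using assms(1) by (intro sum.mono_neutral_cong_left) auto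
    also have "\<dots> = (\<Sum>y\<in>A. (if x < y then g x y else 0) + (if y < x then g x y else 0))"
      by (rule sum.cong) auto
    finally show "(\<Sum>y\<in>A - {x}. g x y) =
      (\<Sum>y\<in>A. if x < y then g x y else 0) + (\<Sum>y\<in>A. if y < x then g x y else 0)"
      by (simp only: sum.distrib)
  qed
  also have "\<dots> = (\<Sum>x\<in>A. \<Sum>y\<in>A. if x < y then g x y else 0) + (\<Sum>x\<in>A. \<Sum>y\<in>A. if y < x then g x y else 0)"
    by (simp only: sum.distrib)
  also have "(\<Sum>x\<in>A. \<Sum>y\<in>A. if y < x then g x y else 0) = (\<Sum>y\<in>A. \<Sum>x\<in>A. if y < x then g x y else 0)"
    by (rule sum.swap)
  also have "(\<Sum>x\<in>A. \<Sum>y\<in>A. if x < y then g x y else 0) = - \<dots>"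
    unfolding sum_negf[symmetric] using anti by (intro sum.cong) auto
  finally show ?thesis by simp
qed

abbreviation var_exp :: "'v \<Rightarrow> 'v \<Rightarrow>\<^sub>0 nat" where
  "var_exp v \<equiv> single v (Suc 0)"

lemma keys_plus_nat: "keys (\<mu> + \<nu>) = keys \<mu> \<union> keys (\<nu> :: 'v \<Rightarrow>\<^sub>0 nat)"
  by (auto simp: in_keys_iff lookup_add)

lemma keys_plus_var_exp [simp]: "keys (\<mu> + var_exp v) = insert v (keys \<mu>)"
  by (simp add: keys_plus_nat)

text \<open>The contraction action: a function \<open>f\<close> on monomials stands for the linear functional
  \<open>x\<^sup>\<mu> \<mapsto> f \<mu>\<close>, and \<open>x\<^sub>v\<close> acts as the transpose of multiplication by \<open>x\<^sub>v\<close>. Hence the cochain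
  complex \<open>dl\<close> below is dual to the Koszul complex of the forms \<open>th 0, ..., th (d - 1)\<close>.\<close>

type_synonym 'v cell = "nat set \<times> 'v set \<times> ('v \<Rightarrow>\<^sub>0 nat)"
type_synonym ('v, 'f) cell_fun = "'v cell \<Rightarrow> 'f"

section \<open>The two differentials of a family of linear forms\<close>

locale forms =
  fixes V :: "'v::linorder set" and d :: nat and th :: "nat \<Rightarrow> 'v \<Rightarrow> 'f::field"
  assumes finite_V: "finite V"
begin

definition dl :: "('v, 'f) cell_fun \<Rightarrow> ('v, 'f) cell_fun" where
  "dl c = (\<lambda>(S, \<tau>, \<mu>). if S \<subseteq> {..<d}
     then \<Sum>k\<in>S. sg k S * (\<Sum>v\<in>V. th k v * c (S - {k}, \<tau>, \<mu> + var_exp v)) else 0)"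

text \<open>The simplicial boundary written in coefficients: the value at \<open>\<tau>\<close>
  collects the faces with one more vertex in the full simplex on \<open>V\<close>. Subcomplexes
  enter only through supports.\<close>

definition bdc :: "('v set \<Rightarrow> 'f) \<Rightarrow> 'v set \<Rightarrow> 'f" where
  "bdc g = (\<lambda>\<tau>. if \<tau> \<subseteq> V then \<Sum>v\<in>V - \<tau>. sg v \<tau> * g (insert v \<tau>) else 0)"

definition bd :: "('v, 'f) cell_fun \<Rightarrow> ('v, 'f) cell_fun" where
  "bd c = (\<lambda>(S, \<tau>, \<mu>). bdc (\<lambda>\<tau>. c (S, \<tau>, \<mu>)) \<tau>)"

lemma bd_apply: "bd c (S, \<tau>, \<mu>) = bdc (\<lambda>\<tau>. c (S, \<tau>, \<mu>)) \<tau>"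
  by (simp add: bd_def)

lemma linear_bdc: "Vector_Spaces.linear fscale fscale bdc"
proof (rule linear_fscaleI)
  fix x y :: "'v set \<Rightarrow> 'f" and k p
  show "bdc (x + y) p = bdc x p + bdc y p"
    by (simp add: bdc_def distrib_left sum.distrib)
  show "bdc (fscale k x) p = k * bdc x p"
    by (simp add: bdc_def fscale_apply sum_distrib_left mult.left_commute)
qed

lemma linear_dl: "Vector_Spaces.linear fscale fscale dl"
proof (rule linear_fscaleI)
  fix x y :: "('v, 'f) cell_fun" and k and p :: "'v cell"
  obtain S \<tau> \<mu> where p: "p = (S, \<tau>, \<mu>)" by (cases p)
  show "dl (x + y) p = dl x p + dl y p"
    by (simp add: p dl_def distrib_left sum.distrib)
  show "dl (fscale k x) p = k * dl x p"
    by (simp add: p dl_def fscale_apply sum_distrib_left mult.left_commute)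
qed

lemma linear_bd: "Vector_Spaces.linear fscale fscale bd"
proof (rule linear_fscaleI)
  fix x y :: "('v, 'f) cell_fun" and k and p :: "'v cell"
  obtain S \<tau> \<mu> where p: "p = (S, \<tau>, \<mu>)" by (cases p)
  show "bd (x + y) p = bd x p + bd y p"
    by (simp add: p bd_def bdc_def distrib_left sum.distrib)
  show "bd (fscale k x) p = k * bd x p"
    by (simp add: p bd_def bdc_def fscale_apply sum_distrib_left mult.left_commute)
qed

sublocale bdc: Vector_Spaces.linear fscale fscale bdc by (rule linear_bdc)
sublocale dl: Vector_Spaces.linear fscale fscale dl by (rule linear_dl)
sublocale bd: Vector_Spaces.linear fscale fscale bd by (rule linear_bd)

lemma bdc_bdc: "bdc (bdc g) = 0"
proof
  fix \<tau>
  show "bdc (bdc g) \<tau> = 0 \<tau>"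
  proof (cases "\<tau> \<subseteq> V")
    case True
    then have fin: "finite \<tau>" using finite_V finite_subset by blast
    have "bdc (bdc g) \<tau> = (\<Sum>v\<in>V - \<tau>. \<Sum>u\<in>V - \<tau> - {v}. sg v \<tau> * sg u (insert v \<tau>) * g (insert u (insert v \<tau>)))"
    proof -
      have D: "V - insert v \<tau> = V - \<tau> - {v}" for v by auto
      show ?thesis
        unfolding bdc_def using True
        by (auto intro!: sum.cong simp: sum_distrib_left mult.assoc D)
    qed
    also have "\<dots> = 0"
    proof (rule sum_antisymmetric_eq_0)
      fix x y assume "x \<in> V - \<tau>" "y \<in> V - \<tau>" "x < y"
      then show "sg x \<tau> * sg y (insert x \<tau>) * g (insert y (insert x \<tau>)) =
        - (sg y \<tau> * sg x (insert y \<tau>) * g (insert x (insert y \<tau>)))"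
        using sg_swap(2)[OF fin, of x y, where 'f='f] by (auto simp: insert_commute)
    qed (use finite_V in simp)
    finally show ?thesis by simp
  qed (simp add: bdc_def)
qed

lemma bd_bd: "bd (bd c) = 0"
  using bdc_bdc by (auto simp: fun_eq_iff bd_def)

text \<open>The iterated action \<open>?q k l\<close> is symmetric in the two forms, while removing
  \<open>k\<close> and \<open>l\<close> in the two orders gives opposite signs.\<close>

lemma dl_dl: "dl (dl c) = 0"
proof
  fix x :: "'v cell"
  obtain S \<tau> \<mu> where x: "x = (S, \<tau>, \<mu>)" by (cases x)
  show "dl (dl c) x = 0 x"
  proof (cases "S \<subseteq> {..<d}")
    case True
    then have fin: "finite S" using finite_subset by blast
    let ?q = "\<lambda>k l. (\<Sum>v\<in>V. \<Sum>u\<in>V. th k v * th l u * c (S - {k} - {l}, \<tau>, \<mu> + var_exp v + var_exp u))"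
    have q: "?q k l = ?q l k" for k l
    proof -
      have c: "c (S - {k} - {l}, \<tau>, \<mu> + var_exp v + var_exp u) =
          c (S - {l} - {k}, \<tau>, \<mu> + var_exp u + var_exp v)" for u v
        by (intro arg_cong[of _ _ c]) (auto simp: ac_simps)
      have "?q k l = (\<Sum>u\<in>V. \<Sum>v\<in>V. th k v * th l u * c (S - {k} - {l}, \<tau>, \<mu> + var_exp v + var_exp u))"
        by (rule sum.swap)
      also have "\<dots> = ?q l k" by (simp only: c mult.commute)
      finally show ?thesis .
    qed
    have "dl (dl c) x = (\<Sum>k\<in>S. sg k S * (\<Sum>v\<in>V. th k v * (\<Sum>l\<in>S - {k}. sg l (S - {k}) *
        (\<Sum>u\<in>V. th l u * c (S - {k} - {l}, \<tau>, \<mu> + var_exp v + var_exp u)))))"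
    proof -
      have "S - {k} \<subseteq> {..<d}" for k using True by blast
      then show ?thesis using True by (simp add: x dl_def)
    qed
    also have "\<dots> = (\<Sum>k\<in>S. \<Sum>l\<in>S - {k}. sg k S * sg l (S - {k}) * ?q k l)"
    proof (rule sum.cong[OF refl])
      fix k assume "k \<in> S"
      show "sg k S * (\<Sum>v\<in>V. th k v * (\<Sum>l\<in>S - {k}. sg l (S - {k}) *
        (\<Sum>u\<in>V. th l u * c (S - {k} - {l}, \<tau>, \<mu> + var_exp v + var_exp u)))) =
        (\<Sum>l\<in>S - {k}. sg k S * sg l (S - {k}) * ?q k l)"
        unfolding sum_distrib_left by (subst sum.swap) (simp add: mult_ac)
    qed
    also have "\<dots> = 0"
    proof (rule sum_antisymmetric_eq_0[OF fin])
      fix k l assume kl: "k \<in> S" "l \<in> S" "k < l"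
      define T where "T = S - {k} - {l}"
      have S: "S = insert k (insert l T)" using kl by (auto simp: T_def)
      have "S - {k} = insert l T" "S - {l} = insert k T" using kl by (auto simp: T_def)
      moreover have "sg k S = (sg k (insert l T) :: 'f)" "sg l S = (sg l (insert k T) :: 'f)"
        unfolding S by (simp, subst insert_commute, simp)
      moreover have "sg k T * sg l (insert k T) = - (sg l T * sg k (insert l T) :: 'f)"
        by (rule sg_swap(2)) (use kl fin in \<open>auto simp: T_def\<close>)
      ultimately have "sg k S * sg l (S - {k}) = - (sg l S * sg k (S - {l}) :: 'f)"
        by (simp add: mult.commute)
      then show "sg k S * sg l (S - {k}) * ?q k l = - (sg l S * sg k (S - {l}) * ?q l k)"
        using q[of k l] by simp
    qed
    finally show ?thesis by simp
  qed (simp add: x dl_def)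
qed

text \<open>The differentials act on different components of a cell and commute without a sign, so
  the diagram chases below work with commuting squares.\<close>

lemma dl_bd: "dl (bd c) = bd (dl c)"
proof
  fix x :: "'v cell"
  obtain S \<tau> \<mu> where x: "x = (S, \<tau>, \<mu>)" by (cases x)
  show "dl (bd c) x = bd (dl c) x"
  proof (cases "S \<subseteq> {..<d} \<and> \<tau> \<subseteq> V")
    case True
    then have "dl (bd c) x = (\<Sum>k\<in>S. \<Sum>u\<in>V. \<Sum>v\<in>V - \<tau>.
        sg k S * th k u * sg v \<tau> * c (S - {k}, insert v \<tau>, \<mu> + var_exp u))"
      unfolding x by (simp add: dl_def bd_def bdc_def sum_distrib_left mult_ac)
    also have "\<dots> = (\<Sum>k\<in>S. \<Sum>v\<in>V - \<tau>. \<Sum>u\<in>V.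
        sg k S * th k u * sg v \<tau> * c (S - {k}, insert v \<tau>, \<mu> + var_exp u))"
      by (rule sum.cong[OF refl sum.swap])
    also have "\<dots> = (\<Sum>v\<in>V - \<tau>. \<Sum>k\<in>S. \<Sum>u\<in>V.
        sg k S * th k u * sg v \<tau> * c (S - {k}, insert v \<tau>, \<mu> + var_exp u))"
      by (rule sum.swap)
    also have "\<dots> = bd (dl c) x"
      unfolding x using True by (simp add: dl_def bd_def bdc_def sum_distrib_left mult_ac)
    finally show ?thesis .
  qed (auto simp: x dl_def bd_def bdc_def)
qed

section \<open>Null-homotopies: cones and contractions of the Koszul complex\<close>

definition cone :: "'v \<Rightarrow> ('v set \<Rightarrow> 'f) \<Rightarrow> 'v set \<Rightarrow> 'f" where
  "cone u g = (\<lambda>\<tau>. if u \<in> \<tau> then sg u \<tau> * g (\<tau> - {u}) else 0)"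

text \<open>The contraction of the full simplex on \<open>V\<close> to \<open>u\<close>. If
  \<open>u\<close> is not in \<open>\<tau>\<close>, only the summand \<open>v = u\<close> of the
  boundary survives; if it is, all summands except \<open>g \<tau>\<close> cancel by exchange of
  signs.\<close>

lemma bdc_cone:
  assumes "u \<in> V" "\<tau> \<subseteq> V"
  shows "bdc (cone u g) \<tau> + cone u (bdc g) \<tau> = g \<tau>"
proof (cases "u \<in> \<tau>")
  case False
  have "bdc (cone u g) \<tau> = (\<Sum>v\<in>V - \<tau>. if v = u then sg u \<tau> * (sg u \<tau> * g \<tau>) else 0)"
    unfolding bdc_def cone_def using assms False by (auto intro!: sum.cong)
  also have "\<dots> = g \<tau>"
    using assms False finite_V sg_sq[of u \<tau>, where 'f='f] by (simp flip: mult.assoc)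
  finally show ?thesis using False by (simp add: cone_def)
next
  case True
  define \<rho> where "\<rho> = \<tau> - {u}"
  have \<rho>: "\<tau> = insert u \<rho>" "u \<notin> \<rho>" "finite \<rho>" "\<rho> \<subseteq> V"
    using True assms finite_subset[OF assms(2) finite_V] by (auto simp: \<rho>_def)
  have VS: "V - \<rho> = insert u (V - \<tau>)" using \<rho> assms by auto
  have 1: "cone u (bdc g) \<tau> = sg u \<rho> * (sg u \<rho> * g \<tau> + (\<Sum>v\<in>V - \<tau>. sg v \<rho> * g (insert v \<rho>)))"
  proof -
    have "cone u (bdc g) \<tau> = sg u \<rho> * bdc g \<rho>"
      using True by (simp add: cone_def \<rho>_def)
    also have "bdc g \<rho> = (\<Sum>v\<in>insert u (V - \<tau>). sg v \<rho> * g (insert v \<rho>))"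
      using \<rho>(4) by (simp add: bdc_def VS)
    also have "\<dots> = sg u \<rho> * g \<tau> + (\<Sum>v\<in>V - \<tau>. sg v \<rho> * g (insert v \<rho>))"
      using True finite_V by (simp flip: \<rho>(1))
    finally show ?thesis .
  qed
  have 2: "sg u \<rho> * (sg u \<rho> * g \<tau> + (\<Sum>v\<in>V - \<tau>. sg v \<rho> * g (insert v \<rho>))) =
      g \<tau> + (\<Sum>v\<in>V - \<tau>. sg u \<rho> * sg v \<rho> * g (insert v \<rho>))"
    using sg_sq[of u \<rho>, where 'f='f] by (simp add: distrib_left sum_distrib_left flip: mult.assoc)
  have "bdc (cone u g) \<tau> = (\<Sum>v\<in>V - \<tau>. sg v \<tau> * (sg u (insert v \<tau>) * g (insert v \<rho>)))"
    unfolding bdc_def cone_def using assms True \<rho>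
    by (auto intro!: sum.cong arg_cong[of _ _ g])
  also have "\<dots> = (\<Sum>v\<in>V - \<tau>. - (sg u \<rho> * sg v \<rho> * g (insert v \<rho>)))"
  proof (rule sum.cong[OF refl])
    fix v assume v: "v \<in> V - \<tau>"
    have "sg u (insert v \<tau>) = (sg u (insert v \<rho>) :: 'f)"
      unfolding \<rho>(1) by (subst insert_commute) simp
    moreover have "sg v \<tau> = (sg v (insert u \<rho>) :: 'f)" by (simp only: \<rho>(1))
    ultimately have "sg v \<tau> * sg u (insert v \<tau>) = - (sg u \<rho> * sg v \<rho> :: 'f)"
      using sg_swap(1)[of \<rho> u v, where 'f='f] v \<rho> by auto
    then show "sg v \<tau> * (sg u (insert v \<tau>) * g (insert v \<rho>)) = - (sg u \<rho> * sg v \<rho> * g (insert v \<rho>))"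
      by (simp flip: mult.assoc)
  qed
  finally show ?thesis using 1 2 by (simp add: sum_negf)
qed

text \<open>Contraction with the vector \<open>a\<close>, which lowers the Koszul position by
  one.\<close>

definition homotopy :: "(nat \<Rightarrow> 'f) \<Rightarrow> ('v, 'f) cell_fun \<Rightarrow> ('v, 'f) cell_fun" where
  "homotopy a c = (\<lambda>(S, \<tau>, \<mu>). if S \<subseteq> {..<d}
     then \<Sum>k\<in>{..<d} - S. a k * sg k S * c (insert k S, \<tau>, \<mu>) else 0)"

text \<open>The Cartan formula: contraction with \<open>a\<close> is a null-homotopy for the action
  of the combined form with coefficients \<open>a k\<close>. Terms that insert and remove the same
  index give this action; terms that exchange an index of \<open>S\<close> for one outside it
  cancel.\<close>

lemma dl_homotopy:
  assumes S: "S \<subseteq> {..<d}"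
  shows "dl (homotopy a c) (S, \<tau>, \<mu>) + homotopy a (dl c) (S, \<tau>, \<mu>) =
    (\<Sum>k<d. a k * (\<Sum>v\<in>V. th k v * c (S, \<tau>, \<mu> + var_exp v)))"
proof -
  have fin: "finite S" using S finite_subset by blast
  let ?t = "\<lambda>k T. \<Sum>v\<in>V. th k v * c (T, \<tau>, \<mu> + var_exp v)"
  let ?x = "\<lambda>k l. sg k S * (sg l (S - {k}) * (a l * ?t k (insert l (S - {k}))))"
  have "dl (homotopy a c) (S, \<tau>, \<mu>) =
      (\<Sum>k\<in>S. sg k S * (\<Sum>v\<in>V. th k v * homotopy a c (S - {k}, \<tau>, \<mu> + var_exp v)))"
    using S by (simp add: dl_def)
  also have "\<dots> = (\<Sum>k\<in>S. a k * ?t k S + (\<Sum>l\<in>{..<d} - S. ?x k l))"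
  proof (rule sum.cong[OF refl])
    fix k assume k: "k \<in> S"
    have D: "{..<d} - (S - {k}) = insert k ({..<d} - S)" using k S by auto
    have "(\<Sum>v\<in>V. th k v * homotopy a c (S - {k}, \<tau>, \<mu> + var_exp v)) =
      (\<Sum>v\<in>V. th k v * (a k * sg k S * c (S, \<tau>, \<mu> + var_exp v) +
         (\<Sum>l\<in>{..<d} - S. a l * sg l (S - {k}) * c (insert l (S - {k}), \<tau>, \<mu> + var_exp v))))"
      using k S by (intro sum.cong refl) (auto simp: homotopy_def D insert_absorb)
    also have "\<dots> = sg k S * (a k * ?t k S) + (\<Sum>l\<in>{..<d} - S. sg l (S - {k}) * (a l * ?t k (insert l (S - {k}))))"
      unfolding distrib_left sum.distrib sum_distrib_left
      by (subst (2) sum.swap) (simp add: mult_ac)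
    finally show "sg k S * (\<Sum>v\<in>V. th k v * homotopy a c (S - {k}, \<tau>, \<mu> + var_exp v)) =
      a k * ?t k S + (\<Sum>l\<in>{..<d} - S. ?x k l)"
      using sg_sq[of k S, where 'f='f]
      by (simp add: distrib_left sum_distrib_left flip: mult.assoc)
  qed
  also have "\<dots> = (\<Sum>k\<in>S. a k * ?t k S) + (\<Sum>k\<in>S. \<Sum>l\<in>{..<d} - S. ?x k l)"
    by (rule sum.distrib)
  finally have 1: "dl (homotopy a c) (S, \<tau>, \<mu>) = (\<Sum>k\<in>S. a k * ?t k S) + (\<Sum>k\<in>S. \<Sum>l\<in>{..<d} - S. ?x k l)" .
  have "homotopy a (dl c) (S, \<tau>, \<mu>) = (\<Sum>l\<in>{..<d} - S. a l * sg l S * dl c (insert l S, \<tau>, \<mu>))"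
    using S by (simp add: homotopy_def)
  also have "\<dots> = (\<Sum>l\<in>{..<d} - S. a l * ?t l S + (\<Sum>k\<in>S. - ?x k l))"
  proof (rule sum.cong[OF refl])
    fix l assume l: "l \<in> {..<d} - S"
    have "dl c (insert l S, \<tau>, \<mu>) = sg l S * ?t l S + (\<Sum>k\<in>S. sg k (insert l S) * ?t k (insert l S - {k}))"
      using l S fin by (simp add: dl_def)
    moreover have "a l * sg l S * (sg k (insert l S) * ?t k (insert l S - {k})) = - ?x k l" if k: "k \<in> S" for k
    proof -
      define T where "T = S - {k}"
      have T: "S = insert k T" "k \<notin> T" "l \<notin> T" "k \<noteq> l" "finite T"
        using k l fin by (auto simp: T_def)
      have e: "insert l S - {k} = insert l T" using T by auto
      have "sg k (insert l S) = (sg k (insert l T) :: 'f)"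
        unfolding T(1) by (subst insert_commute) simp
      moreover have "sg k S = (sg k T :: 'f)" by (simp add: T(1))
      moreover have "sg l S * sg k (insert l T) = - (sg k T * sg l T :: 'f)"
        using sg_swap(1)[of T k l, where 'f='f] T by simp
      ultimately have "sg l S * sg k (insert l S) = - (sg k S * sg l T :: 'f)" by simp
      then have "a l * (sg l S * sg k (insert l S)) * ?t k (insert l T) =
          a l * - (sg k S * sg l T) * ?t k (insert l T)" by simp
      then show ?thesis unfolding T_def[symmetric] e by (simp add: mult_ac)
    qed
    then have "a l * sg l S * (\<Sum>k\<in>S. sg k (insert l S) * ?t k (insert l S - {k})) = (\<Sum>k\<in>S. - ?x k l)"
      unfolding sum_distrib_left by (rule sum.cong[OF refl])
    ultimately show "a l * sg l S * dl c (insert l S, \<tau>, \<mu>) = a l * ?t l S + (\<Sum>k\<in>S. - ?x k l)"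
      using sg_sq[of l S, where 'f='f]
      by (simp add: distrib_left mult.assoc)
  qed
  also have "\<dots> = (\<Sum>l\<in>{..<d} - S. a l * ?t l S) + (\<Sum>l\<in>{..<d} - S. \<Sum>k\<in>S. - ?x k l)"
    by (rule sum.distrib)
  also have "(\<Sum>l\<in>{..<d} - S. \<Sum>k\<in>S. - ?x k l) = - (\<Sum>k\<in>S. \<Sum>l\<in>{..<d} - S. ?x k l)"
    by (subst sum.swap) (simp add: sum_negf)
  finally show ?thesis
    using 1 sum.subset_diff[OF S, of "\<lambda>k. a k * ?t k S"] by simp
qed

end

section \<open>Acyclicity\<close>

context forms
begin

text \<open>On the vertices of \<open>\<rho>\<close> every coordinate function is a combination of
  the forms; on faces this is what a linear system of parameters provides.\<close>

definition spanning :: "'v set \<Rightarrow> bool" where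
  "spanning \<rho> \<longleftrightarrow> (\<forall>v\<in>\<rho>. \<exists>a. \<forall>u\<in>\<rho>. (\<Sum>k<d. a k * th k u) = (if u = v then 1 else 0))"

lemma spanning_mono: "spanning \<rho> \<Longrightarrow> \<rho>' \<subseteq> \<rho> \<Longrightarrow> spanning \<rho>'"
  unfolding spanning_def by (meson subset_iff)

lemma dl_nonzeroE:
  assumes "dl c (S, \<tau>, \<mu>) \<noteq> 0"
  obtains k v where "S \<subseteq> {..<d}" "k \<in> S" "v \<in> V" "th k v \<noteq> 0" "c (S - {k}, \<tau>, \<mu> + var_exp v) \<noteq> 0"
proof -
  have S: "S \<subseteq> {..<d}" using assms by (auto simp: dl_def split: if_splits)
  then have "(\<Sum>k\<in>S. sg k S * (\<Sum>v\<in>V. th k v * c (S - {k}, \<tau>, \<mu> + var_exp v))) \<noteq> 0"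
    using assms by (simp add: dl_def)
  then obtain k where k: "k \<in> S" "(\<Sum>v\<in>V. th k v * c (S - {k}, \<tau>, \<mu> + var_exp v)) \<noteq> 0"
    by (metis (no_types, lifting) mult_zero_right sum.neutral)
  then obtain v where "v \<in> V" "th k v * c (S - {k}, \<tau>, \<mu> + var_exp v) \<noteq> 0"
    by (metis (no_types, lifting) sum.neutral)
  then show ?thesis using S k that by auto
qed

lemma bd_nonzeroE:
  assumes "bd c (S, \<tau>, \<mu>) \<noteq> 0"
  obtains v where "\<tau> \<subseteq> V" "v \<in> V - \<tau>" "c (S, insert v \<tau>, \<mu>) \<noteq> 0"
proof -
  have S: "\<tau> \<subseteq> V" using assms by (auto simp: bd_def bdc_def split: if_splits)
  then have "(\<Sum>v\<in>V - \<tau>. sg v \<tau> * c (S, insert v \<tau>, \<mu>)) \<noteq> 0"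
    using assms by (simp add: bd_def bdc_def)
  then obtain v where "v \<in> V - \<tau>" "sg v \<tau> * c (S, insert v \<tau>, \<mu>) \<noteq> 0"
    by (metis (no_types, lifting) sum.neutral)
  then show ?thesis using S that by auto
qed

lemma homotopy_nonzeroE:
  assumes "homotopy a c (S, \<tau>, \<mu>) \<noteq> 0"
  obtains k where "S \<subseteq> {..<d}" "k \<in> {..<d} - S" "c (insert k S, \<tau>, \<mu>) \<noteq> 0"
proof -
  have S: "S \<subseteq> {..<d}" using assms by (auto simp: homotopy_def split: if_splits)
  then have "(\<Sum>k\<in>{..<d} - S. a k * sg k S * c (insert k S, \<tau>, \<mu>)) \<noteq> 0"
    using assms by (simp add: homotopy_def)
  then obtain k where "k \<in> {..<d} - S" "a k * sg k S * c (insert k S, \<tau>, \<mu>) \<noteq> 0"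
    by (metis (no_types, lifting) sum.neutral)
  then show ?thesis using S that by auto
qed

lemma subspace_slice_dl:
  assumes "fn.subspace Z" "\<forall>S \<mu>. (\<lambda>\<tau>. c (S, \<tau>, \<mu>)) \<in> Z"
  shows "(\<lambda>\<tau>. dl c (S, \<tau>, \<mu>)) \<in> Z"
proof (cases "S \<subseteq> {..<d}")
  case True
  then have "(\<lambda>\<tau>. dl c (S, \<tau>, \<mu>)) =
    (\<Sum>k\<in>S. fscale (sg k S) (\<Sum>v\<in>V. fscale (th k v) (\<lambda>\<tau>. c (S - {k}, \<tau>, \<mu> + var_exp v))))"
    by (auto simp: dl_def fun_eq_iff sum_fun_apply fscale_apply)
  then show ?thesis
    using assms(2) by (auto intro!: fn.subspace_sum fn.subspace_scale assms(1))
next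
  case False
  then show ?thesis using fn.subspace_0[OF assms(1)] by (simp add: dl_def zero_fun_def)
qed

lemma subspace_slice_homotopy:
  assumes "fn.subspace Z" "\<forall>S \<mu>. (\<lambda>\<tau>. c (S, \<tau>, \<mu>)) \<in> Z"
  shows "(\<lambda>\<tau>. homotopy a c (S, \<tau>, \<mu>)) \<in> Z"
proof (cases "S \<subseteq> {..<d}")
  case True
  then have "(\<lambda>\<tau>. homotopy a c (S, \<tau>, \<mu>)) =
    (\<Sum>k\<in>{..<d} - S. fscale (a k * sg k S) (\<lambda>\<tau>. c (insert k S, \<tau>, \<mu>)))"
    by (auto simp: homotopy_def fun_eq_iff sum_fun_apply fscale_apply)
  then show ?thesis
    using assms(2) by (auto intro!: fn.subspace_sum fn.subspace_scale assms(1))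
next
  case False
  then show ?thesis using fn.subspace_0[OF assms(1)] by (simp add: homotopy_def zero_fun_def)
qed

text \<open>Koszul cochains of the inverse system of the polynomial ring on \<open>\<rho>\<close>.
  Since \<open>dl\<close> leaves \<open>\<tau>\<close> alone, the space \<open>Z\<close> of
  functions of \<open>\<tau>\<close> is carried along as constant coefficients.\<close>

definition simplex_mod :: "('v set \<Rightarrow> 'f) set \<Rightarrow> 'v set \<Rightarrow> nat \<Rightarrow> ('v, 'f) cell_fun set" where
  "simplex_mod Z \<rho> i = {c. (\<forall>S \<tau> \<mu>. c (S, \<tau>, \<mu>) \<noteq> 0 \<longrightarrow> S \<subseteq> {..<d} \<and> card S = i \<and> keys \<mu> \<subseteq> \<rho>) \<and>
     (\<forall>S \<mu>. (\<lambda>\<tau>. c (S, \<tau>, \<mu>)) \<in> Z)}"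

text \<open>Multiplication by a variable of \<open>\<rho>\<close> is null-homotopic, because it is a combination of the
  forms; this collapses the long exact sequence of \<open>x\<^sub>v\<close>.\<close>

lemma simplex_acyclic:
  assumes "finite \<rho>" "\<rho> \<subseteq> V" "spanning \<rho>" "fn.subspace Z"
    and "c \<in> simplex_mod Z \<rho> (Suc i)" "dl c = 0" "Suc i + card \<rho> > d"
  shows "\<exists>b\<in>simplex_mod Z \<rho> i. dl b = c"
  using assms
proof (induction \<rho> arbitrary: c i rule: finite_induct)
  case empty
  have "c = 0"
  proof
    fix x :: "'v cell"
    obtain S \<tau> \<mu> where x: "x = (S, \<tau>, \<mu>)" by (cases x)
    show "c x = 0 x"
    proof (rule ccontr)
      assume "c x \<noteq> 0 x"
      then have "S \<subseteq> {..<d}" "card S = Suc i" using empty.prems(4) x by (auto simp: simplex_mod_def)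
      then show False using card_mono[of "{..<d}" S] empty.prems(6) by simp
    qed
  qed
  moreover have "0 \<in> simplex_mod Z {} i"
    using fn.subspace_0[OF empty.prems(3)] by (auto simp: simplex_mod_def zero_fun_def)
  ultimately show ?case using dl.zero by blast
next
  case (insert v \<rho>)
  note Z = insert.prems(3) and c = insert.prems(4)
  obtain a where a: "\<And>u. u \<in> insert v \<rho> \<Longrightarrow> (\<Sum>k<d. a k * th k u) = (if u = v then 1 else 0)"
    using insert.prems(2) unfolding spanning_def by blast
  \<comment> \<open>A lift of \<open>c\<close> along the variable of \<open>v\<close>, which acts on
    functions by shifting and therefore returns \<open>c\<close> when applied to
    \<open>y\<close>.\<close>
  define y :: "('v, 'f) cell_fun" where
    "y = (\<lambda>(S, \<tau>, \<mu>). if lookup \<mu> v > 0 then c (S, \<tau>, \<mu> - var_exp v) else 0)"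
  have y_shift: "y (S, \<tau>, \<mu> + var_exp v) = c (S, \<tau>, \<mu>)" for S \<tau> \<mu>
    by (simp add: y_def lookup_add)
  have shift_eq: "\<mu> = (\<mu> - var_exp v) + var_exp v" if "lookup \<mu> v > 0" for \<mu> :: "'v \<Rightarrow>\<^sub>0 nat"
    using that by (intro poly_mapping_eqI) (auto simp: lookup_add lookup_minus lookup_single when_def)
  have y: "y \<in> simplex_mod Z (insert v \<rho>) (Suc i)"
    unfolding simplex_mod_def
  proof (intro CollectI conjI allI impI)
    fix S \<tau> \<mu> assume n: "y (S, \<tau>, \<mu>) \<noteq> 0"
    then have l: "lookup \<mu> v > 0" and "c (S, \<tau>, \<mu> - var_exp v) \<noteq> 0"
      by (auto simp: y_def split: if_splits)
    then have *: "S \<subseteq> {..<d}" "card S = Suc i" "keys (\<mu> - var_exp v) \<subseteq> insert v \<rho>"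
      using c by (auto simp: simplex_mod_def)
    have "keys \<mu> = insert v (keys (\<mu> - var_exp v))"
      by (subst shift_eq[OF l]) (rule keys_plus_var_exp)
    then show "S \<subseteq> {..<d}" "card S = Suc i" "keys \<mu> \<subseteq> insert v \<rho>" using * by auto
  next
    fix S \<mu>
    show "(\<lambda>\<tau>. y (S, \<tau>, \<mu>)) \<in> Z"
      using c fn.subspace_0[OF Z] by (cases "lookup \<mu> v > 0")
        (auto simp: y_def simplex_mod_def zero_fun_def)
  qed
  have dl_shift: "dl w (S, \<tau>, \<mu> + var_exp v) = dl (\<lambda>(S, \<tau>, \<mu>). w (S, \<tau>, \<mu> + var_exp v)) (S, \<tau>, \<mu>)"
    for w S \<tau> \<mu>
  proof -
    have "\<mu> + var_exp v + var_exp u = \<mu> + var_exp u + var_exp v" for u by (simp add: ac_simps)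
    then show ?thesis by (simp add: dl_def)
  qed
  have "(\<lambda>(S, \<tau>, \<mu>). y (S, \<tau>, \<mu> + var_exp v)) = c" using y_shift by auto
  then have dly0: "dl y (S, \<tau>, \<mu> + var_exp v) = 0" for S \<tau> \<mu>
    using insert.prems(5) by (simp add: dl_shift)
  \<comment> \<open>The variable of \<open>v\<close> kills \<open>dl y\<close>, so the monomials in
    its support avoid \<open>v\<close> and the induction hypothesis applies. It is used one Koszul
    position higher, which makes up for the lost vertex in the bound
    \<open>Suc i + card \<rho> > d\<close>.\<close>
  have dly: "dl y \<in> simplex_mod Z \<rho> (Suc (Suc i))"
    unfolding simplex_mod_def
  proof (intro CollectI conjI allI impI)
    fix S \<tau> \<mu> assume n: "dl y (S, \<tau>, \<mu>) \<noteq> 0"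
    have l: "\<not> lookup \<mu> v > 0"
    proof
      assume "lookup \<mu> v > 0"
      then have "\<mu> - var_exp v + var_exp v = \<mu>" by (rule shift_eq[symmetric])
      then have "dl y (S, \<tau>, \<mu>) = 0" using dly0[of S \<tau> "\<mu> - var_exp v"] by (rule subst)
      then show False using n by contradiction
    qed
    from n obtain k u where k: "S \<subseteq> {..<d}" "k \<in> S" "y (S - {k}, \<tau>, \<mu> + var_exp u) \<noteq> 0"
      by (rule dl_nonzeroE)
    then have "card (S - {k}) = Suc i" "keys (\<mu> + var_exp u) \<subseteq> insert v \<rho>"
      using y unfolding simplex_mod_def by blast+
    then have "card S = Suc (Suc i)" "keys \<mu> \<subseteq> insert v \<rho>"
      using card_Suc_Diff1[OF finite_subset[OF k(1)] k(2)] by auto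
    then show "S \<subseteq> {..<d}" "card S = Suc (Suc i)" "keys \<mu> \<subseteq> \<rho>"
      using k(1) l by (auto simp: in_keys_iff)
  next
    fix S \<mu> show "(\<lambda>\<tau>. dl y (S, \<tau>, \<mu>)) \<in> Z"
      using y by (intro subspace_slice_dl Z) (auto simp: simplex_mod_def)
  qed
  obtain u where u: "u \<in> simplex_mod Z \<rho> (Suc i)" "dl u = dl y"
    using insert.IH[OF _ _ Z dly] insert.prems(1,6) insert.hyps dl_dl
      spanning_mono[OF insert.prems(2)] by auto
  define w where "w = y - u"
  have dlw: "dl w = 0" using u(2) by (simp add: w_def dl.diff)
  have w: "w \<in> simplex_mod Z (insert v \<rho>) (Suc i)"
    unfolding simplex_mod_def
  proof (intro CollectI conjI allI impI)
    fix S \<mu>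
    have "(\<lambda>\<tau>. w (S, \<tau>, \<mu>)) = (\<lambda>\<tau>. y (S, \<tau>, \<mu>)) - (\<lambda>\<tau>. u (S, \<tau>, \<mu>))" by (auto simp: w_def)
    then show "(\<lambda>\<tau>. w (S, \<tau>, \<mu>)) \<in> Z"
      using y u(1) fn.subspace_diff[OF Z] by (auto simp: simplex_mod_def)
  next
    fix S \<tau> \<mu> assume "w (S, \<tau>, \<mu>) \<noteq> 0"
    then have "y (S, \<tau>, \<mu>) \<noteq> 0 \<or> u (S, \<tau>, \<mu>) \<noteq> 0" by (auto simp: w_def)
    then show "S \<subseteq> {..<d}" "card S = Suc i" "keys \<mu> \<subseteq> insert v \<rho>"
      using y u(1) unfolding simplex_mod_def by blast+
  qed
  have w_shift: "w (S, \<tau>, \<mu> + var_exp v) = c (S, \<tau>, \<mu>)" for S \<tau> \<mu>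
  proof -
    have "u (S, \<tau>, \<mu> + var_exp v) = 0"
      using u(1) insert.hyps(2) unfolding simplex_mod_def by fastforce
    then show ?thesis by (simp add: w_def y_shift)
  qed
  \<comment> \<open>The combination \<open>a\<close> restricts to the variable of \<open>v\<close>
    on \<open>insert v \<rho>\<close>, and \<open>w\<close> is a cocycle that this variable sends to
    \<open>c\<close>.\<close>
  have "dl (homotopy a w) = c"
  proof
    fix x :: "'v cell"
    obtain S \<tau> \<mu> where x: "x = (S, \<tau>, \<mu>)" by (cases x)
    show "dl (homotopy a w) x = c x"
    proof (cases "S \<subseteq> {..<d}")
      case True
      have "homotopy a (dl w) (S, \<tau>, \<mu>) = 0" by (simp add: dlw homotopy_def)
      then have "dl (homotopy a w) x = (\<Sum>k<d. a k * (\<Sum>u\<in>V. th k u * w (S, \<tau>, \<mu> + var_exp u)))"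
        using dl_homotopy[OF True, of a w \<tau> \<mu>] x by simp
      also have "\<dots> = (\<Sum>k<d. \<Sum>u\<in>V. a k * th k u * w (S, \<tau>, \<mu> + var_exp u))"
        by (simp add: sum_distrib_left mult.assoc)
      also have "\<dots> = (\<Sum>u\<in>V. (\<Sum>k<d. a k * th k u) * w (S, \<tau>, \<mu> + var_exp u))"
        by (subst sum.swap) (simp add: sum_distrib_right)
      also have "\<dots> = (\<Sum>u\<in>V. if u = v then w (S, \<tau>, \<mu> + var_exp v) else 0)"
      proof (rule sum.cong[OF refl])
        fix u
        show "(\<Sum>k<d. a k * th k u) * w (S, \<tau>, \<mu> + var_exp u) = (if u = v then w (S, \<tau>, \<mu> + var_exp v) else 0)"
        proof (cases "u \<in> insert v \<rho>")
          case False
          then have "w (S, \<tau>, \<mu> + var_exp u) = 0"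
            using w unfolding simplex_mod_def by fastforce
          then show ?thesis using False by simp
        qed (simp add: a)
      qed
      also have "\<dots> = c x"
        using insert.prems(1) finite_V by (simp add: w_shift x)
      finally show ?thesis .
    next
      case False
      then have "c x = 0" using c x unfolding simplex_mod_def by blast
      then show ?thesis using False by (simp add: x dl_def)
    qed
  qed
  moreover have "homotopy a w \<in> simplex_mod Z (insert v \<rho>) i"
    unfolding simplex_mod_def
  proof (intro CollectI conjI allI impI)
    fix S \<tau> \<mu> assume "homotopy a w (S, \<tau>, \<mu>) \<noteq> 0"
    then obtain k where k: "S \<subseteq> {..<d}" "k \<in> {..<d} - S" "w (insert k S, \<tau>, \<mu>) \<noteq> 0"
      by (rule homotopy_nonzeroE)
    then have "card (insert k S) = Suc i" "keys \<mu> \<subseteq> insert v \<rho>"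
      using w unfolding simplex_mod_def by blast+
    then show "S \<subseteq> {..<d}" "card S = i" "keys \<mu> \<subseteq> insert v \<rho>"
      using k finite_subset[OF k(1)] by auto
  next
    fix S \<mu> show "(\<lambda>\<tau>. homotopy a w (S, \<tau>, \<mu>)) \<in> Z"
      using w by (intro subspace_slice_homotopy Z) (auto simp: simplex_mod_def)
  qed
  ultimately show ?case by blast
qed

end

section \<open>Stars, links and their double complexes\<close>

locale complex_forms = forms V d th for V :: "'v::linorder set" and d and th :: "nat \<Rightarrow> 'v \<Rightarrow> 'f::field" +
  fixes \<Delta> :: "'v set set"
  assumes complex: "simplicial_complex \<Delta>"
    and V_eq: "V = vertices \<Delta>"
    and card_face: "\<sigma> \<in> \<Delta> \<Longrightarrow> card \<sigma> \<le> d"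
    and spanning_face: "\<sigma> \<in> \<Delta> \<Longrightarrow> spanning \<sigma>"
begin

lemma face_subset: "\<sigma> \<in> \<Delta> \<Longrightarrow> \<sigma> \<subseteq> V"
  by (auto simp: V_eq vertices_def)

lemma subface: "\<sigma> \<in> \<Delta> \<Longrightarrow> \<tau> \<subseteq> \<sigma> \<Longrightarrow> \<tau> \<in> \<Delta>"
  using complex by (auto simp: simplicial_complex_def)

lemma finite_face: "\<sigma> \<in> \<Delta> \<Longrightarrow> finite \<sigma>"
  using complex by (auto simp: simplicial_complex_def)

text \<open>Indexed by the number of vertices, which is one more than the dimension.\<close>

definition link_faces :: "'v set \<Rightarrow> nat \<Rightarrow> 'v set set" where
  "link_faces \<sigma> p = {\<tau>. card \<tau> = p \<and> \<tau> \<inter> \<sigma> = {} \<and> \<sigma> \<union> \<tau> \<in> \<Delta>}"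

text \<open>Vanishing of the reduced homology of the link in dimension \<open>p - 1\<close>.\<close>

definition link_exact :: "'v set \<Rightarrow> nat \<Rightarrow> bool" where
  "link_exact \<sigma> p \<longleftrightarrow> (\<forall>g\<in>supported (link_faces \<sigma> p). bdc g = 0 \<longrightarrow>
     (\<exists>g'\<in>supported (link_faces \<sigma> (Suc p)). bdc g' = g))"

text \<open>Dual of the degree-\<open>p\<close> term of the partition complex of the star of \<open>\<sigma>\<close>, tensored with the
  \<open>i\<close>-th Koszul term: the direct sum of the stars of the faces \<open>\<sigma> \<union> \<tau>\<close>.\<close>

definition star_mod :: "'v set \<Rightarrow> nat \<Rightarrow> nat \<Rightarrow> ('v, 'f) cell_fun set" where
  "star_mod \<sigma> p i = supported {(S, \<tau>, \<mu>). S \<subseteq> {..<d} \<and> card S = i \<and> card \<tau> = p \<and> \<tau> \<inter> \<sigma> = {} \<and>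
     \<sigma> \<union> \<tau> \<union> keys \<mu> \<in> \<Delta>}"

lemma star_modI:
  assumes "\<And>S \<tau> \<mu>. c (S, \<tau>, \<mu>) \<noteq> 0 \<Longrightarrow> S \<subseteq> {..<d} \<and> card S = i \<and> card \<tau> = p \<and> \<tau> \<inter> \<sigma> = {} \<and>
     \<sigma> \<union> \<tau> \<union> keys \<mu> \<in> \<Delta>"
  shows "c \<in> star_mod \<sigma> p i"
  using assms by (auto simp: star_mod_def supported_def)

lemma star_modD:
  assumes "c \<in> star_mod \<sigma> p i" "c (S, \<tau>, \<mu>) \<noteq> 0"
  shows "S \<subseteq> {..<d}" "card S = i" "card \<tau> = p" "\<tau> \<inter> \<sigma> = {}" "\<sigma> \<union> \<tau> \<union> keys \<mu> \<in> \<Delta>"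
  using assms unfolding star_mod_def supported_def by auto

lemma subspace_star_mod: "fn.subspace (star_mod \<sigma> p i)"
  unfolding star_mod_def by (rule subspace_supported)

lemma dl_star_mod:
  assumes "c \<in> star_mod \<sigma> p i"
  shows "dl c \<in> star_mod \<sigma> p (Suc i)"
proof (rule star_modI)
  fix S \<tau> \<mu> assume "dl c (S, \<tau>, \<mu>) \<noteq> 0"
  then obtain k v where k: "S \<subseteq> {..<d}" "k \<in> S" "c (S - {k}, \<tau>, \<mu> + var_exp v) \<noteq> 0"
    by (rule dl_nonzeroE)
  note D = star_modD[OF assms k(3)]
  have "card S = Suc i" using D(2) card_Suc_Diff1[OF finite_subset[OF k(1)] k(2)] by simp
  moreover have "\<sigma> \<union> \<tau> \<union> keys \<mu> \<in> \<Delta>" by (rule subface[OF D(5)]) auto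
  ultimately show "S \<subseteq> {..<d} \<and> card S = Suc i \<and> card \<tau> = p \<and> \<tau> \<inter> \<sigma> = {} \<and>
     \<sigma> \<union> \<tau> \<union> keys \<mu> \<in> \<Delta>" using D k by blast
qed

lemma bd_star_mod:
  assumes "c \<in> star_mod \<sigma> (Suc p) i"
  shows "bd c \<in> star_mod \<sigma> p i"
proof (rule star_modI)
  fix S \<tau> \<mu> assume "bd c (S, \<tau>, \<mu>) \<noteq> 0"
  then obtain v where v: "\<tau> \<subseteq> V" "v \<in> V - \<tau>" "c (S, insert v \<tau>, \<mu>) \<noteq> 0"
    by (rule bd_nonzeroE)
  note D = star_modD[OF assms v(3)]
  have "card \<tau> = p" using D(3) v finite_subset[OF v(1) finite_V] by auto
  moreover have "\<sigma> \<union> \<tau> \<union> keys \<mu> \<in> \<Delta>" by (rule subface[OF D(5)]) auto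
  ultimately show "S \<subseteq> {..<d} \<and> card S = i \<and> card \<tau> = p \<and> \<tau> \<inter> \<sigma> = {} \<and>
     \<sigma> \<union> \<tau> \<union> keys \<mu> \<in> \<Delta>" using D by blast
qed

lemma bd_star_mod_0:
  assumes "c \<in> star_mod \<sigma> 0 i"
  shows "bd c = 0"
proof
  fix x :: "'v cell"
  obtain S \<tau> \<mu> where x: "x = (S, \<tau>, \<mu>)" by (cases x)
  show "bd c x = 0 x"
  proof (rule ccontr)
    assume "bd c x \<noteq> 0 x"
    then have "bd c (S, \<tau>, \<mu>) \<noteq> 0" by (simp add: x)
    then obtain v where v: "\<tau> \<subseteq> V" "v \<in> V - \<tau>" "c (S, insert v \<tau>, \<mu>) \<noteq> 0"
      by (rule bd_nonzeroE)
    have "finite (insert v \<tau>)" using finite_subset[OF v(1) finite_V] by simp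
    then show False using star_modD(3)[OF assms v(3)] by simp
  qed
qed

text \<open>Adding to \<open>\<tau>\<close> a vertex that already occurs in the monomial does not
  change \<open>\<sigma> \<union> \<tau> \<union> keys \<mu>\<close>, so the cone with apex
  \<open>u\<close> stays within the star.\<close>

lemma cone_cell_nonzero:
  assumes c: "c \<in> star_mod \<sigma> p i" and u: "u \<in> keys \<mu> - \<sigma>"
    and nz: "cone u (\<lambda>\<tau>. c (S, \<tau>, \<mu>)) \<tau> \<noteq> 0"
  shows "S \<subseteq> {..<d}" "card S = i" "card \<tau> = Suc p" "\<tau> \<inter> \<sigma> = {}" "\<sigma> \<union> \<tau> \<union> keys \<mu> \<in> \<Delta>"
proof -
  have u\<tau>: "u \<in> \<tau>" "c (S, \<tau> - {u}, \<mu>) \<noteq> 0" using nz by (auto simp: cone_def split: if_splits)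
  note D = star_modD[OF c u\<tau>(2)]
  have e: "\<sigma> \<union> (\<tau> - {u}) \<union> keys \<mu> = \<sigma> \<union> \<tau> \<union> keys \<mu>" using u u\<tau> by auto
  then show "\<sigma> \<union> \<tau> \<union> keys \<mu> \<in> \<Delta>" using D by simp
  then have "finite \<tau>" using finite_face by fastforce
  then show "card \<tau> = Suc p" using D(3) card_Suc_Diff1[OF _ u\<tau>(1)] by simp
  show "S \<subseteq> {..<d}" "card S = i" "\<tau> \<inter> \<sigma> = {}" using D u u\<tau> by auto
qed

lemma bdc_cone_cell:
  assumes c: "c \<in> star_mod \<sigma> p i" "bd c = 0" and u: "u \<in> keys \<mu> - \<sigma>"
  shows "bdc (cone u (\<lambda>\<tau>. c (S, \<tau>, \<mu>))) = (\<lambda>\<tau>. c (S, \<tau>, \<mu>))"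
proof
  fix \<tau>
  let ?g = "\<lambda>\<tau>. c (S, \<tau>, \<mu>)"
  show "bdc (cone u ?g) \<tau> = c (S, \<tau>, \<mu>)"
  proof (cases "\<tau> \<subseteq> V \<and> u \<in> V")
    case True
    have "bdc ?g \<tau>' = 0" for \<tau>' using c(2) by (simp flip: bd_apply)
    then have "cone u (bdc ?g) \<tau> = 0" by (simp add: cone_def)
    then show ?thesis using bdc_cone[of u \<tau> ?g] True by simp
  next
    case False
    have "c (S, \<tau>', \<mu>) = 0" if "\<not> (\<tau>' \<subseteq> V \<and> u \<in> V)" for \<tau>'
      using star_modD(5)[OF c(1), of S \<tau>' \<mu>] face_subset u that by blast
    then have "c (S, \<tau>, \<mu>) = 0" and "u \<notin> V \<Longrightarrow> cone u ?g = 0"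
      using False by (auto simp: cone_def fun_eq_iff)
    then show ?thesis using False bdc.zero by (auto simp: bdc_def)
  qed
qed

text \<open>A row splits over the pairs \<open>(S, \<mu>)\<close>. If the monomial has a vertex
  outside \<open>\<sigma>\<close>, the summand is a cone; otherwise it is the chain complex of the
  link of \<open>\<sigma>\<close>. Exactness of the link is requested only when a monomial of the
  second kind occurs in \<open>c\<close>.\<close>

lemma row_exact:
  assumes c: "c \<in> star_mod \<sigma> p i" "bd c = 0"
    and lk: "\<And>S \<tau> \<mu>. c (S, \<tau>, \<mu>) \<noteq> 0 \<Longrightarrow> keys \<mu> \<subseteq> \<sigma> \<Longrightarrow> link_exact \<sigma> p"
  shows "\<exists>b\<in>star_mod \<sigma> (Suc p) i. bd b = c"
proof -
  have "\<exists>g. bdc g = (\<lambda>\<tau>. c (S, \<tau>, \<mu>)) \<and> (\<forall>\<tau>. g \<tau> \<noteq> 0 \<longrightarrow> S \<subseteq> {..<d} \<and> card S = i \<and> card \<tau> = Suc p \<and>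
     \<tau> \<inter> \<sigma> = {} \<and> \<sigma> \<union> \<tau> \<union> keys \<mu> \<in> \<Delta>)" for S \<mu>
  proof (cases "keys \<mu> \<subseteq> \<sigma>")
    case False
    then obtain u where u: "u \<in> keys \<mu> - \<sigma>" by blast
    show ?thesis
      using bdc_cone_cell[OF c u] cone_cell_nonzero[OF c(1) u]
      by (intro exI[of _ "cone u (\<lambda>\<tau>. c (S, \<tau>, \<mu>))"]) blast
  next
    case True
    then have e: "\<sigma> \<union> \<tau> \<union> keys \<mu> = \<sigma> \<union> \<tau>" for \<tau> by auto
    let ?g = "\<lambda>\<tau>. c (S, \<tau>, \<mu>)"
    show ?thesis
    proof (cases "?g = 0")
      case True
      then show ?thesis using bdc.zero by (intro exI[of _ 0]) (auto simp: fun_eq_iff)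
    next
      case False
      then obtain \<tau> where \<tau>: "c (S, \<tau>, \<mu>) \<noteq> 0" by (auto simp: fun_eq_iff)
      have "?g \<in> supported (link_faces \<sigma> p)"
        unfolding supported_def link_faces_def using star_modD[OF c(1), of S _ \<mu>] e by auto
      moreover have "bdc ?g = 0" using c(2) by (auto simp: fun_eq_iff bd_def)
      ultimately obtain g where g: "g \<in> supported (link_faces \<sigma> (Suc p))" "bdc g = ?g"
        using lk[OF \<tau> True] unfolding link_exact_def by blast
      then show ?thesis
        using star_modD(1,2)[OF c(1) \<tau>] e
        by (intro exI[of _ g]) (auto simp: supported_def link_faces_def)
    qed
  qed
  then obtain G where G: "\<And>S \<mu>. bdc (G S \<mu>) = (\<lambda>\<tau>. c (S, \<tau>, \<mu>))"
    "\<And>S \<mu> \<tau>. G S \<mu> \<tau> \<noteq> 0 \<Longrightarrow> S \<subseteq> {..<d} \<and> card S = i \<and> card \<tau> = Suc p \<and>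
     \<tau> \<inter> \<sigma> = {} \<and> \<sigma> \<union> \<tau> \<union> keys \<mu> \<in> \<Delta>" by metis
  have "(\<lambda>(S, \<tau>, \<mu>). G S \<mu> \<tau>) \<in> star_mod \<sigma> (Suc p) i"
    using G(2) by (intro star_modI) auto
  moreover have "bd (\<lambda>(S, \<tau>, \<mu>). G S \<mu> \<tau>) = c"
    by (auto simp: bd_def G(1))
  ultimately show ?thesis by blast
qed

definition star_acyclic :: "'v set \<Rightarrow> bool" where
  "star_acyclic \<sigma> \<longleftrightarrow> (\<forall>i. \<forall>c\<in>star_mod \<sigma> 0 (Suc i). dl c = 0 \<longrightarrow> (\<exists>b\<in>star_mod \<sigma> 0 i. dl b = c))"

text \<open>As \<open>dl\<close> fixes \<open>\<tau>\<close>, a column is the direct sum of the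
  complexes of the stars of \<open>\<sigma> \<union> \<tau>\<close>. The slice
  \<open>?s c \<tau>\<close> moves the summand of \<open>\<tau>\<close> to the empty face, that is,
  to column 0 of that star.\<close>

lemma column_acyclic:
  assumes ac: "\<And>\<tau>. \<tau> \<in> link_faces \<sigma> p \<Longrightarrow> star_acyclic (\<sigma> \<union> \<tau>)"
    and c: "c \<in> star_mod \<sigma> p (Suc i)" "dl c = 0"
  shows "\<exists>b\<in>star_mod \<sigma> p i. dl b = c"
proof -
  let ?s = "\<lambda>(c :: ('v, 'f) cell_fun) \<tau> (S, \<tau>' :: 'v set, \<mu>). if \<tau>' = {} then c (S, \<tau>, \<mu>) else 0"
  have "\<exists>b\<in>star_mod (\<sigma> \<union> \<tau>) 0 i. dl b = ?s c \<tau>" if \<tau>: "\<tau> \<in> link_faces \<sigma> p" for \<tau>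
  proof -
    have "?s c \<tau> \<in> star_mod (\<sigma> \<union> \<tau>) 0 (Suc i)"
      using star_modD[OF c(1)] by (intro star_modI) (auto split: if_splits simp: Un_assoc)
    moreover have "dl (?s c \<tau>) = ?s (dl c) \<tau>"
      by (auto simp: dl_def fun_eq_iff)
    then have "dl (?s c \<tau>) = 0"
      unfolding c(2) by (auto simp: fun_eq_iff)
    ultimately show ?thesis using ac[OF \<tau>] unfolding star_acyclic_def by blast
  qed
  then obtain B where B: "\<And>\<tau>. \<tau> \<in> link_faces \<sigma> p \<Longrightarrow> B \<tau> \<in> star_mod (\<sigma> \<union> \<tau>) 0 i"
    "\<And>\<tau>. \<tau> \<in> link_faces \<sigma> p \<Longrightarrow> dl (B \<tau>) = ?s c \<tau>" by metis
  define b :: "('v, 'f) cell_fun" where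
    "b = (\<lambda>(S, \<tau>, \<mu>). if \<tau> \<in> link_faces \<sigma> p then B \<tau> (S, {}, \<mu>) else 0)"
  have "b \<in> star_mod \<sigma> p i"
  proof (rule star_modI)
    fix S \<tau> \<mu> assume "b (S, \<tau>, \<mu>) \<noteq> 0"
    then have \<tau>: "\<tau> \<in> link_faces \<sigma> p" and "B \<tau> (S, {}, \<mu>) \<noteq> 0" by (auto simp: b_def split: if_splits)
    from star_modD[OF B(1)[OF \<tau>] this(2)] \<tau>
    show "S \<subseteq> {..<d} \<and> card S = i \<and> card \<tau> = p \<and> \<tau> \<inter> \<sigma> = {} \<and> \<sigma> \<union> \<tau> \<union> keys \<mu> \<in> \<Delta>"
      by (auto simp: link_faces_def)
  qed
  moreover have "dl b = c"
  proof
    fix x :: "'v cell"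
    obtain S \<tau> \<mu> where x: "x = (S, \<tau>, \<mu>)" by (cases x)
    show "dl b x = c x"
    proof (cases "\<tau> \<in> link_faces \<sigma> p")
      case True
      then have "dl b x = dl (B \<tau>) (S, {}, \<mu>)" by (simp add: x dl_def b_def)
      then show ?thesis using B(2)[OF True] by (simp add: x)
    next
      case False
      then have "c x = 0"
        using star_modD(3-5)[OF c(1), of S \<tau> \<mu>] subface[of "\<sigma> \<union> \<tau> \<union> keys \<mu>" "\<sigma> \<union> \<tau>"]
        unfolding x link_faces_def by blast
      then show ?thesis using False by (simp add: x dl_def b_def)
    qed
  qed
  ultimately show ?thesis by blast
qed

text \<open>A zigzag through the double complex of the star, each step moving one column and one
  Koszul position further. Columns other than the zeroth belong to stars of larger faces and are
  exact by induction; at the last column \<open>e\<close> the lemma \<open>simplex_acyclic\<close>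
  takes over.\<close>

lemma star_acyclic_if_links_exact:
  assumes lk: "\<And>\<sigma> p. \<sigma> \<in> \<Delta> \<Longrightarrow> \<sigma> \<noteq> {} \<Longrightarrow> p < d - card \<sigma> \<Longrightarrow> link_exact \<sigma> p"
    and \<sigma>: "\<sigma> \<in> \<Delta>" "\<sigma> \<noteq> {}"
  shows "star_acyclic \<sigma>"
  using \<sigma>
proof (induction "d - card \<sigma>" arbitrary: \<sigma> rule: less_induct)
  case less
  note \<sigma> = less.prems
  define e where "e = d - card \<sigma>"
  have de: "d = card \<sigma> + e" using card_face[OF \<sigma>(1)] by (simp add: e_def)
  have col: "\<exists>b\<in>star_mod \<sigma> (Suc p) i. dl b = c"
    if "c \<in> star_mod \<sigma> (Suc p) (Suc i)" "dl c = 0" for p i c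
  proof (rule column_acyclic[OF _ that])
    fix \<tau> assume \<tau>: "\<tau> \<in> link_faces \<sigma> (Suc p)"
    then have f: "\<sigma> \<union> \<tau> \<in> \<Delta>" "\<tau> \<inter> \<sigma> = {}" "card \<tau> = Suc p" by (auto simp: link_faces_def)
    then have "card (\<sigma> \<union> \<tau>) = card \<sigma> + Suc p"
      using card_Un_disjoint[of \<sigma> \<tau>] finite_face[OF f(1)] by auto
    then have "d - card (\<sigma> \<union> \<tau>) < d - card \<sigma>" using card_face[OF f(1)] by simp
    then show "star_acyclic (\<sigma> \<union> \<tau>)" using less.hyps f(1) \<sigma>(2) by blast
  qed
  \<comment> \<open>The zigzag preserves \<open>i \<ge> p\<close>; at \<open>p = e\<close> this
    becomes \<open>Suc i + card \<sigma> > d\<close>, the range in which the simplex on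
    \<open>\<sigma>\<close> is acyclic. The induction runs downwards from
    \<open>p = e\<close>.\<close>
  have main: "\<exists>b\<in>star_mod \<sigma> p i. bd b = 0 \<and> dl b = c"
    if "p \<le> e" "i \<ge> p" "c \<in> star_mod \<sigma> p (Suc i)" "bd c = 0" "dl c = 0" for p i c
    using that
  proof (induction p arbitrary: i c rule: inc_induct)
    case base
    note c = base.prems(2-4)
    define Z where "Z = {g. g \<in> supported (link_faces \<sigma> e) \<and> bdc g = 0}"
    \<comment> \<open>A vertex of the monomial outside \<open>\<sigma>\<close> would be a cone apex,
      but the cone would live on faces with more than \<open>d\<close> vertices. Hence the cone is
      zero, and so is the row cycle that it bounds.\<close>
    have keys: "keys \<mu> \<subseteq> \<sigma>" if "c (S, \<tau>, \<mu>) \<noteq> 0" for S \<tau> \<mu>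
    proof (rule ccontr)
      assume "\<not> keys \<mu> \<subseteq> \<sigma>"
      then obtain u where u: "u \<in> keys \<mu> - \<sigma>" by blast
      have "cone u (\<lambda>\<tau>. c (S, \<tau>, \<mu>)) \<tau>' = 0" for \<tau>'
      proof (rule ccontr)
        assume "cone u (\<lambda>\<tau>. c (S, \<tau>, \<mu>)) \<tau>' \<noteq> 0"
        note C = cone_cell_nonzero[OF c(1) u this]
        have f: "\<sigma> \<union> \<tau>' \<in> \<Delta>" by (rule subface[OF C(5)]) auto
        then have "card (\<sigma> \<union> \<tau>') = card \<sigma> + Suc e"
          using card_Un_disjoint[of \<sigma> \<tau>'] finite_face[OF f] C by auto
        then show False using card_face[OF f] de by simp
      qed
      then have "cone u (\<lambda>\<tau>. c (S, \<tau>, \<mu>)) = 0" by (auto simp: fun_eq_iff)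
      then have "(\<lambda>\<tau>. c (S, \<tau>, \<mu>)) = 0"
        using bdc_cone_cell[OF c(1,2) u, of S] bdc.zero by simp
      then show False using that by (simp add: fun_eq_iff)
    qed
    have Z: "fn.subspace Z"
      unfolding Z_def
      by (rule fn.subspaceI) (auto simp: bdc.add bdc.scale intro: fn.subspace_0 fn.subspace_add
        fn.subspace_scale subspace_supported)
    have "c \<in> simplex_mod Z \<sigma> (Suc i)"
      unfolding simplex_mod_def
    proof (intro CollectI conjI allI impI)
      fix S \<tau> \<mu> assume "c (S, \<tau>, \<mu>) \<noteq> 0"
      then show "S \<subseteq> {..<d}" "card S = Suc i" "keys \<mu> \<subseteq> \<sigma>"
        by (rule star_modD[OF c(1)], rule star_modD[OF c(1)], rule keys)
    next
      fix S \<mu>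
      have "c (S, \<tau>, \<mu>) \<noteq> 0 \<Longrightarrow> \<tau> \<in> link_faces \<sigma> e" for \<tau>
        using star_modD(3-5)[OF c(1), of S \<tau> \<mu>] subface[of "\<sigma> \<union> \<tau> \<union> keys \<mu>" "\<sigma> \<union> \<tau>"]
        unfolding link_faces_def by blast
      moreover have "bdc (\<lambda>\<tau>. c (S, \<tau>, \<mu>)) = 0" using c(2) by (auto simp: fun_eq_iff bd_def)
      ultimately show "(\<lambda>\<tau>. c (S, \<tau>, \<mu>)) \<in> Z" by (auto simp: Z_def supported_def)
    qed
    then obtain b where b: "b \<in> simplex_mod Z \<sigma> i" "dl b = c"
      using simplex_acyclic[OF finite_face[OF \<sigma>(1)] face_subset[OF \<sigma>(1)] spanning_face[OF \<sigma>(1)] Z _ c(3), of i]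
        base.prems(1) de by auto
    have slice: "(\<lambda>\<tau>. b (S, \<tau>, \<mu>)) \<in> Z" for S \<mu> using b(1) by (auto simp: simplex_mod_def)
    have "b \<in> star_mod \<sigma> e i"
    proof (rule star_modI)
      fix S \<tau> \<mu> assume n: "b (S, \<tau>, \<mu>) \<noteq> 0"
      then have "\<tau> \<in> link_faces \<sigma> e" using slice[of S \<mu>] by (auto simp: Z_def supported_def)
      moreover have "S \<subseteq> {..<d}" "card S = i" and k: "keys \<mu> \<subseteq> \<sigma>"
        using b(1) n by (auto simp: simplex_mod_def)
      moreover have "\<sigma> \<union> \<tau> \<union> keys \<mu> = \<sigma> \<union> \<tau>" using k by auto
      ultimately show "S \<subseteq> {..<d} \<and> card S = i \<and> card \<tau> = e \<and> \<tau> \<inter> \<sigma> = {} \<and> \<sigma> \<union> \<tau> \<union> keys \<mu> \<in> \<Delta>"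
        by (auto simp: link_faces_def)
    qed
    moreover have "bd b = 0" using slice by (auto simp: bd_def fun_eq_iff Z_def)
    ultimately show ?case using b(2) by blast
  next
    case (step p)
    note c = step.prems(2-4)
    \<comment> \<open>\<open>c1\<close> lifts \<open>c\<close> along the row. Subtracting the row
      cycle \<open>u\<close> makes it a cocycle of column \<open>Suc p\<close>; the boundary of a
      primitive of \<open>c1 - u\<close> is then a primitive of \<open>c\<close>.\<close>
    obtain c1 where c1: "c1 \<in> star_mod \<sigma> (Suc p) (Suc i)" "bd c1 = c"
      using row_exact[OF c(1,2)] lk[OF \<sigma>] step.hyps e_def by auto
    have "bd (dl c1) = 0" using dl_bd[of c1] c(3) c1(2) by (simp only:)
    then obtain u where u: "u \<in> star_mod \<sigma> (Suc p) (Suc i)" "bd u = 0" "dl u = dl c1"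
      using step.IH[OF _ dl_star_mod[OF c1(1)] _ dl_dl] step.prems(1) Suc_le_mono by blast
    have "c1 - u \<in> star_mod \<sigma> (Suc p) (Suc i)"
      using fn.subspace_diff[OF subspace_star_mod] c1 u by blast
    moreover have "dl (c1 - u) = 0" using u by (simp add: dl.diff)
    ultimately obtain b where b: "b \<in> star_mod \<sigma> (Suc p) i" "dl b = c1 - u"
      using col by blast
    have "dl (bd b) = c" by (simp add: dl_bd b(2) bd.diff u(2) c1(2))
    then show ?case using bd_star_mod[OF b(1)] bd_bd by blast
  qed
  show ?case
    unfolding star_acyclic_def
  proof (intro allI ballI impI)
    fix i c assume c: "c \<in> star_mod \<sigma> 0 (Suc i)" "dl c = 0"
    show "\<exists>b\<in>star_mod \<sigma> 0 i. dl b = c"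
      using main[OF le0 le0 c(1) bd_star_mod_0[OF c(1)] c(2)] by blast
  qed
qed

end

section \<open>Dimension count in a fixed multidegree\<close>

lemma multidegree_superset:
  assumes "finite W" "keys \<mu> \<subseteq> W"
  shows "multidegree \<pi> \<mu> i = (\<Sum>v\<in>W. lookup \<mu> v * \<pi> v i)"
  unfolding multidegree_def using assms
  by (intro sum.mono_neutral_left) (auto simp: in_keys_iff)

lemma multidegree_add: "multidegree \<pi> (\<mu> + \<nu>) i = multidegree \<pi> \<mu> i + multidegree \<pi> \<nu> i"
proof -
  let ?W = "keys \<mu> \<union> keys \<nu>"
  show ?thesis
    using multidegree_superset[of ?W "\<mu> + \<nu>" \<pi> i] multidegree_superset[of ?W \<mu> \<pi> i]
      multidegree_superset[of ?W \<nu> \<pi> i]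
    by (simp add: keys_plus_nat lookup_add distrib_right sum.distrib)
qed

lemma multidegree_var_exp [simp]: "multidegree \<pi> (var_exp v) i = \<pi> v i"
  by (simp add: multidegree_def)

lemma multidegree_0 [simp]: "multidegree \<pi> 0 i = 0"
  by (simp add: multidegree_def)

lemma vsize_unit_vec [simp]: "vsize (unit_vec i) = 1"
  by (simp add: vsize_def unit_vec_def)

lemma finite_bounded_monomials:
  assumes "finite V"
  shows "finite {\<mu> :: 'v \<Rightarrow>\<^sub>0 nat. keys \<mu> \<subseteq> V \<and> (\<forall>v. lookup \<mu> v \<le> N)}"
proof (rule finite_imageD)
  show "inj_on lookup {\<mu> :: 'v \<Rightarrow>\<^sub>0 nat. keys \<mu> \<subseteq> V \<and> (\<forall>v. lookup \<mu> v \<le> N)}"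
    by (auto intro: inj_onI poly_mapping_eqI)
  have "finite {f. \<forall>x. (x \<in> V \<longrightarrow> f x \<in> {..N}) \<and> (x \<notin> V \<longrightarrow> f x = 0)}"
    by (rule finite_set_of_finite_funs[OF assms]) simp
  then show "finite (lookup ` {\<mu> :: 'v \<Rightarrow>\<^sub>0 nat. keys \<mu> \<subseteq> V \<and> (\<forall>v. lookup \<mu> v \<le> N)})"
    by (rule rev_finite_subset) (auto simp: in_keys_iff)
qed

section \<open>Cycles and boundaries of links\<close>

context complex_forms
begin

definition lcyc :: "'v set \<Rightarrow> nat \<Rightarrow> ('v set \<Rightarrow> 'f) set" where
  "lcyc \<sigma> p = {g \<in> supported (link_faces \<sigma> p). bdc g = 0}"

definition lbnd :: "'v set \<Rightarrow> nat \<Rightarrow> ('v set \<Rightarrow> 'f) set" where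
  "lbnd \<sigma> p = bdc ` supported (link_faces \<sigma> (Suc p))"

lemma finite_link_faces: "finite (link_faces \<sigma> p)"
  by (rule finite_subset[of _ "Pow V"]) (use face_subset finite_V in \<open>auto simp: link_faces_def\<close>)

lemma bdc_supported:
  assumes "g \<in> supported (link_faces \<sigma> (Suc p))"
  shows "bdc g \<in> supported (link_faces \<sigma> p)"
  unfolding supported_def
proof (intro CollectI allI impI)
  fix \<tau> assume n: "bdc g \<tau> \<noteq> 0"
  then have V: "\<tau> \<subseteq> V" by (auto simp: bdc_def split: if_splits)
  then have "(\<Sum>v\<in>V - \<tau>. sg v \<tau> * g (insert v \<tau>)) \<noteq> 0" using n by (simp add: bdc_def)
  then obtain v where v: "v \<in> V - \<tau>" "sg v \<tau> * g (insert v \<tau>) \<noteq> 0"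
    by (metis (no_types, lifting) sum.neutral)
  then have "insert v \<tau> \<in> link_faces \<sigma> (Suc p)" using assms by (auto simp: supported_def)
  then show "\<tau> \<in> link_faces \<sigma> p"
    using v finite_subset[OF V finite_V] subface[of "\<sigma> \<union> insert v \<tau>" "\<sigma> \<union> \<tau>"]
    by (auto simp: link_faces_def)
qed

lemma subspace_kernel_in:
  assumes "fn.subspace U" "Vector_Spaces.linear fscale fscale f"
  shows "fn.subspace {c \<in> U. f c = 0}"
proof -
  interpret f: Vector_Spaces.linear fscale fscale f by fact
  show ?thesis
    by (rule fn.subspaceI) (auto simp: f.add f.scale f.zero
        intro: fn.subspace_0[OF assms(1)] fn.subspace_add[OF assms(1)] fn.subspace_scale[OF assms(1)])
qed

lemma subspace_lcyc: "fn.subspace (lcyc \<sigma> p)"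
  unfolding lcyc_def by (rule subspace_kernel_in[OF subspace_supported linear_bdc])

lemma subspace_lbnd: "fn.subspace (lbnd \<sigma> p)"
  unfolding lbnd_def by (rule bdc.subspace_image[OF subspace_supported])

lemma lcyc_supported: "lcyc \<sigma> p \<subseteq> supported (link_faces \<sigma> p)"
  unfolding lcyc_def by (rule Collect_subset)

lemma lbnd_subset_lcyc: "lbnd \<sigma> p \<subseteq> lcyc \<sigma> p"
  unfolding lbnd_def lcyc_def using bdc_supported bdc_bdc by blast

end

section \<open>The double complex in multidegree b\<close>

text \<open>\<open>\<kappa> k\<close> is the multidegree of the \<open>k\<close>-th form. It is a
  parameter of its own because a zero form does not determine it.\<close>

locale graded_forms = complex_forms V d th \<Delta> for V :: "'v::linorder set" and d
    and th :: "nat \<Rightarrow> 'v \<Rightarrow> 'f::field" and \<Delta> +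
  fixes \<pi> :: "'v \<Rightarrow> 'm::finite \<Rightarrow> nat" and \<kappa> :: "nat \<Rightarrow> 'm \<Rightarrow> nat" and b :: "'m \<Rightarrow> nat"
  assumes links_exact: "\<sigma> \<in> \<Delta> \<Longrightarrow> \<sigma> \<noteq> {} \<Longrightarrow> p < d - card \<sigma> \<Longrightarrow> link_exact \<sigma> p"
    and homogeneous: "k < d \<Longrightarrow> v \<in> V \<Longrightarrow> th k v \<noteq> 0 \<Longrightarrow> \<pi> v = \<kappa> k"
    and unit_pi: "v \<in> V \<Longrightarrow> \<pi> v \<in> range unit_vec"
    and unit_kappa: "k < d \<Longrightarrow> \<kappa> k \<in> range unit_vec"
begin

lemma size_pi: "v \<in> V \<Longrightarrow> vsize (\<pi> v) = 1" and size_kappa: "k < d \<Longrightarrow> vsize (\<kappa> k) = 1"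
  using unit_pi unit_kappa by fastforce+

text \<open>A set \<open>S\<close> of Koszul generators counts with the degree of the product of its
  forms.\<close>

definition cdeg :: "nat set \<Rightarrow> ('v \<Rightarrow>\<^sub>0 nat) \<Rightarrow> 'm \<Rightarrow> nat" where
  "cdeg S \<mu> = (\<lambda>i. (\<Sum>k\<in>S. \<kappa> k i) + multidegree \<pi> \<mu> i)"

lemma vsize_cdeg:
  assumes "S \<subseteq> {..<d}" "keys \<mu> \<subseteq> V"
  shows "vsize (cdeg S \<mu>) = card S + (\<Sum>v\<in>V. lookup \<mu> v)"
proof -
  have "(\<Sum>i\<in>UNIV. \<Sum>k\<in>S. \<kappa> k i) = (\<Sum>k\<in>S. vsize (\<kappa> k))"
    unfolding vsize_def by (rule sum.swap)
  also have "\<dots> = (\<Sum>k\<in>S. 1)" using size_kappa assms(1) by (intro sum.cong) auto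
  finally have 1: "(\<Sum>i\<in>UNIV. \<Sum>k\<in>S. \<kappa> k i) = card S" by simp
  have "(\<Sum>i\<in>UNIV. multidegree \<pi> \<mu> i) = (\<Sum>i\<in>UNIV. \<Sum>v\<in>V. lookup \<mu> v * \<pi> v i)"
    by (rule sum.cong[OF refl multidegree_superset[OF finite_V assms(2)]])
  also have "\<dots> = (\<Sum>v\<in>V. lookup \<mu> v * vsize (\<pi> v))"
    unfolding vsize_def sum_distrib_left by (rule sum.swap)
  also have "\<dots> = (\<Sum>v\<in>V. lookup \<mu> v)"
    using size_pi by (intro sum.cong) auto
  finally show ?thesis using 1 by (simp add: vsize_def cdeg_def sum.distrib)
qed

text \<open>Projection to degree \<open>b\<close>. It commutes with both differentials, so
  primitives found without regard to degrees can be projected.\<close>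

definition deg_part :: "('v, 'f) cell_fun \<Rightarrow> ('v, 'f) cell_fun" where
  "deg_part c = (\<lambda>(S, \<tau>, \<mu>). if cdeg S \<mu> = b then c (S, \<tau>, \<mu>) else 0)"

lemma bd_deg_part: "bd (deg_part c) = deg_part (bd c)"
proof
  fix x :: "'v cell"
  obtain S \<tau> \<mu> where x: "x = (S, \<tau>, \<mu>)" by (cases x)
  show "bd (deg_part c) x = deg_part (bd c) x"
    by (cases "cdeg S \<mu> = b") (simp_all add: x bd_def bdc_def deg_part_def)
qed

lemma cdeg_shift:
  assumes "S \<subseteq> {..<d}" "k \<in> S" "v \<in> V" "th k v \<noteq> 0"
  shows "cdeg (S - {k}) (\<mu> + var_exp v) = cdeg S \<mu>"
proof
  fix i
  have "finite S" using assms(1) finite_subset by blast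
  moreover have "\<pi> v = \<kappa> k" using assms homogeneous by blast
  ultimately show "cdeg (S - {k}) (\<mu> + var_exp v) i = cdeg S \<mu> i"
    using sum.remove[of S k "\<lambda>k. \<kappa> k i"] assms(2) by (simp add: cdeg_def multidegree_add)
qed

lemma dl_deg_part: "dl (deg_part c) = deg_part (dl c)"
proof
  fix x :: "'v cell"
  obtain S \<tau> \<mu> where x: "x = (S, \<tau>, \<mu>)" by (cases x)
  show "dl (deg_part c) x = deg_part (dl c) x"
  proof (cases "S \<subseteq> {..<d}")
    case True
    have "th k v * deg_part c (S - {k}, \<tau>, \<mu> + var_exp v) =
      (if cdeg S \<mu> = b then th k v * c (S - {k}, \<tau>, \<mu> + var_exp v) else 0)" if "k \<in> S" "v \<in> V" for k v
      using cdeg_shift[OF True that, of \<mu>] by (cases "th k v = 0") (auto simp: deg_part_def)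
    then have "dl (deg_part c) x = (\<Sum>k\<in>S. sg k S * (\<Sum>v\<in>V.
        if cdeg S \<mu> = b then th k v * c (S - {k}, \<tau>, \<mu> + var_exp v) else 0))"
      using True by (simp add: x dl_def)
    then show ?thesis using True by (simp add: x dl_def deg_part_def)
  qed (simp add: x dl_def deg_part_def)
qed

definition cells :: "nat \<Rightarrow> nat \<Rightarrow> 'v cell set" where
  "cells p i = {(S, \<tau>, \<mu>). S \<subseteq> {..<d} \<and> card S = i \<and> card \<tau> = p \<and>
     \<tau> \<union> keys \<mu> \<in> \<Delta> \<and> cdeg S \<mu> = b}"

definition D :: "nat \<Rightarrow> nat \<Rightarrow> ('v, 'f) cell_fun set" where
  "D p i = supported (cells p i)"

lemma D_iff: "c \<in> D p i \<longleftrightarrow> c \<in> star_mod {} p i \<and> deg_part c = c"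
proof
  assume c: "c \<in> D p i"
  then have cell: "(S, \<tau>, \<mu>) \<in> cells p i" if "c (S, \<tau>, \<mu>) \<noteq> 0" for S \<tau> \<mu>
    using that by (auto simp: D_def supported_def)
  have "c \<in> star_mod {} p i" using cell by (intro star_modI) (simp add: cells_def)
  moreover have "deg_part c (S, \<tau>, \<mu>) = c (S, \<tau>, \<mu>)" for S \<tau> \<mu>
    using cell[of S \<tau> \<mu>] by (auto simp: deg_part_def cells_def)
  ultimately show "c \<in> star_mod {} p i \<and> deg_part c = c" by auto
next
  assume c: "c \<in> star_mod {} p i \<and> deg_part c = c"
  have "(S, \<tau>, \<mu>) \<in> cells p i" if n: "c (S, \<tau>, \<mu>) \<noteq> 0" for S \<tau> \<mu>
  proof -
    have "deg_part c (S, \<tau>, \<mu>) \<noteq> 0" using n c by simp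
    then have "cdeg S \<mu> = b" by (auto simp: deg_part_def split: if_splits)
    then show ?thesis using star_modD[of c "{}" p i S \<tau> \<mu>] c n by (simp add: cells_def)
  qed
  then show "c \<in> D p i" by (auto simp: D_def supported_def)
qed

lemma deg_part_star_mod:
  assumes "c \<in> star_mod {} p i"
  shows "deg_part c \<in> D p i"
  using assms by (auto simp: D_def star_mod_def cells_def supported_def deg_part_def)

lemma dl_D: "c \<in> D p i \<Longrightarrow> dl c \<in> D p (Suc i)"
  unfolding D_iff by (metis dl_deg_part dl_star_mod)

lemma bd_D: "c \<in> D (Suc p) i \<Longrightarrow> bd c \<in> D p i"
  unfolding D_iff by (metis bd_deg_part bd_star_mod)

lemma subspace_D: "fn.subspace (D p i)"
  unfolding D_def by (rule subspace_supported)

lemma finite_cells: "finite (cells p i)"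
proof (rule finite_subset)
  let ?M = "{\<mu> :: 'v \<Rightarrow>\<^sub>0 nat. keys \<mu> \<subseteq> V \<and> (\<forall>v. lookup \<mu> v \<le> vsize b)}"
  show "finite (Pow {..<d} \<times> Pow V \<times> ?M)"
    using finite_bounded_monomials[OF finite_V] finite_V by blast
  show "cells p i \<subseteq> Pow {..<d} \<times> Pow V \<times> ?M"
  proof
    fix x assume x: "x \<in> cells p i"
    obtain S \<tau> \<mu> where e: "x = (S, \<tau>, \<mu>)" by (cases x)
    have *: "S \<subseteq> {..<d}" "\<tau> \<subseteq> V" "keys \<mu> \<subseteq> V" "cdeg S \<mu> = b"
      using x face_subset unfolding e cells_def by blast+
    have "lookup \<mu> v \<le> vsize b" for v
    proof (cases "v \<in> V")
      case True
      have "lookup \<mu> v \<le> (\<Sum>v\<in>V. lookup \<mu> v)"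
        using True finite_V by (intro member_le_sum) auto
      then show ?thesis using vsize_cdeg[OF *(1,3)] *(4) by simp
    next
      case False
      then have "v \<notin> keys \<mu>" using *(3) by blast
      then show ?thesis by (simp add: in_keys_iff)
    qed
    then show "x \<in> Pow {..<d} \<times> Pow V \<times> ?M" using * e by auto
  qed
qed

lemma D_zero_if_large: "i > vsize b \<Longrightarrow> D p i = {0}"
proof -
  assume i: "i > vsize b"
  have "cells p i = {}"
  proof (rule ccontr)
    assume "cells p i \<noteq> {}"
    then obtain S \<tau> \<mu> where *: "S \<subseteq> {..<d}" "card S = i" "\<tau> \<union> keys \<mu> \<in> \<Delta>" "cdeg S \<mu> = b"
      by (auto simp: cells_def)
    moreover have "keys \<mu> \<subseteq> V" using face_subset[OF *(3)] by blast
    ultimately show False using vsize_cdeg[of S \<mu>] i by simp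
  qed
  then show ?thesis by (auto simp: D_def supported_def fun_eq_iff)
qed

definition Z :: "nat \<Rightarrow> nat \<Rightarrow> ('v, 'f) cell_fun set" where
  "Z p i = {c \<in> D p i. bd c = 0}"

definition B :: "nat \<Rightarrow> nat \<Rightarrow> ('v, 'f) cell_fun set" where
  "B p i = bd ` D (Suc p) i"

definition cyc :: "('v, 'f) cell_fun set \<Rightarrow> ('v, 'f) cell_fun set" where
  "cyc X = {c \<in> X. dl c = 0}"

lemma dim_D_kernel_image:
  assumes "fn.subspace U" "U \<subseteq> D p i" "Vector_Spaces.linear fscale fscale f"
  shows "fn.dim U = fn.dim {c \<in> U. f c = 0} + fn.dim (f ` U)"
  using dim_kernel_image_fn[OF assms(3,1) _ finite_cells] assms(2) unfolding D_def by blast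

lemma dim_D_split: "fn.dim (D (Suc p) i) = fn.dim (Z (Suc p) i) + fn.dim (B p i)"
  unfolding Z_def B_def by (rule dim_D_kernel_image[OF subspace_D subset_refl linear_bd])

text \<open>Columns \<open>Suc p\<close> are sums of stars of nonempty faces. Column 0 is excluded:
  it is the complex of \<Delta> itself, whose cohomology is the object of the computation.\<close>

lemma column_exact: "cyc (D (Suc p) (Suc i)) = dl ` D (Suc p) i"
proof
  show "dl ` D (Suc p) i \<subseteq> cyc (D (Suc p) (Suc i))"
    using dl_D dl_dl by (auto simp: cyc_def)
  show "cyc (D (Suc p) (Suc i)) \<subseteq> dl ` D (Suc p) i"
  proof
    fix c assume "c \<in> cyc (D (Suc p) (Suc i))"
    then have c: "c \<in> star_mod {} (Suc p) (Suc i)" "deg_part c = c" "dl c = 0" by (auto simp: cyc_def D_iff)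
    have "star_acyclic ({} \<union> \<tau>)" if "\<tau> \<in> link_faces {} (Suc p)" for \<tau>
    proof -
      have "\<tau> \<in> \<Delta>" "\<tau> \<noteq> {}" using that by (auto simp: link_faces_def)
      then show ?thesis using star_acyclic_if_links_exact[OF links_exact] by simp
    qed
    then obtain b where "b \<in> star_mod {} (Suc p) i" "dl b = c"
      using column_acyclic[OF _ c(1,3)] by blast
    then have "deg_part b \<in> D (Suc p) i" "dl (deg_part b) = c"
      using deg_part_star_mod by (auto simp: dl_deg_part c(2))
    then show "c \<in> dl ` D (Suc p) i" by blast
  qed
qed

lemma dim_D_column: "fn.dim (D (Suc p) i) = fn.dim (cyc (D (Suc p) i)) + fn.dim (cyc (D (Suc p) (Suc i)))"
  unfolding column_exact unfolding cyc_def
  by (rule dim_D_kernel_image[OF subspace_D subset_refl linear_dl])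

text \<open>The dimension of \<open>W\<close>, where \<open>bd\<close> and \<open>dl\<close> compose
  to zero, is counted along \<open>bd\<close> and along \<open>dl\<close>. Exactness of the column
  ensures that \<open>dl\<close> maps \<open>W\<close> onto all cocycles among the row cycles of the
  next position.\<close>

lemma dim_zigzag:
  "fn.dim (cyc (B p i)) + fn.dim (Z (Suc p) i) =
     fn.dim (cyc (Z (Suc p) (Suc i))) + fn.dim (cyc (D (Suc p) i))"
proof -
  define W where "W = {c \<in> D (Suc p) i. bd (dl c) = 0}"
  have WD: "W \<subseteq> D (Suc p) i" by (auto simp: W_def)
  have "Vector_Spaces.linear fscale fscale (bd \<circ> dl)"
    by (rule Vector_Spaces.linear_compose[OF linear_dl linear_bd])
  from subspace_kernel_in[OF subspace_D this] have W: "fn.subspace W"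
    by (simp only: W_def comp_apply)
  have bdW: "bd ` W = cyc (B p i)"
    unfolding W_def cyc_def B_def by (auto simp only: dl_bd)
  have ker1: "{c \<in> W. bd c = 0} = Z (Suc p) i"
  proof -
    have "bd (dl c) = 0" if "bd c = 0" for c
      using dl_bd[of c] unfolding that dl.zero by (rule sym)
    then show ?thesis unfolding W_def Z_def by blast
  qed
  have dlW: "dl ` W = cyc (Z (Suc p) (Suc i))"
  proof
    show "dl ` W \<subseteq> cyc (Z (Suc p) (Suc i))"
      using dl_D dl_dl by (auto simp: W_def Z_def cyc_def)
    show "cyc (Z (Suc p) (Suc i)) \<subseteq> dl ` W"
    proof
      fix c assume c: "c \<in> cyc (Z (Suc p) (Suc i))"
      then have "c \<in> cyc (D (Suc p) (Suc i))" "bd c = 0" by (auto simp: cyc_def Z_def)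
      then show "c \<in> dl ` W" unfolding column_exact W_def by blast
    qed
  qed
  have ker2: "{c \<in> W. dl c = 0} = cyc (D (Suc p) i)"
  proof -
    have "bd (dl c) = 0" if "dl c = 0" for c unfolding that by (rule bd.zero)
    then show ?thesis unfolding W_def cyc_def by blast
  qed
  show ?thesis
    using dim_D_kernel_image[OF W WD linear_bd] dim_D_kernel_image[OF W WD linear_dl]
    unfolding bdW ker1 dlW ker2 by simp
qed

text \<open>Below position \<open>vsize b\<close> the monomial of a cell has positive degree, so
  every row is a cone and the reduced homology of \<Delta> does not enter.\<close>

lemma Z_eq_B_below: "i < vsize b \<Longrightarrow> Z p i = B p i"
proof
  assume i: "i < vsize b"
  show "B p i \<subseteq> Z p i" unfolding Z_def B_def using bd_D bd_bd by auto
  show "Z p i \<subseteq> B p i"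
  proof
    fix c assume "c \<in> Z p i"
    have c: "c \<in> star_mod {} p i" "bd c = 0" "deg_part c = c" "c \<in> supported (cells p i)"
    proof -
      have "c \<in> D p i" "bd c = 0" using \<open>c \<in> Z p i\<close> unfolding Z_def by blast+
      then show "c \<in> star_mod {} p i" "bd c = 0" "deg_part c = c" "c \<in> supported (cells p i)"
        unfolding D_def[symmetric] by (simp_all only: D_iff)
    qed
    have "link_exact {} p" if "c (S, \<tau>, \<mu>) \<noteq> 0" "keys \<mu> \<subseteq> {}" for S \<tau> \<mu>
    proof -
      have *: "S \<subseteq> {..<d}" "card S = i" "cdeg S \<mu> = b"
        using c(4) that(1) by (auto simp: supported_def cells_def)
      then have "vsize b = i" using vsize_cdeg[of S \<mu>] that(2) by (auto simp: in_keys_iff)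
      then show ?thesis using i by simp
    qed
    then obtain c1 where "c1 \<in> star_mod {} (Suc p) i" "bd c1 = c"
      using row_exact[OF c(1,2)] by blast
    then have "deg_part c1 \<in> D (Suc p) i" "bd (deg_part c1) = c"
      using deg_part_star_mod by (auto simp: bd_deg_part c(3))
    then show "c \<in> B p i" unfolding B_def by blast
  qed
qed

lemma cyc_Z_top: "cyc (Z p (vsize b)) = Z p (vsize b)"
proof -
  have "dl c = 0" if "c \<in> Z p (vsize b)" for c
    using dl_D[of c p "vsize b"] D_zero_if_large[of "Suc (vsize b)" p] that by (auto simp: Z_def)
  then show ?thesis by (auto simp: cyc_def)
qed

section \<open>The top position, where the monomial is 1\<close>

definition tops :: "nat set set" where
  "tops = {S. S \<subseteq> {..<d} \<and> (\<lambda>i. \<Sum>k\<in>S. \<kappa> k i) = b}"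

lemma finite_tops: "finite tops"
  by (rule finite_subset[of _ "Pow {..<d}"]) (auto simp: tops_def)

text \<open>The common shape of all spaces at position \<open>vsize b\<close>: one copy of
  \<open>U\<close> for each set of forms of total degree \<open>b\<close>.\<close>

definition top_mod :: "('v set \<Rightarrow> 'f) set \<Rightarrow> ('v, 'f) cell_fun set" where
  "top_mod U = {c. \<forall>S. (\<lambda>\<tau>. c (S, \<tau>, 0)) \<in> U \<and> (\<forall>\<tau> \<mu>. c (S, \<tau>, \<mu>) \<noteq> 0 \<longrightarrow> S \<in> tops \<and> \<mu> = 0)}"

lemma dim_top_mod:
  assumes "fn.subspace U" "U \<subseteq> supported X" "finite X"
  shows "fn.dim (top_mod U) = card tops * fn.dim U"
proof -
  let ?E = "\<lambda>(h :: nat set \<times> 'v set \<Rightarrow> 'f) (S, \<tau>, \<mu> :: 'v \<Rightarrow>\<^sub>0 nat). if \<mu> = 0 then h (S, \<tau>) else 0"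
  let ?M = "{h :: nat set \<times> 'v set \<Rightarrow> 'f. \<forall>S. (\<lambda>\<tau>. h (S, \<tau>)) \<in> U \<and> (S \<notin> tops \<longrightarrow> (\<forall>\<tau>. h (S, \<tau>) = 0))}"
  have lin: "Vector_Spaces.linear fscale fscale ?E"
    by (rule linear_fscaleI) (auto simp: fscale_apply split: prod.splits)
  have "top_mod U = ?E ` ?M"
  proof
    show "?E ` ?M \<subseteq> top_mod U" by (auto simp: top_mod_def split: if_splits)
    show "top_mod U \<subseteq> ?E ` ?M"
    proof
      fix c assume c: "c \<in> top_mod U"
      have "c = ?E (\<lambda>(S, \<tau>). c (S, \<tau>, 0))" using c by (auto simp: top_mod_def fun_eq_iff)
      moreover have "(\<lambda>(S, \<tau>). c (S, \<tau>, 0)) \<in> ?M" using c by (auto simp: top_mod_def)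
      ultimately show "c \<in> ?E ` ?M" by blast
    qed
  qed
  moreover have "fn.dim (?E ` ?M) = fn.dim ?M"
  proof (rule fn_pair.dim_injective_image[OF lin])
    show "fn.subspace ?M"
    proof (rule fn.subspaceI)
      fix x y k
      assume x: "x \<in> ?M"
      have "(\<lambda>\<tau>. fscale k x (S, \<tau>)) = fscale k (\<lambda>\<tau>. x (S, \<tau>))" for S by (auto simp: fscale_apply)
      then show "fscale k x \<in> ?M"
        using x fn.subspace_scale[OF assms(1), of _ k] by (auto simp: fscale_apply)
      assume y: "y \<in> ?M"
      have "(\<lambda>\<tau>. (x + y) (S, \<tau>)) = (\<lambda>\<tau>. x (S, \<tau>)) + (\<lambda>\<tau>. y (S, \<tau>))" for S by auto
      then show "x + y \<in> ?M" using x y fn.subspace_add[OF assms(1)] by auto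
    qed (use fn.subspace_0[OF assms(1)] in \<open>auto simp: zero_fun_def\<close>)
    have "?M \<subseteq> supported (tops \<times> X)" using assms(2) unfolding supported_def by fastforce
    then show "?M \<subseteq> fn.span (unit_fun ` (tops \<times> X))"
      using supported_subset_span[of "tops \<times> X"] finite_tops assms(3) by blast
    show "finite (unit_fun ` (tops \<times> X) :: (nat set \<times> 'v set \<Rightarrow> 'f) set)"
      using finite_tops assms(3) by simp
    fix h :: "nat set \<times> 'v set \<Rightarrow> 'f" assume "?E h = 0"
    then have "?E h (S, \<tau>, 0) = 0" for S \<tau> by simp
    then show "h = 0" by (auto simp: fun_eq_iff)
  qed
  ultimately show ?thesis using dim_slices[OF finite_tops assms] by simp
qed

lemma top_cell:
  assumes "(S, \<tau>, \<mu>) \<in> cells p (vsize b)"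
  shows "S \<in> tops" "\<mu> = 0" "\<tau> \<in> link_faces {} p"
proof -
  have *: "S \<subseteq> {..<d}" "card S = vsize b" "card \<tau> = p" "\<tau> \<union> keys \<mu> \<in> \<Delta>" "cdeg S \<mu> = b"
    using assms by (auto simp: cells_def)
  have k: "keys \<mu> \<subseteq> V" using face_subset[OF *(4)] by blast
  then have "(\<Sum>v\<in>V. lookup \<mu> v) = 0" using vsize_cdeg[OF *(1) k] * by simp
  then show \<mu>: "\<mu> = 0" using k finite_V
    by (intro poly_mapping_eqI) (metis in_keys_iff lookup_zero subsetD sum_eq_0_iff)
  show "S \<in> tops" using * by (auto simp: tops_def cdeg_def \<mu>)
  show "\<tau> \<in> link_faces {} p" using * by (auto simp: link_faces_def \<mu>)
qed

lemma cell_top: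
  assumes "S \<in> tops" "\<tau> \<in> link_faces {} p"
  shows "(S, \<tau>, 0) \<in> cells p (vsize b)"
proof -
  have "S \<subseteq> {..<d}" "cdeg S 0 = b" using assms(1) by (auto simp: tops_def cdeg_def)
  then show ?thesis using vsize_cdeg[of S 0] assms(2) by (auto simp: cells_def link_faces_def)
qed

lemma top_D:
  "c \<in> D p (vsize b) \<longleftrightarrow> c \<in> top_mod (supported (link_faces {} p))"
proof
  assume "c \<in> D p (vsize b)"
  then show "c \<in> top_mod (supported (link_faces {} p))"
    using top_cell unfolding D_def top_mod_def supported_def by fastforce
next
  assume c: "c \<in> top_mod (supported (link_faces {} p))"
  show "c \<in> D p (vsize b)"
    unfolding D_def supported_def
  proof (intro CollectI allI impI)
    fix x assume n: "c x \<noteq> 0"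
    obtain S \<tau> \<mu> where x: "x = (S, \<tau>, \<mu>)" by (cases x)
    have "S \<in> tops" "\<mu> = 0" using c n unfolding x top_mod_def by blast+
    moreover have "\<tau> \<in> link_faces {} p"
      using c n \<open>\<mu> = 0\<close> unfolding x top_mod_def supported_def by auto
    ultimately show "x \<in> cells p (vsize b)" using cell_top x by blast
  qed
qed

lemma Z_top: "Z p (vsize b) = top_mod (lcyc {} p)"
proof -
  have "bd c = 0 \<longleftrightarrow> (\<forall>S. bdc (\<lambda>\<tau>. c (S, \<tau>, 0)) = 0)" if c: "c \<in> top_mod (supported (link_faces {} p))" for c
  proof
    assume "bd c = 0"
    then have "bd c (S, \<tau>, 0) = 0" for S \<tau> by simp
    then show "\<forall>S. bdc (\<lambda>\<tau>. c (S, \<tau>, 0)) = 0" by (auto simp: bd_apply fun_eq_iff)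
  next
    assume *: "\<forall>S. bdc (\<lambda>\<tau>. c (S, \<tau>, 0)) = 0"
    have "bdc (\<lambda>\<tau>. c (S, \<tau>, \<mu>)) \<tau> = 0" for S \<tau> \<mu>
    proof (cases "\<mu> = 0")
      case False
      then have "c (S, \<tau>', \<mu>) = 0" for \<tau>' using c unfolding top_mod_def by blast
      then show ?thesis by (simp add: bdc_def)
    qed (use * in \<open>simp add: fun_eq_iff\<close>)
    then show "bd c = 0" by (auto simp: bd_def fun_eq_iff)
  qed
  then have "Z p (vsize b) = {c \<in> top_mod (supported (link_faces {} p)). \<forall>S. bdc (\<lambda>\<tau>. c (S, \<tau>, 0)) = 0}"
    unfolding Z_def top_D by blast
  also have "\<dots> = top_mod (lcyc {} p)"
  proof (rule Collect_cong[where Q="\<lambda>c. c \<in> top_mod (lcyc {} p)", unfolded Collect_mem_eq])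
    fix c :: "('v, 'f) cell_fun"
    show "(c \<in> top_mod (supported (link_faces {} p)) \<and> (\<forall>S. bdc (\<lambda>\<tau>. c (S, \<tau>, 0)) = 0)) = (c \<in> top_mod (lcyc {} p))"
      unfolding top_mod_def lcyc_def mem_Collect_eq by blast
  qed
  finally show ?thesis .
qed

lemma B_top: "B p (vsize b) = top_mod (lbnd {} p)"
proof
  show "B p (vsize b) \<subseteq> top_mod (lbnd {} p)"
  proof
    fix c assume "c \<in> B p (vsize b)"
    then obtain c1 where c1: "c1 \<in> D (Suc p) (vsize b)" "c = bd c1" by (auto simp: B_def)
    have "c \<in> top_mod (supported (link_faces {} p))" using bd_D[OF c1(1)] c1(2) top_D by blast
    moreover have "(\<lambda>\<tau>. c (S, \<tau>, 0)) \<in> lbnd {} p" for S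
    proof -
      have "(\<lambda>\<tau>. c1 (S, \<tau>, 0)) \<in> supported (link_faces {} (Suc p))"
        using c1(1) unfolding top_D top_mod_def by blast
      then show ?thesis unfolding c1(2) bd_apply lbnd_def by blast
    qed
    ultimately show "c \<in> top_mod (lbnd {} p)" unfolding top_mod_def by blast
  qed
  show "top_mod (lbnd {} p) \<subseteq> B p (vsize b)"
  proof
    fix c assume c: "c \<in> top_mod (lbnd {} p)"
    have "\<exists>g\<in>supported (link_faces {} (Suc p)). bdc g = (\<lambda>\<tau>. c (S, \<tau>, 0))" for S
    proof -
      have "(\<lambda>\<tau>. c (S, \<tau>, 0)) \<in> lbnd {} p" using c unfolding top_mod_def by blast
      then show ?thesis unfolding lbnd_def by (elim imageE) (rule bexI, rule sym)
    qed
    then obtain g where g: "\<And>S. g S \<in> supported (link_faces {} (Suc p))"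
      "\<And>S. bdc (g S) = (\<lambda>\<tau>. c (S, \<tau>, 0))" by metis
    define c1 :: "('v, 'f) cell_fun" where "c1 = (\<lambda>(S, \<tau>, \<mu>). if S \<in> tops \<and> \<mu> = 0 then g S \<tau> else 0)"
    have "(\<lambda>\<tau>. c1 (S, \<tau>, 0)) \<in> supported (link_faces {} (Suc p))" for S
      using g(1)[of S] by (cases "S \<in> tops") (auto simp: c1_def supported_def)
    then have "c1 \<in> D (Suc p) (vsize b)"
      unfolding top_D top_mod_def by (auto simp: c1_def split: if_splits)
    moreover have "bd c1 = c"
    proof
      fix x :: "'v cell"
      obtain S \<tau> \<mu> where x: "x = (S, \<tau>, \<mu>)" by (cases x)
      show "bd c1 x = c x"
      proof (cases "S \<in> tops \<and> \<mu> = 0")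
        case True
        then show ?thesis using g(2)[of S] by (simp add: x bd_apply c1_def)
      next
        case False
        then have "c x = 0" using c unfolding x top_mod_def by blast
        then show ?thesis using False by (auto simp: x bd_apply c1_def bdc_def)
      qed
    qed
    ultimately show "c \<in> B p (vsize b)" unfolding B_def by blast
  qed
qed

lemma dim_Z_top: "fn.dim (Z p (vsize b)) = card tops * fn.dim (lcyc {} p)"
  unfolding Z_top by (rule dim_top_mod[OF subspace_lcyc lcyc_supported finite_link_faces])

lemma dim_B_top: "fn.dim (B p (vsize b)) = card tops * fn.dim (lbnd {} p)"
  unfolding B_top
  by (rule dim_top_mod[OF subspace_lbnd subset_trans[OF lbnd_subset_lcyc lcyc_supported] finite_link_faces])

section \<open>Telescoping along the diagonal\<close>

text \<open>The column is exact in positive positions and zero past \<open>vsize b\<close>, so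
  rank-nullity telescopes from the top down.\<close>

lemma dim_cyc_D:
  assumes "i \<le> vsize b"
  shows "int (fn.dim (cyc (D (Suc p) i))) = (\<Sum>j=i..vsize b. (- 1) ^ (j - i) * int (fn.dim (D (Suc p) j)))"
  using assms
proof (induction i rule: inc_induct)
  case base
  have "cyc (D (Suc p) (Suc (vsize b))) = {0}"
    unfolding cyc_def D_zero_if_large[OF lessI] using dl.zero by blast
  then show ?case using dim_D_column[of p "vsize b"] by (simp add: fn_dim_zero)
next
  case (step i)
  have "(\<Sum>j=i..vsize b. (- 1) ^ (j - i) * int (fn.dim (D (Suc p) j))) =
    int (fn.dim (D (Suc p) i)) + (\<Sum>j=Suc i..vsize b. (- 1) ^ (j - i) * int (fn.dim (D (Suc p) j)))"
    using step.hyps by (simp add: sum.atLeast_Suc_atMost)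
  also have "(\<Sum>j=Suc i..vsize b. (- 1) ^ (j - i) * int (fn.dim (D (Suc p) j))) =
    (\<Sum>j=Suc i..vsize b. - ((- 1) ^ (j - Suc i) * int (fn.dim (D (Suc p) j))))"
  proof (rule sum.cong[OF refl])
    fix j assume "j \<in> {Suc i..vsize b}"
    then have "j - i = Suc (j - Suc i)" by auto
    then show "(- 1) ^ (j - i) * int (fn.dim (D (Suc p) j)) = - ((- 1) ^ (j - Suc i) * int (fn.dim (D (Suc p) j)))"
      by simp
  qed
  finally show ?case using step.IH dim_D_column[of p i] by (simp add: sum_negf)
qed

text \<open>Euler characteristic of the row cycles of column \<open>p\<close> from the diagonal
  upwards. Subtracted from the dimension of the cocycles at \<open>(p, p)\<close>, it gives the
  quantity that telescopes.\<close>

definition alternating_dim :: "nat \<Rightarrow> int" where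
  "alternating_dim p = (\<Sum>j=p..vsize b. (- 1) ^ (j - p) * int (fn.dim (Z p j)))"

definition rbetti :: "nat \<Rightarrow> int" where
  "rbetti p = int (fn.dim (lcyc {} p)) - int (fn.dim (lbnd {} p))"

text \<open>\<open>D (Suc p) j\<close> splits into \<open>Z (Suc p) j\<close> and
  \<open>B p j\<close>, and \<open>B p j\<close> equals \<open>Z p j\<close> as long as
  \<open>j < vsize b\<close>. At \<open>j = vsize b\<close> the two differ by
  \<open>card tops\<close> copies of the homology of \<Delta>, which yields the last term with the
  sign of that position.\<close>

lemma cyc_Z_step:
  assumes "p < vsize b"
  shows "int (fn.dim (cyc (Z p p))) - alternating_dim p =
    int (fn.dim (cyc (Z (Suc p) (Suc p)))) - alternating_dim (Suc p) -
      (- 1) ^ (vsize b - p) * int (card tops) * rbetti p"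
proof -
  let ?s = "\<lambda>j. (- 1) ^ (j - p) :: int"
  have "int (fn.dim (cyc (D (Suc p) p))) = (\<Sum>j=p..vsize b. ?s j * int (fn.dim (Z (Suc p) j))) +
      (\<Sum>j=p..vsize b. ?s j * int (fn.dim (B p j)))"
    using dim_cyc_D[of p p] assms by (simp add: dim_D_split distrib_left sum.distrib)
  also have "(\<Sum>j=p..vsize b. ?s j * int (fn.dim (Z (Suc p) j))) =
      int (fn.dim (Z (Suc p) p)) + (\<Sum>j=Suc p..vsize b. ?s j * int (fn.dim (Z (Suc p) j)))"
    using assms by (simp add: sum.atLeast_Suc_atMost)
  also have "(\<Sum>j=Suc p..vsize b. ?s j * int (fn.dim (Z (Suc p) j))) = - alternating_dim (Suc p)"
    unfolding alternating_dim_def sum_negf[symmetric]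
  proof (rule sum.cong[OF refl])
    fix j assume "j \<in> {Suc p..vsize b}"
    then have "j - p = Suc (j - Suc p)" by auto
    then show "?s j * int (fn.dim (Z (Suc p) j)) = - ((- 1) ^ (j - Suc p) * int (fn.dim (Z (Suc p) j)))"
      by simp
  qed
  also have "(\<Sum>j=p..vsize b. ?s j * int (fn.dim (B p j))) = alternating_dim p - ?s (vsize b) * int (card tops) * rbetti p"
  proof -
    have "(\<Sum>j=p..vsize b. ?s j * int (fn.dim (B p j))) =
        (\<Sum>j=p..<vsize b. ?s j * int (fn.dim (Z p j))) + ?s (vsize b) * int (fn.dim (B p (vsize b)))"
      using assms Z_eq_B_below by (simp add: sum.last_plus)
    moreover have "alternating_dim p = (\<Sum>j=p..<vsize b. ?s j * int (fn.dim (Z p j))) + ?s (vsize b) * int (fn.dim (Z p (vsize b)))"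
      unfolding alternating_dim_def using assms by (simp add: sum.last_plus)
    ultimately show ?thesis by (simp add: dim_Z_top dim_B_top rbetti_def algebra_simps)
  qed
  finally have "int (fn.dim (cyc (D (Suc p) p))) =
    int (fn.dim (Z (Suc p) p)) - alternating_dim (Suc p) + alternating_dim p - ?s (vsize b) * int (card tops) * rbetti p" by simp
  moreover have "int (fn.dim (cyc (Z p p))) + int (fn.dim (Z (Suc p) p)) =
      int (fn.dim (cyc (Z (Suc p) (Suc p)))) + int (fn.dim (cyc (D (Suc p) p)))"
    using dim_zigzag[of p p] Z_eq_B_below[OF assms, of p] by simp
  ultimately show ?thesis by simp
qed

text \<open>At the upper end of the diagonal the telescoping quantity is zero: there every row cycle
  is a cocycle and the alternating sum has a single term.\<close>

theorem dim_cyc_D_0: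
  "int (fn.dim (cyc (D 0 0))) = (\<Sum>j\<le>vsize b. (- 1) ^ j * int (fn.dim (D 0 j))) -
     int (card tops) * (\<Sum>p<vsize b. (- 1) ^ (vsize b - p) * rbetti p)"
proof -
  have "int (fn.dim (cyc (Z q q))) - alternating_dim q =
      - (\<Sum>p=q..<vsize b. (- 1) ^ (vsize b - p) * int (card tops) * rbetti p)" if "q \<le> vsize b" for q
    using that
  proof (induction q rule: inc_induct)
    case base
    then show ?case by (simp add: alternating_dim_def cyc_Z_top)
  next
    case (step q)
    then show ?case
      using cyc_Z_step[of q] by (simp add: sum.atLeast_Suc_lessThan)
  qed
  from this[of 0] have "int (fn.dim (cyc (Z 0 0))) = alternating_dim 0 -
      (\<Sum>p<vsize b. (- 1) ^ (vsize b - p) * int (card tops) * rbetti p)"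
    by (simp add: atLeast0LessThan)
  moreover have "Z 0 j = D 0 j" for j
  proof -
    have "bd c = 0" if "c \<in> D 0 j" for c using that bd_star_mod_0 unfolding D_iff by blast
    then show ?thesis unfolding Z_def by blast
  qed
  ultimately show ?thesis
    by (simp add: alternating_dim_def atLeast0AtMost sum_distrib_left mult.assoc mult.left_commute)
qed

end

section \<open>Euler characteristic of the Koszul complex\<close>

definition color_count :: "('k \<Rightarrow> 'm \<Rightarrow> nat) \<Rightarrow> 'k set \<Rightarrow> 'm \<Rightarrow> nat" where
  "color_count \<kappa> T = (\<lambda>i. card {k \<in> T. \<kappa> k = unit_vec i})"

lemma unit_vec_eq_iff [simp]: "unit_vec i = unit_vec j \<longleftrightarrow> i = j"
  by (metis unit_vec_def zero_neq_one)

lemma color_count_insert: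
  assumes "finite T" "t \<notin> T" "\<kappa> t = unit_vec i"
  shows "color_count \<kappa> (insert t T) = (color_count \<kappa> T)(i := Suc (color_count \<kappa> T i))"
proof
  fix j
  have "{k \<in> insert t T. \<kappa> k = unit_vec j} =
      (if j = i then insert t {k \<in> T. \<kappa> k = unit_vec j} else {k \<in> T. \<kappa> k = unit_vec j})"
    using assms(3) by auto
  then show "color_count \<kappa> (insert t T) j = ((color_count \<kappa> T)(i := Suc (color_count \<kappa> T i))) j"
    using assms by (auto simp: color_count_def)
qed

lemma vbinom_update:
  "vbinom (f(i := x)) (g(i := y)) = (x choose y) * (\<Prod>j\<in>UNIV - {i}. f j choose g j)"
proof -
  have "vbinom (f(i := x)) (g(i := y)) =
      ((f(i := x)) i choose (g(i := y)) i) * (\<Prod>j\<in>UNIV - {i}. (f(i := x)) j choose (g(i := y)) j)"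
    unfolding vbinom_def by (rule prod.remove) auto
  also have "(\<Prod>j\<in>UNIV - {i}. (f(i := x)) j choose (g(i := y)) j) = (\<Prod>j\<in>UNIV - {i}. f j choose g j)"
    by (rule prod.cong) auto
  finally show ?thesis by (simp only: fun_upd_same)
qed

text \<open>The elements of each colour are chosen independently; the induction is Pascal's rule in
  the colour of the new element.\<close>

lemma card_subsets_color_sum:
  fixes \<kappa> :: "'k \<Rightarrow> 'm::finite \<Rightarrow> nat"
  assumes "finite T" "\<kappa> ` T \<subseteq> range unit_vec"
  shows "card {S \<in> Pow T. color_sum \<kappa> S = c} = vbinom (color_count \<kappa> T) c"
  using assms
proof (induction T arbitrary: c rule: finite_induct)
  case empty
  have "vbinom (\<lambda>_. 0) c = (if c = (\<lambda>_. 0) then 1 else 0)"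
  proof (cases "c = (\<lambda>_. 0)")
    case False
    then obtain i where "c i \<noteq> 0" by auto
    then have "(0 choose c i) = 0" by (cases "c i") auto
    then show ?thesis using False unfolding vbinom_def by (auto intro!: prod_zero)
  qed (simp add: vbinom_def)
  moreover have "{S \<in> Pow {}. color_sum \<kappa> S = c} = (if c = (\<lambda>_. 0) then {{}} else {})"
    by (auto simp: color_sum_def)
  ultimately show ?case by (simp add: color_count_def)
next
  case (insert t T)
  obtain i where i: "\<kappa> t = unit_vec i" using insert.prems by auto
  let ?A = "{S \<in> Pow T. color_sum \<kappa> S = c}" and ?B = "{S \<in> Pow T. color_sum \<kappa> (insert t S) = c}"
  have cs: "color_sum \<kappa> (insert t S) = (color_sum \<kappa> S)(i := Suc (color_sum \<kappa> S i))" if "S \<in> Pow T" for S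
  proof -
    have "finite S" "t \<notin> S" using that insert.hyps finite_subset by auto
    then show ?thesis by (simp add: color_sum_def fun_eq_iff i unit_vec_def)
  qed
  have "{S \<in> Pow (insert t T). color_sum \<kappa> S = c} = ?A \<union> insert t ` ?B"
    unfolding Pow_insert by auto
  moreover have "?A \<inter> insert t ` ?B = {}" using insert.hyps by auto
  moreover have "card (insert t ` ?B) = card ?B"
    using insert.hyps by (intro card_image inj_onI) (auto simp: insert_ident)
  ultimately have card: "card {S \<in> Pow (insert t T). color_sum \<kappa> S = c} = card ?A + card ?B"
    using insert.hyps by (simp add: card_Un_disjoint)
  have IH: "card {S \<in> Pow T. color_sum \<kappa> S = c} = vbinom (color_count \<kappa> T) c" for c
    using insert.IH insert.prems by auto
  let ?n = "color_count \<kappa> T" and ?r = "\<Prod>j\<in>UNIV - {i}. color_count \<kappa> T j choose c j"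
  have vb: "vbinom (color_count \<kappa> (insert t T)) c = (Suc (?n i) choose c i) * ?r"
    using vbinom_update[of ?n i _ c "c i"] color_count_insert[of T t \<kappa> i] insert.hyps i by simp
  have A: "card ?A = (?n i choose c i) * ?r"
    using IH[of c] vbinom_update[of ?n i "?n i" c "c i"] by simp
  show ?case
  proof (cases "c i")
    case 0
    have "?B = {}" using cs 0 by (auto simp: fun_eq_iff)
    then have "card ?B = 0" by (simp only: card.empty)
    then show ?thesis using card A vb 0 by simp
  next
    case (Suc m)
    have "?B = {S \<in> Pow T. color_sum \<kappa> S = c(i := m)}"
    proof (intro Collect_cong conj_cong refl)
      fix S assume "S \<in> Pow T"
      from cs[OF this] show "color_sum \<kappa> (insert t S) = c \<longleftrightarrow> color_sum \<kappa> S = c(i := m)"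
        using Suc by (auto simp: fun_eq_iff)
    qed
    then have "card ?B = (?n i choose m) * ?r"
      using IH[of "c(i := m)"] vbinom_update[of ?n i "?n i" c m] by simp
    then show ?thesis using card A vb Suc by (simp add: distrib_right)
  qed
qed

section \<open>Counting monomials by support\<close>

text \<open>The offset \<open>g\<close> is added to the degree rather than subtracted from
  \<open>b\<close>, which avoids truncated subtraction.\<close>

definition mon_set :: "('v \<Rightarrow> 'm \<Rightarrow> nat) \<Rightarrow> 'v set \<Rightarrow> ('m \<Rightarrow> nat) \<Rightarrow> ('m \<Rightarrow> nat) \<Rightarrow> ('v \<Rightarrow>\<^sub>0 nat) set" where
  "mon_set \<pi> \<sigma> g b = {\<mu>. keys \<mu> = \<sigma> \<and> (\<forall>i. multidegree \<pi> \<mu> i + g i = b i)}"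

lemma finite_mon_set:
  fixes \<pi> :: "'v \<Rightarrow> 'm::finite \<Rightarrow> nat"
  assumes "finite \<sigma>" "\<pi> ` \<sigma> \<subseteq> range unit_vec"
  shows "finite (mon_set \<pi> \<sigma> g b)"
proof (rule finite_subset[OF _ finite_bounded_monomials[OF assms(1), of "vsize b"]])
  show "mon_set \<pi> \<sigma> g b \<subseteq> {\<mu>. keys \<mu> \<subseteq> \<sigma> \<and> (\<forall>v. lookup \<mu> v \<le> vsize b)}"
  proof clarify
    fix \<mu> assume \<mu>: "\<mu> \<in> mon_set \<pi> \<sigma> g b"
    then have k: "keys \<mu> = \<sigma>" and deg: "\<And>i. multidegree \<pi> \<mu> i \<le> b i"
      unfolding mon_set_def by (auto, metis le_add1)
    have "lookup \<mu> v \<le> vsize b" for v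
    proof (cases "v \<in> \<sigma>")
      case True
      then obtain i where i: "\<pi> v = unit_vec i" using assms(2) by auto
      have "lookup \<mu> v = lookup \<mu> v * \<pi> v i" by (simp add: i unit_vec_def)
      also have "\<dots> \<le> multidegree \<pi> \<mu> i"
        unfolding multidegree_def k using assms(1) True by (intro member_le_sum) auto
      also have "\<dots> \<le> b i" by (rule deg)
      also have "\<dots> \<le> vsize b" unfolding vsize_def by (rule member_le_sum) auto
      finally show ?thesis .
    qed (use k in \<open>auto simp: in_keys_iff\<close>)
    then show "keys \<mu> \<subseteq> \<sigma> \<and> (\<forall>v. lookup \<mu> v \<le> vsize b)" using k by simp
  qed
qed

text \<open>Divide the monomials with support \<open>insert v \<sigma>\<close> by \<open>x\<^sub>v\<close>.\<close>

lemma card_mon_set_insert: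
  fixes \<pi> :: "'v \<Rightarrow> 'm::finite \<Rightarrow> nat"
  assumes "finite \<sigma>" "v \<notin> \<sigma>" "\<pi> ` insert v \<sigma> \<subseteq> range unit_vec"
  shows "card (mon_set \<pi> (insert v \<sigma>) g b) =
    card (mon_set \<pi> (insert v \<sigma>) (\<lambda>i. g i + \<pi> v i) b) + card (mon_set \<pi> \<sigma> (\<lambda>i. g i + \<pi> v i) b)"
proof -
  let ?A = "mon_set \<pi> (insert v \<sigma>) (\<lambda>i. g i + \<pi> v i) b" and ?B = "mon_set \<pi> \<sigma> (\<lambda>i. g i + \<pi> v i) b"
  have "mon_set \<pi> (insert v \<sigma>) g b = (\<lambda>\<nu>. \<nu> + var_exp v) ` (?A \<union> ?B)"
  proof
    show "(\<lambda>\<nu>. \<nu> + var_exp v) ` (?A \<union> ?B) \<subseteq> mon_set \<pi> (insert v \<sigma>) g b"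
      by (auto simp: mon_set_def multidegree_add add_ac)
    show "mon_set \<pi> (insert v \<sigma>) g b \<subseteq> (\<lambda>\<nu>. \<nu> + var_exp v) ` (?A \<union> ?B)"
    proof
      fix \<mu> assume \<mu>: "\<mu> \<in> mon_set \<pi> (insert v \<sigma>) g b"
      define \<nu> where "\<nu> = \<mu> - var_exp v"
      have "v \<in> keys \<mu>" using \<mu> by (simp add: mon_set_def)
      then have "lookup \<mu> v > 0" by (simp add: in_keys_iff)
      then have e: "\<mu> = \<nu> + var_exp v" unfolding \<nu>_def
        by (intro poly_mapping_eqI) (auto simp: lookup_add lookup_minus lookup_single when_def)
      have "insert v (keys \<nu>) = insert v \<sigma>" using \<mu> by (simp add: mon_set_def e)
      then have "keys \<nu> = insert v \<sigma> \<or> keys \<nu> = \<sigma>"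
        using assms(2) by (metis insert_absorb insert_ident)
      moreover have "\<forall>i. multidegree \<pi> \<nu> i + (g i + \<pi> v i) = b i"
        using \<mu> by (simp add: mon_set_def e multidegree_add add_ac)
      ultimately have "\<nu> \<in> ?A \<union> ?B" by (auto simp: mon_set_def)
      then show "\<mu> \<in> (\<lambda>\<nu>. \<nu> + var_exp v) ` (?A \<union> ?B)" using e by blast
    qed
  qed
  moreover have "inj_on (\<lambda>\<nu>. \<nu> + var_exp v) (?A \<union> ?B)" by (auto intro: inj_onI)
  ultimately have "card (mon_set \<pi> (insert v \<sigma>) g b) = card (?A \<union> ?B)" by (simp add: card_image)
  also have "\<dots> = card ?A + card ?B"
    using finite_mon_set[of "insert v \<sigma>" \<pi>] finite_mon_set[of \<sigma> \<pi>] assms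
    by (intro card_Un_disjoint) (auto simp: mon_set_def)
  finally show ?thesis .
qed

text \<open>The coefficient of t^b in t^g times the product of 1 - t^(\<kappa> k) over k in
  \<open>T\<close> times the product of t^(\<pi> v) / (1 - t^(\<pi> v)) over v in
  \<open>\<sigma>\<close>: the Koszul Euler characteristic on monomials with support exactly
  \<open>\<sigma>\<close>.\<close>

definition signed_count where
  "signed_count \<kappa> \<pi> T \<sigma> g b =
     (\<Sum>S\<in>Pow T. (- 1) ^ card S * int (card (mon_set \<pi> \<sigma> (\<lambda>i. g i + color_sum \<kappa> S i) b)))"

text \<open>A form of the colour of \<open>v\<close> cancels the geometric series of
  \<open>v\<close>: (1 - x) * x / (1 - x) = x for x = t^(\<pi> v). The sets \<open>S\<close> and
  \<open>insert t S\<close> are paired to see this on coefficients.\<close>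

lemma signed_count_insert:
  fixes \<pi> :: "'v \<Rightarrow> 'm::finite \<Rightarrow> nat"
  assumes "finite \<sigma>" "v \<notin> \<sigma>" "\<pi> ` insert v \<sigma> \<subseteq> range unit_vec" "finite T" "t \<notin> T" "\<kappa> t = \<pi> v"
  shows "signed_count \<kappa> \<pi> (insert t T) (insert v \<sigma>) g b = signed_count \<kappa> \<pi> T \<sigma> (\<lambda>i. g i + \<pi> v i) b"
proof -
  let ?f = "\<lambda>S. (- 1) ^ card S * int (card (mon_set \<pi> (insert v \<sigma>) (\<lambda>i. g i + color_sum \<kappa> S i) b))"
  have inj: "inj_on (insert t) (Pow T)" using assms(5) by (auto intro!: inj_onI simp: insert_ident)
  have "signed_count \<kappa> \<pi> (insert t T) (insert v \<sigma>) g b = sum ?f (Pow T) + sum ?f (insert t ` Pow T)"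
    unfolding signed_count_def Pow_insert using assms(4,5) by (intro sum.union_disjoint) auto
  also have "sum ?f (insert t ` Pow T) = (\<Sum>S\<in>Pow T. ?f (insert t S))"
    using inj by (simp add: sum.reindex)
  also have "sum ?f (Pow T) + \<dots> = (\<Sum>S\<in>Pow T. ?f S + ?f (insert t S))"
    by (rule sum.distrib[symmetric])
  also have "\<dots> = signed_count \<kappa> \<pi> T \<sigma> (\<lambda>i. g i + \<pi> v i) b"
    unfolding signed_count_def
  proof (rule sum.cong[OF refl])
    fix S assume "S \<in> Pow T"
    then have S: "finite S" "t \<notin> S" using assms(4,5) finite_subset by auto
    have "(\<lambda>i. g i + color_sum \<kappa> (insert t S) i) = (\<lambda>i. g i + color_sum \<kappa> S i + \<pi> v i)"
      using S assms(6) by (auto simp: color_sum_def fun_eq_iff)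
    moreover have "(\<lambda>i. g i + \<pi> v i + color_sum \<kappa> S i) = (\<lambda>i. g i + color_sum \<kappa> S i + \<pi> v i)"
      by (simp add: add_ac)
    ultimately show "?f S + ?f (insert t S) =
        (- 1) ^ card S * int (card (mon_set \<pi> \<sigma> (\<lambda>i. g i + \<pi> v i + color_sum \<kappa> S i) b))"
      using card_mon_set_insert[OF assms(1-3), of "\<lambda>i. g i + color_sum \<kappa> S i" b] S
      by (simp add: distrib_left)
  qed
  finally show ?thesis .
qed

lemma vsize_color_sum:
  assumes "\<kappa> ` S \<subseteq> range unit_vec"
  shows "vsize (color_sum \<kappa> S) = card S"
proof -
  have "vsize (color_sum \<kappa> S) = (\<Sum>k\<in>S. vsize (\<kappa> k))"
    unfolding vsize_def color_sum_def by (rule sum.swap)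
  also have "\<dots> = (\<Sum>k\<in>S. 1)" using assms by (intro sum.cong) auto
  finally show ?thesis by simp
qed

text \<open>With empty support the monomial is \<open>1\<close>, so only the sets of forms of degree
  \<open>b - g\<close> contribute, and they all have the same size.\<close>

lemma signed_count_empty:
  fixes \<pi> :: "'v \<Rightarrow> 'm::finite \<Rightarrow> nat" and \<kappa> :: "'k \<Rightarrow> 'm \<Rightarrow> nat"
  assumes "finite T" "\<kappa> ` T \<subseteq> range unit_vec"
  shows "signed_count \<kappa> \<pi> T {} g b =
    (if g \<le> b then (- 1) ^ (vsize b - vsize g) * int (vbinom (color_count \<kappa> T) (b - g)) else 0)"
proof -
  have mono: "mon_set \<pi> {} h b = (if h = b then {0} else {})" for h
    by (auto simp: mon_set_def fun_eq_iff)
  have "signed_count \<kappa> \<pi> T {} g b =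
      (\<Sum>S\<in>Pow T. if (\<lambda>i. g i + color_sum \<kappa> S i) = b then (- 1) ^ card S else 0)"
    unfolding signed_count_def mono by (rule sum.cong) auto
  also have "\<dots> = (\<Sum>S | S \<in> Pow T \<and> (\<lambda>i. g i + color_sum \<kappa> S i) = b. (- 1) ^ card S)"
    using assms(1) by (intro sum.inter_filter[symmetric]) simp
  also have "\<dots> = (if g \<le> b then (- 1) ^ (vsize b - vsize g) * int (vbinom (color_count \<kappa> T) (b - g)) else 0)"
  proof (cases "g \<le> b")
    case False
    then have "{S \<in> Pow T. (\<lambda>i. g i + color_sum \<kappa> S i) = b} = {}" by (auto simp: le_fun_def)
    then show ?thesis using False by (simp only: sum.empty if_False)
  next
    case True
    then have eq: "{S \<in> Pow T. (\<lambda>i. g i + color_sum \<kappa> S i) = b} = {S \<in> Pow T. color_sum \<kappa> S = b - g}"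
    proof (intro Collect_cong conj_cong refl)
      fix S
      have "(\<forall>i. g i + color_sum \<kappa> S i = b i) \<longleftrightarrow> (\<forall>i. color_sum \<kappa> S i = b i - g i)"
        using True unfolding le_fun_def by (metis add_diff_cancel_left' le_add_diff_inverse)
      then show "(\<lambda>i. g i + color_sum \<kappa> S i) = b \<longleftrightarrow> color_sum \<kappa> S = b - g"
        by (simp add: fun_eq_iff)
    qed
    have "card S = vsize b - vsize g" if S: "S \<in> Pow T" "color_sum \<kappa> S = b - g" for S
    proof -
      have "\<kappa> ` S \<subseteq> range unit_vec" using S(1) assms(2) by blast
      from vsize_color_sum[OF this] have "card S = vsize (b - g)" by (simp only: S(2))
      also have "\<dots> = vsize b - vsize g"
        using True unfolding vsize_def by (simp add: sum_subtractf_nat le_fun_def)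
      finally show ?thesis .
    qed
    then have "(\<Sum>S | S \<in> Pow T \<and> color_sum \<kappa> S = b - g. (- 1) ^ card S) =
        (\<Sum>S | S \<in> Pow T \<and> color_sum \<kappa> S = b - g. (- 1 :: int) ^ (vsize b - vsize g))"
      by (intro sum.cong) auto
    then show ?thesis
      unfolding eq using card_subsets_color_sum[OF assms, of "b - g"] True by simp
  qed
  finally show ?thesis .
qed

text \<open>Every vertex of \<open>\<sigma>\<close> uses up one form of its colour, of which there
  are enough by the bound on \<open>color_sum \<pi> \<sigma>\<close>; the remaining forms are
  expanded binomially.\<close>

lemma signed_count_eq:
  fixes \<pi> :: "'v \<Rightarrow> 'm::finite \<Rightarrow> nat" and \<kappa> :: "'k \<Rightarrow> 'm \<Rightarrow> nat"
  assumes "finite \<sigma>" "\<pi> ` \<sigma> \<subseteq> range unit_vec" "finite T" "\<kappa> ` T \<subseteq> range unit_vec"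
    and "color_sum \<pi> \<sigma> \<le> color_count \<kappa> T"
  shows "signed_count \<kappa> \<pi> T \<sigma> g b =
    (if (\<lambda>i. g i + color_sum \<pi> \<sigma> i) \<le> b
     then (- 1) ^ (vsize b - vsize (\<lambda>i. g i + color_sum \<pi> \<sigma> i)) *
       int (vbinom (\<lambda>i. color_count \<kappa> T i - color_sum \<pi> \<sigma> i) (\<lambda>i. b i - (g i + color_sum \<pi> \<sigma> i))) else 0)"
  using assms
proof (induction \<sigma> arbitrary: T g rule: finite_induct)
  case empty
  have "color_sum \<pi> {} = (\<lambda>i. 0)" by (simp add: color_sum_def)
  moreover have "b - g = (\<lambda>i. b i - g i)" by (simp add: fun_eq_iff)
  ultimately show ?case using signed_count_empty[OF empty.prems(2,3), of \<pi> g b] by simp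
next
  case (insert v \<sigma>)
  obtain i where i: "\<pi> v = unit_vec i" using insert.prems(1) by auto
  have cs: "color_sum \<pi> (insert v \<sigma>) j = \<pi> v j + color_sum \<pi> \<sigma> j" for j
    using insert.hyps by (simp add: color_sum_def)
  have "color_sum \<pi> (insert v \<sigma>) i > 0" by (simp add: cs i unit_vec_def)
  then have "color_count \<kappa> T i > 0" using insert.prems(4) by (metis le_fun_def le_zero_eq not_gr_zero)
  then obtain t where t: "t \<in> T" "\<kappa> t = unit_vec i"
    unfolding color_count_def by (auto simp: card_gt_0_iff)
  let ?T = "T - {t}"
  have T: "T = insert t ?T" "t \<notin> ?T" "finite ?T" using t insert.prems(2) by auto
  have cc: "color_count \<kappa> T j = \<pi> v j + color_count \<kappa> ?T j" for j
    by (subst T(1), subst color_count_insert[where \<kappa> = \<kappa>, OF T(3,2) t(2)]) (simp add: i unit_vec_def)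
  have "color_sum \<pi> \<sigma> \<le> color_count \<kappa> ?T"
    using insert.prems(4) by (simp add: le_fun_def cs cc)
  then have IH: "signed_count \<kappa> \<pi> ?T \<sigma> (\<lambda>i. g i + \<pi> v i) b =
    (if (\<lambda>i. g i + \<pi> v i + color_sum \<pi> \<sigma> i) \<le> b
     then (- 1) ^ (vsize b - vsize (\<lambda>i. g i + \<pi> v i + color_sum \<pi> \<sigma> i)) *
       int (vbinom (\<lambda>i. color_count \<kappa> ?T i - color_sum \<pi> \<sigma> i) (\<lambda>i. b i - (g i + \<pi> v i + color_sum \<pi> \<sigma> i))) else 0)"
    using insert.prems(1,3) T(3) by (intro insert.IH) auto
  have "signed_count \<kappa> \<pi> T (insert v \<sigma>) g b = signed_count \<kappa> \<pi> ?T \<sigma> (\<lambda>i. g i + \<pi> v i) b"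
    using signed_count_insert[OF insert.hyps insert.prems(1) T(3,2), of \<kappa> g b] t(2) i T(1) by simp
  then show ?case unfolding IH cs cc by (simp add: add.assoc)
qed

lemma finite_fun_le: "finite {c :: 'm::finite \<Rightarrow> nat. c \<le> b}"
proof (rule finite_subset)
  show "{c. c \<le> b} \<subseteq> {f. \<forall>x. (x \<in> UNIV \<longrightarrow> f x \<in> {..vsize b}) \<and> (x \<notin> UNIV \<longrightarrow> f x = 0)}"
  proof clarsimp
    fix c x assume "c \<le> b"
    then have "c x \<le> b x" by (simp add: le_fun_def)
    also have "\<dots> \<le> vsize b" unfolding vsize_def by (rule member_le_sum) auto
    finally show "c x \<le> vsize b" .
  qed
qed (rule finite_set_of_finite_funs, auto)

section \<open>Flag h-numbers as Euler characteristics\<close>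

context graded_forms
begin

lemma dim_D_0: "fn.dim (D 0 j) = (\<Sum>S | S \<subseteq> {..<d} \<and> card S = j. \<Sum>\<sigma>\<in>\<Delta>. card (mon_set \<pi> \<sigma> (color_sum \<kappa> S) b))"
proof -
  let ?I = "{S. S \<subseteq> {..<d} \<and> card S = j}"
  let ?X = "SIGMA S:?I. \<Union>\<sigma>\<in>\<Delta>. mon_set \<pi> \<sigma> (color_sum \<kappa> S) b"
  have fin\<Delta>: "finite \<Delta>" using complex by (simp add: simplicial_complex_def)
  have unit: "\<pi> ` \<sigma> \<subseteq> range unit_vec" if "\<sigma> \<in> \<Delta>" for \<sigma>
    using that face_subset unit_pi by blast
  have cdeg_iff: "cdeg S \<mu> = b \<longleftrightarrow> (\<forall>i. multidegree \<pi> \<mu> i + color_sum \<kappa> S i = b i)" for S \<mu>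
    unfolding cdeg_def color_sum_def fun_eq_iff by (simp only: add.commute)
  have "cells 0 j = (\<lambda>(S, \<mu>). (S, {}, \<mu>)) ` ?X"
  proof
    show "cells 0 j \<subseteq> (\<lambda>(S, \<mu>). (S, {}, \<mu>)) ` ?X"
    proof
      fix x assume "x \<in> cells 0 j"
      then obtain S \<tau> \<mu> where x: "x = (S, \<tau>, \<mu>)" "S \<subseteq> {..<d}" "card S = j" "card \<tau> = 0"
        "\<tau> \<union> keys \<mu> \<in> \<Delta>" "cdeg S \<mu> = b" by (auto simp: cells_def)
      then have "\<tau> = {}" using finite_face[OF x(5)] by simp
      moreover have "\<mu> \<in> mon_set \<pi> (keys \<mu>) (color_sum \<kappa> S) b"
        using x(6) by (auto simp: mon_set_def cdeg_def color_sum_def add.commute)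
      ultimately have "(S, \<mu>) \<in> ?X" "x = (S, {}, \<mu>)" using x by auto
      then show "x \<in> (\<lambda>(S, \<mu>). (S, {}, \<mu>)) ` ?X" by force
    qed
    show "(\<lambda>(S, \<mu>). (S, {}, \<mu>)) ` ?X \<subseteq> cells 0 j"
      by (auto simp: mon_set_def cells_def cdeg_def color_sum_def add.commute)
  qed
  moreover have "inj_on (\<lambda>(S, \<mu>). (S, {} :: 'v set, \<mu>)) ?X" by (auto intro: inj_onI)
  ultimately have "card (cells 0 j) = card ?X" by (simp add: card_image)
  also have "\<dots> = (\<Sum>S\<in>?I. card (\<Union>\<sigma>\<in>\<Delta>. mon_set \<pi> \<sigma> (color_sum \<kappa> S) b))"
    using fin\<Delta> finite_mon_set[OF finite_face unit] by (intro card_SigmaI) auto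
  also have "\<dots> = (\<Sum>S\<in>?I. \<Sum>\<sigma>\<in>\<Delta>. card (mon_set \<pi> \<sigma> (color_sum \<kappa> S) b))"
    using fin\<Delta> finite_mon_set[OF finite_face unit]
    by (intro sum.cong refl card_UN_disjoint) (auto simp: mon_set_def)
  finally show ?thesis by (simp add: D_def dim_supported[OF finite_cells])
qed

lemma euler_characteristic:
  "(\<Sum>j\<le>vsize b. (- 1) ^ j * int (fn.dim (D 0 j))) = (\<Sum>\<sigma>\<in>\<Delta>. signed_count \<kappa> \<pi> {..<d} \<sigma> (\<lambda>_. 0) b)"
proof -
  let ?m = "\<lambda>S \<sigma>. int (card (mon_set \<pi> \<sigma> (color_sum \<kappa> S) b))"
  have zero: "fn.dim (D 0 j) = 0" if "j > vsize b" for j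
    using D_zero_if_large[OF that] fn_dim_zero by simp
  \<comment> \<open>The range is enlarged by zero terms so that it contains the size of every subset
    of \<open>{..<d}\<close>, as needed for grouping subsets by size.\<close>
  have "(\<Sum>j\<le>vsize b. (- 1) ^ j * int (fn.dim (D 0 j))) = (\<Sum>j\<le>vsize b + d. (- 1) ^ j * int (fn.dim (D 0 j)))"
    by (rule sum.mono_neutral_left) (auto simp: zero)
  also have "\<dots> = (\<Sum>j\<le>vsize b + d. \<Sum>S | S \<in> Pow {..<d} \<and> card S = j. (- 1) ^ card S * (\<Sum>\<sigma>\<in>\<Delta>. ?m S \<sigma>))"
    by (simp add: dim_D_0 sum_distrib_left)
  also have "\<dots> = (\<Sum>S\<in>Pow {..<d}. (- 1) ^ card S * (\<Sum>\<sigma>\<in>\<Delta>. ?m S \<sigma>))"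
  proof (rule sum.group)
    show "card ` Pow {..<d} \<subseteq> {..vsize b + d}"
    proof (rule image_subsetI)
      fix S assume "S \<in> Pow {..<d}"
      then have "card S \<le> card {..<d}" by (intro card_mono) auto
      then show "card S \<in> {..vsize b + d}" by simp
    qed
  qed auto
  also have "\<dots> = (\<Sum>\<sigma>\<in>\<Delta>. signed_count \<kappa> \<pi> {..<d} \<sigma> (\<lambda>_. 0) b)"
    unfolding signed_count_def sum_distrib_left by (simp add: sum.swap[of _ \<Delta>])
  finally show ?thesis .
qed

text \<open>With \<open>a i\<close> forms of colour \<open>i\<close>, the contribution of a face
  depends only on its colour vector, and is the coefficient of the corresponding flag f-number in
  the flag h-number.\<close>

lemma euler_characteristic_flag_h:
  assumes a: "\<And>i. card {k. k < d \<and> \<kappa> k = unit_vec i} = a i"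
    and bal: "\<And>\<sigma>. \<sigma> \<in> \<Delta> \<Longrightarrow> color_sum \<pi> \<sigma> \<le> a"
  shows "(\<Sum>j\<le>vsize b. (- 1) ^ j * int (fn.dim (D 0 j))) = flag_h \<Delta> \<pi> a b"
proof -
  have cc: "color_count \<kappa> {..<d} = a" using a by (auto simp: color_count_def fun_eq_iff)
  let ?t = "\<lambda>c. (- 1) ^ (vsize b - vsize c) * int (vbinom (a - c) (b - c))"
  have fin\<Delta>: "finite \<Delta>" using complex by (simp add: simplicial_complex_def)
  have finb: "finite {c. c \<le> b}" by (rule finite_fun_le)
  have "signed_count \<kappa> \<pi> {..<d} \<sigma> (\<lambda>_. 0) b = (if color_sum \<pi> \<sigma> \<le> b then ?t (color_sum \<pi> \<sigma>) else 0)"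
    if \<sigma>: "\<sigma> \<in> \<Delta>" for \<sigma>
  proof -
    have "a - color_sum \<pi> \<sigma> = (\<lambda>i. a i - color_sum \<pi> \<sigma> i)" "b - color_sum \<pi> \<sigma> = (\<lambda>i. b i - color_sum \<pi> \<sigma> i)"
      by auto
    moreover have "\<pi> ` \<sigma> \<subseteq> range unit_vec" using face_subset[OF \<sigma>] unit_pi by blast
    moreover have "\<kappa> ` {..<d} \<subseteq> range unit_vec" using unit_kappa by blast
    ultimately show ?thesis
      using signed_count_eq[OF finite_face[OF \<sigma>], of \<pi> "{..<d}" \<kappa> "\<lambda>_. 0" b] bal[OF \<sigma>] cc by simp
  qed
  then have "(\<Sum>j\<le>vsize b. (- 1) ^ j * int (fn.dim (D 0 j))) =
      (\<Sum>\<sigma>\<in>\<Delta>. if color_sum \<pi> \<sigma> \<le> b then ?t (color_sum \<pi> \<sigma>) else 0)"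
    unfolding euler_characteristic by (rule sum.cong[OF refl])
  also have "\<dots> = (\<Sum>\<sigma> | \<sigma> \<in> \<Delta> \<and> color_sum \<pi> \<sigma> \<le> b. ?t (color_sum \<pi> \<sigma>))"
    using fin\<Delta> by (simp add: sum.inter_filter)
  also have "\<dots> = (\<Sum>c\<in>{c. c \<le> b}. \<Sum>\<sigma> | \<sigma> \<in> {\<sigma> \<in> \<Delta>. color_sum \<pi> \<sigma> \<le> b} \<and> color_sum \<pi> \<sigma> = c. ?t (color_sum \<pi> \<sigma>))"
    using fin\<Delta> finb by (intro sum.group[symmetric]) auto
  also have "\<dots> = (\<Sum>c\<in>{c. c \<le> b}. ?t c * int (flag_f \<Delta> \<pi> c))"
  proof (rule sum.cong[OF refl])
    fix c assume "c \<in> {c. c \<le> b}"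
    then have "{\<sigma>. \<sigma> \<in> {\<sigma> \<in> \<Delta>. color_sum \<pi> \<sigma> \<le> b} \<and> color_sum \<pi> \<sigma> = c} = {\<sigma> \<in> \<Delta>. color_sum \<pi> \<sigma> = c}" by auto
    then have "(\<Sum>\<sigma> | \<sigma> \<in> {\<sigma> \<in> \<Delta>. color_sum \<pi> \<sigma> \<le> b} \<and> color_sum \<pi> \<sigma> = c. ?t (color_sum \<pi> \<sigma>)) =
        (\<Sum>\<sigma> | \<sigma> \<in> \<Delta> \<and> color_sum \<pi> \<sigma> = c. ?t c)" by (intro sum.cong) auto
    then show "(\<Sum>\<sigma> | \<sigma> \<in> {\<sigma> \<in> \<Delta>. color_sum \<pi> \<sigma> \<le> b} \<and> color_sum \<pi> \<sigma> = c. ?t (color_sum \<pi> \<sigma>)) =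
        ?t c * int (flag_f \<Delta> \<pi> c)" by (simp add: flag_f_def)
  qed
  finally show ?thesis by (simp add: flag_h_def)
qed

lemma card_tops:
  assumes "\<And>i. card {k. k < d \<and> \<kappa> k = unit_vec i} = a i"
  shows "card tops = vbinom a b"
proof -
  have "color_count \<kappa> {..<d} = a" using assms by (auto simp: color_count_def fun_eq_iff)
  moreover have "tops = {S \<in> Pow {..<d}. color_sum \<kappa> S = b}"
    by (auto simp: tops_def color_sum_def)
  ultimately show ?thesis using card_subsets_color_sum[of "{..<d}" \<kappa> b] unit_kappa by auto
qed

end

section \<open>Duality between the Artinian reduction and its inverse system\<close>

definition pairing :: "('a \<Rightarrow> 'f) \<Rightarrow> ('a \<Rightarrow>\<^sub>0 'f) \<Rightarrow> 'f::field" where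
  "pairing f p = (\<Sum>\<mu>\<in>keys p. lookup p \<mu> * f \<mu>)"

lemma pairing_superset:
  assumes "finite W" "keys p \<subseteq> W"
  shows "pairing f p = (\<Sum>\<mu>\<in>W. lookup p \<mu> * f \<mu>)"
  unfolding pairing_def using assms
  by (intro sum.mono_neutral_left) (auto simp: in_keys_iff)

lemma pairing_add: "pairing f (p + q) = pairing f p + pairing f q"
proof -
  let ?W = "keys p \<union> keys q"
  have "keys (p + q) \<subseteq> ?W" by (rule Poly_Mapping.keys_add)
  then show ?thesis
    using pairing_superset[of ?W "p + q" f] pairing_superset[of ?W p f] pairing_superset[of ?W q f]
    by (simp add: lookup_add distrib_right sum.distrib)
qed

lemma pairing_0 [simp]: "pairing f 0 = 0"
  by (simp add: pairing_def)

lemma pairing_uminus [simp]: "pairing f (- p) = - pairing f p"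
  by (simp add: pairing_def sum_negf)

lemma pairing_diff: "pairing f (p - q) = pairing f p - pairing f q"
  using pairing_add[of f p "- q"] by simp

lemma pairing_sum: "pairing f (\<Sum>i\<in>I. p i) = (\<Sum>i\<in>I. pairing f (p i))"
  by (induction I rule: infinite_finite_induct) (simp_all add: pairing_add)

lemma pairing_single [simp]: "pairing f (single \<mu> c) = c * f \<mu>"
  by (simp add: pairing_def)

lemma poly_mapping_eq_sum: "p = (\<Sum>\<mu>\<in>keys p. single \<mu> (lookup p \<mu>))"
proof (rule poly_mapping_eqI)
  fix \<nu>
  show "lookup p \<nu> =
      lookup (\<Sum>\<mu>\<in>keys p. single \<mu> (lookup p \<mu>)) \<nu>"
    by (simp add: lookup_sum lookup_single when_def in_keys_iff)
qed

text \<open>Multiplication by a monomial is adjoint to a shift of the function. Hence the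
  polynomials killed by a shift-closed family form an ideal.\<close>

lemma pairing_single_mult:
  "pairing f (single \<nu> c * p) = c * pairing (\<lambda>\<mu>. f (\<nu> + \<mu>)) p"
proof -
  have "pairing f (single \<nu> c * p) =
      pairing f (\<Sum>\<mu>\<in>keys p. single (\<nu> + \<mu>) (c * lookup p \<mu>))"
    by (subst poly_mapping_eq_sum[of p]) (simp add: sum_distrib_left mult_single)
  also have "\<dots> = (\<Sum>\<mu>\<in>keys p. c * lookup p \<mu> * f (\<nu> + \<mu>))"
    by (simp only: pairing_sum pairing_single)
  also have "\<dots> = c * pairing (\<lambda>\<mu>. f (\<nu> + \<mu>)) p"
    by (simp add: pairing_def sum_distrib_left mult.assoc)
  finally show ?thesis .
qed

lemma pairing_mult:
  "pairing f (p * q) = (\<Sum>\<nu>\<in>keys p. lookup p \<nu> * pairing (\<lambda>\<mu>. f (\<nu> + \<mu>)) q)"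
  by (subst poly_mapping_eq_sum[of p]) (simp add: sum_distrib_right pairing_sum pairing_single_mult)

lemma sf_monomial_eq:
  assumes "finite \<sigma>"
  shows "sf_monomial \<sigma> = single (\<Sum>v\<in>\<sigma>. single v 1) (1 :: 'f::field)"
  using assms unfolding sf_monomial_def
  by (induction \<sigma> rule: finite_induct) (simp_all add: mult_single)

lemma keys_sum_var_exp:
  assumes "finite \<sigma>"
  shows "keys (\<Sum>v\<in>\<sigma>. single v (1 :: nat)) = \<sigma>"
  using assms by (induction \<sigma> rule: finite_induct) (simp_all add: keys_plus_nat)

lemma poly_component_iff:
  "p \<in> poly_component V \<pi> b \<longleftrightarrow> (\<forall>\<mu>\<in>keys p. keys \<mu> \<subseteq> V \<and> multidegree \<pi> \<mu> = b)"
  by (auto simp: poly_component_def)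

section \<open>The tower of quotient rings and its annihilated functions\<close>

text \<open>\<open>pk k\<close> is a chosen linear representative of the \<open>k\<close>-th
  parameter. Together with the composite map \<open>quo\<close> it lets all computations take place
  with polynomials instead of nested cosets.\<close>

locale sr_forms =
  fixes \<Delta> :: "'v set set" and \<Theta> :: "('v, 'f::field) mpoly set list" and pk :: "nat \<Rightarrow> ('v, 'f) mpoly"
  assumes complex: "simplicial_complex \<Delta>"
    and pk_linear: "k < length \<Theta> \<Longrightarrow> pk k \<in> linear_polys (vertices \<Delta>)"
    and theta: "k < length \<Theta> \<Longrightarrow> \<Theta> ! k = SR_map \<Delta> (pk k)"
begin

abbreviation "V \<equiv> vertices \<Delta>"
abbreviation R :: "('v, 'f) mpoly ring" where "R \<equiv> poly_ring V"
abbreviation I :: "('v, 'f) mpoly set" where "I \<equiv> SR_ideal \<Delta>"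
abbreviation Q :: "('v, 'f) mpoly set ring" where "Q \<equiv> SR_ring \<Delta>"
abbreviation "J \<equiv> param_ideal \<Delta> \<Theta>"
abbreviation "QQ \<equiv> SR_quot \<Delta> \<Theta>"
abbreviation "K \<equiv> SR_quot_constants \<Delta> \<Theta>"

definition th :: "nat \<Rightarrow> 'v \<Rightarrow> 'f" where
  "th k v = lookup (pk k) (var_exp v)"

definition quo :: "('v, 'f) mpoly \<Rightarrow> ('v, 'f) mpoly set set" where
  "quo p = quot_map Q J (SR_map \<Delta> p)"

lemma finite_V: "finite V"
  using complex by (auto simp: vertices_def simplicial_complex_def)

lemma subface: "\<sigma> \<in> \<Delta> \<Longrightarrow> \<tau> \<subseteq> \<sigma> \<Longrightarrow> \<tau> \<in> \<Delta>"
  using complex by (auto simp: simplicial_complex_def)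

lemma face_subset: "\<sigma> \<in> \<Delta> \<Longrightarrow> \<sigma> \<subseteq> V"
  by (auto simp: vertices_def)

sublocale R: cring R by (rule cring_poly_ring)

lemma gens_carrier: "sf_monomial ` {\<sigma>. \<sigma> \<subseteq> V \<and> \<sigma> \<notin> \<Delta>} \<subseteq> carrier R"
proof (rule image_subsetI)
  fix \<sigma> assume "\<sigma> \<in> {\<sigma>. \<sigma> \<subseteq> V \<and> \<sigma> \<notin> \<Delta>}"
  then have "\<sigma> \<subseteq> V" "finite \<sigma>" using finite_V finite_subset by auto
  then show "sf_monomial \<sigma> \<in> carrier R"
    using keys_sum_var_exp[of \<sigma>] by (simp add: sf_monomial_eq)
qed

sublocale I: ideal I R
  unfolding SR_ideal_def by (rule R.genideal_ideal[OF gens_carrier])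

sublocale Q: cring Q
  unfolding SR_ring_def by (rule I.quotient_is_cring[OF cring_poly_ring])

sublocale RQ: ring_hom_ring R Q "SR_map \<Delta>"
  using I.rcos_ring_hom_ring unfolding SR_ring_def SR_map_def quot_map_def[abs_def] .

lemma pk_carrier: "k < length \<Theta> \<Longrightarrow> pk k \<in> carrier R"
  using pk_linear unfolding linear_polys_def by blast

lemma Theta_carrier: "set \<Theta> \<subseteq> carrier Q"
proof
  fix x assume "x \<in> set \<Theta>"
  then obtain k where "k < length \<Theta>" "x = \<Theta> ! k" by (auto simp: in_set_conv_nth)
  then show "x \<in> carrier Q" using RQ.hom_closed[OF pk_carrier] theta by simp
qed

sublocale J: ideal J Q
  unfolding param_ideal_def by (rule Q.genideal_ideal[OF Theta_carrier])

sublocale QQ: cring QQ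
  unfolding SR_quot_def by (rule J.quotient_is_cring[OF Q.is_cring])

sublocale QQhom: ring_hom_ring Q QQ "quot_map Q J"
  using J.rcos_ring_hom_ring unfolding SR_quot_def quot_map_def[abs_def] .

sublocale quo: ring_hom_ring R QQ quo
proof (rule ring_hom_ringI2[OF R.ring_axioms QQ.ring_axioms])
  have "quot_map Q J \<circ> SR_map \<Delta> \<in> ring_hom R QQ"
    by (rule ring_hom_trans[OF RQ.homh QQhom.homh])
  then show "quo \<in> ring_hom R QQ" unfolding quo_def[abs_def] comp_def .
qed

lemma carrier_Q: "carrier Q = SR_map \<Delta> ` carrier R"
  unfolding SR_ring_def SR_map_def quot_map_def FactRing_def
  using A_RCOSETS_def'[of R I] by auto

lemma quo_eq_zero_iff:
  assumes "p \<in> carrier R"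
  shows "quo p = \<zero>\<^bsub>QQ\<^esub> \<longleftrightarrow> SR_map \<Delta> p \<in> J"
proof -
  have "SR_map \<Delta> p \<in> carrier Q" using assms by (rule RQ.hom_closed)
  then have "J +>\<^bsub>Q\<^esub> SR_map \<Delta> p = J \<longleftrightarrow> SR_map \<Delta> p \<in> J"
    using J.rcos_const_imp_mem J.a_rcos_const by blast
  then show ?thesis unfolding quo_def quot_map_def SR_quot_def FactRing_def by simp
qed

lemma SR_map_eq_zero_iff:
  assumes "p \<in> carrier R"
  shows "SR_map \<Delta> p = \<zero>\<^bsub>Q\<^esub> \<longleftrightarrow> p \<in> I"
proof -
  have "I +>\<^bsub>R\<^esub> p = I \<longleftrightarrow> p \<in> I"
    using assms I.rcos_const_imp_mem I.a_rcos_const by blast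
  then show ?thesis unfolding SR_map_def quot_map_def SR_ring_def FactRing_def by simp
qed

lemma quo_pk: "k < length \<Theta> \<Longrightarrow> quo (pk k) = \<zero>\<^bsub>QQ\<^esub>"
  using quo_eq_zero_iff[OF pk_carrier] theta Q.genideal_self[OF Theta_carrier]
  unfolding param_ideal_def by (metis nth_mem subsetD)

lemma quo_I:
  assumes "p \<in> I"
  shows "quo p = \<zero>\<^bsub>QQ\<^esub>"
proof -
  have p: "p \<in> carrier R" using assms by (rule I.a_Hcarr)
  then have "SR_map \<Delta> p = \<zero>\<^bsub>Q\<^esub>" using SR_map_eq_zero_iff assms by blast
  then show ?thesis using quo_eq_zero_iff[OF p] J.zero_closed by simp
qed

lemma a_inv_R: "p \<in> carrier R \<Longrightarrow> \<ominus>\<^bsub>R\<^esub> p = - p"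
  by (rule R.minus_equality) auto

text \<open>The inverse system of the ideal generated by the forms and the non-faces.\<close>

definition Ann :: "(('v \<Rightarrow>\<^sub>0 nat) \<Rightarrow> 'f) set" where
  "Ann = {f. (\<forall>\<mu>. f \<mu> \<noteq> 0 \<longrightarrow> keys \<mu> \<in> \<Delta>) \<and>
     (\<forall>k<length \<Theta>. \<forall>\<mu>. (\<Sum>v\<in>V. th k v * f (\<mu> + var_exp v)) = 0)}"

lemma Ann_shift:
  assumes "f \<in> Ann"
  shows "(\<lambda>\<mu>. f (\<nu> + \<mu>)) \<in> Ann"
proof -
  have "keys \<mu> \<in> \<Delta>" if "f (\<nu> + \<mu>) \<noteq> 0" for \<mu>
  proof -
    have "keys (\<nu> + \<mu>) \<in> \<Delta>" using assms that unfolding Ann_def by blast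
    then show ?thesis by (rule subface) (simp add: keys_plus_nat)
  qed
  moreover have "(\<Sum>v\<in>V. th k v * f (\<nu> + (\<mu> + var_exp v))) = 0" if "k < length \<Theta>" for k \<mu>
    using assms that unfolding Ann_def by (simp add: add.assoc[symmetric])
  ultimately show ?thesis unfolding Ann_def by blast
qed

lemma linear_monomial:
  assumes "total_degree \<mu> = 1"
  obtains v where "\<mu> = var_exp v"
proof -
  have s: "(\<Sum>v\<in>keys \<mu>. lookup \<mu> v) = 1"
    using assms by (simp add: total_degree_def)
  then obtain v where v: "v \<in> keys \<mu>"
    by (metis equals0I sum.empty zero_neq_one)
  have "lookup \<mu> v + (\<Sum>u\<in>keys \<mu> - {v}. lookup \<mu> u) = 1"
    using s sum.remove[OF finite_keys v, of "lookup \<mu>"] by simp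
  moreover have "lookup \<mu> v > 0" using v by (simp add: in_keys_iff)
  ultimately have 1: "lookup \<mu> v = 1"
    and z: "(\<Sum>u\<in>keys \<mu> - {v}. lookup \<mu> u) = 0" by linarith+
  have "lookup \<mu> u = 0" if "u \<noteq> v" for u
  proof (rule ccontr)
    assume "lookup \<mu> u \<noteq> 0"
    then have "u \<in> keys \<mu> - {v}" using that by (simp add: in_keys_iff)
    then have "lookup \<mu> u \<le> (\<Sum>u\<in>keys \<mu> - {v}. lookup \<mu> u)"
      by (intro member_le_sum) auto
    then show False using z \<open>lookup \<mu> u \<noteq> 0\<close> by simp
  qed
  then have "\<mu> = var_exp v"
    using 1 by (intro poly_mapping_eqI) (auto simp: lookup_single when_def)
  then show ?thesis using that by blast
qed

lemma pk_eq:
  assumes "k < length \<Theta>"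
  shows "pk k = (\<Sum>v\<in>V. single (var_exp v) (th k v))"
proof (rule poly_mapping_eqI)
  fix \<mu>
  have "lookup (\<Sum>v\<in>V. single (var_exp v) (th k v)) \<mu> =
      (\<Sum>v\<in>V. if var_exp v = \<mu> then th k v else 0)"
    by (simp add: lookup_sum lookup_single when_def)
  also have "\<dots> = lookup (pk k) \<mu>"
  proof (cases "\<exists>v\<in>V. \<mu> = var_exp v")
    case True
    then obtain v where v: "v \<in> V" "\<mu> = var_exp v" by blast
    have "var_exp u = \<mu> \<longleftrightarrow> u = v" for u
      unfolding v(2) by (metis keys_single singleton_iff nat.simps(3))
    then show ?thesis using v finite_V by (simp add: th_def)
  next
    case False
    have "\<mu> \<notin> keys (pk k)"
    proof
      assume \<mu>: "\<mu> \<in> keys (pk k)"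
      then have "total_degree \<mu> = 1" "keys \<mu> \<subseteq> V"
        using pk_linear[OF assms] by (auto simp: linear_polys_def)
      then show False using False linear_monomial[of \<mu>] by (metis insert_subset keys_single nat.simps(3))
    qed
    moreover have "(\<Sum>v\<in>V. if var_exp v = \<mu> then th k v else 0) = 0"
      using False by (intro sum.neutral) auto
    ultimately show ?thesis by (simp add: in_keys_iff)
  qed
  finally show "lookup (pk k) \<mu> =
      lookup (\<Sum>v\<in>V. single (var_exp v) (th k v)) \<mu>" by simp
qed

lemma pairing_pk: "k < length \<Theta> \<Longrightarrow> pairing f (pk k) = (\<Sum>v\<in>V. th k v * f (var_exp v))"
  by (subst pk_eq) (simp_all add: pairing_sum)

lemma ideal_killed:
  assumes "\<And>f \<nu>. f \<in> F \<Longrightarrow> (\<lambda>\<mu>. f (\<nu> + \<mu>)) \<in> F"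
  shows "ideal {p \<in> carrier R. \<forall>f\<in>F. pairing f p = 0} R"
proof (rule idealI[OF R.ring_axioms])
  let ?K = "{p \<in> carrier R. \<forall>f\<in>F. pairing f p = 0}"
  show "subgroup ?K (add_monoid R)"
  proof (rule R.add.subgroupI)
    show "?K \<noteq> {}" using R.zero_closed pairing_0 by fastforce
    fix a assume a: "a \<in> ?K"
    then have "a \<in> carrier R" by blast
    from R.add.inv_closed[OF this] a show "\<ominus>\<^bsub>R\<^esub> a \<in> ?K"
      using a_inv_R[of a] by (simp del: poly_ring_simps(1))
    fix c assume c: "c \<in> ?K"
    show "a \<oplus>\<^bsub>R\<^esub> c \<in> ?K"
      using R.add.m_closed[of a c] a c by (simp add: pairing_add del: poly_ring_simps(1))
  qed blast
  have l: "x * a \<in> ?K" if a: "a \<in> ?K" and x: "x \<in> carrier R" for a x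
  proof -
    have "x \<otimes>\<^bsub>R\<^esub> a \<in> carrier R" using a x by blast
    then show ?thesis using a assms by (simp add: pairing_mult del: poly_ring_simps(1))
  qed
  show "x \<otimes>\<^bsub>R\<^esub> a \<in> ?K" if "a \<in> ?K" "x \<in> carrier R" for a x
    using l[OF that] by (simp del: poly_ring_simps(1))
  show "a \<otimes>\<^bsub>R\<^esub> x \<in> ?K" if "a \<in> ?K" "x \<in> carrier R" for a x
    using l[OF that] by (simp add: mult.commute del: poly_ring_simps(1))
qed

text \<open>Stated for a general family \<open>F\<close>, as it serves twice: for
  \<open>Ann\<close>, and for all functions supported on face monomials.\<close>

lemma I_killed:
  assumes "\<And>f \<nu>. f \<in> F \<Longrightarrow> (\<lambda>\<mu>. f (\<nu> + \<mu>)) \<in> F"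
    and "\<And>f \<mu>. f \<in> F \<Longrightarrow> keys \<mu> \<notin> \<Delta> \<Longrightarrow> f \<mu> = 0"
  shows "I \<subseteq> {p \<in> carrier R. \<forall>f\<in>F. pairing f p = 0}"
  unfolding SR_ideal_def
proof (rule R.genideal_minimal[OF ideal_killed[OF assms(1)]])
  show "sf_monomial ` {\<sigma>. \<sigma> \<subseteq> V \<and> \<sigma> \<notin> \<Delta>} \<subseteq> {p \<in> carrier R. \<forall>f\<in>F. pairing f p = 0}"
  proof (rule image_subsetI, rule CollectI, rule conjI)
    fix \<sigma> assume \<sigma>: "\<sigma> \<in> {\<sigma>. \<sigma> \<subseteq> V \<and> \<sigma> \<notin> \<Delta>}"
    then show "sf_monomial \<sigma> \<in> carrier R" using gens_carrier by blast
    have "finite \<sigma>" using \<sigma> finite_V finite_subset by auto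
    then show "\<forall>f\<in>F. pairing f (sf_monomial \<sigma>) = 0"
      using assms(2) \<sigma> keys_sum_var_exp[of \<sigma>] by (simp add: sf_monomial_eq)
  qed
qed

text \<open>The polynomials killed by \<open>Ann\<close> form an ideal that contains the non-faces
  and the forms, so its image contains the parameter ideal. A polynomial of zero class then differs
  from a killed one by an element of the Stanley-Reisner ideal, which is killed as well.\<close>

lemma pairing_kernel:
  assumes f: "f \<in> Ann" and p: "p \<in> carrier R" "quo p = \<zero>\<^bsub>QQ\<^esub>"
  shows "pairing f p = 0"
proof -
  let ?K = "{p \<in> carrier R. \<forall>f\<in>Ann. pairing f p = 0}"
  have K: "ideal ?K R" using ideal_killed Ann_shift by blast
  have "f \<mu> = 0" if "f \<in> Ann" "keys \<mu> \<notin> \<Delta>" for f \<mu>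
    using that unfolding Ann_def by blast
  then have IK: "I \<subseteq> ?K" using I_killed Ann_shift by blast
  have "ideal (SR_map \<Delta> ` ?K) Q"
    using R.ring_ideal_imp_quot_ideal[OF I.ideal_axioms K]
    unfolding SR_map_def quot_map_def SR_ring_def .
  moreover have "set \<Theta> \<subseteq> SR_map \<Delta> ` ?K"
  proof
    fix x assume "x \<in> set \<Theta>"
    then obtain k where k: "k < length \<Theta>" "x = SR_map \<Delta> (pk k)"
      using theta by (auto simp: in_set_conv_nth)
    have "pairing f (pk k) = 0" if "f \<in> Ann" for f
    proof -
      have "(\<Sum>v\<in>V. th k v * f (0 + var_exp v)) = 0" using that k(1) unfolding Ann_def by blast
      then show ?thesis using pairing_pk[OF k(1)] by simp
    qed
    then have "pk k \<in> ?K" using pk_carrier[OF k(1)] by simp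
    then show "x \<in> SR_map \<Delta> ` ?K" unfolding k(2) by (rule imageI)
  qed
  ultimately have "J \<subseteq> SR_map \<Delta> ` ?K"
    unfolding param_ideal_def by (rule Q.genideal_minimal)
  moreover have "SR_map \<Delta> p \<in> J" using quo_eq_zero_iff[OF p(1)] p(2) by simp
  ultimately have "SR_map \<Delta> p \<in> SR_map \<Delta> ` ?K" by (rule subsetD)
  then obtain q where q: "q \<in> ?K" "SR_map \<Delta> p = SR_map \<Delta> q" by (rule imageE)
  have "I +>\<^bsub>R\<^esub> p = I +>\<^bsub>R\<^esub> q" using q(2) unfolding SR_map_def quot_map_def .
  then have "p \<in> I +>\<^bsub>R\<^esub> q" using I.a_rcos_self[OF p(1)] by simp
  then obtain i where i: "i \<in> I" "p = i + q"
    unfolding a_r_coset_def' by auto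
  have "pairing f i = 0" "pairing f q = 0" using i(1) IK q(1) f by blast+
  then show ?thesis by (simp add: i(2) pairing_add)
qed

lemma monomial_carrier: "keys \<mu> \<subseteq> V \<Longrightarrow> single \<mu> c \<in> carrier R"
  by (cases "c = 0") auto

lemma monomial_in_I:
  assumes "keys \<mu> \<subseteq> V" "keys \<mu> \<notin> \<Delta>"
  shows "single \<mu> 1 \<in> I"
proof -
  let ?s = "\<Sum>v\<in>keys \<mu>. single v (1 :: nat)"
  have "lookup ?s v = (if v \<in> keys \<mu> then 1 else 0)" for v
    by (simp add: lookup_sum lookup_single when_def)
  then have e: "\<mu> = (\<mu> - ?s) + ?s"
    by (intro poly_mapping_eqI) (auto simp: lookup_add lookup_minus in_keys_iff)
  have "single \<mu> 1 = single (\<mu> - ?s) 1 * (sf_monomial (keys \<mu>) :: ('v, 'f) mpoly)"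
    using e by (simp add: sf_monomial_eq mult_single)
  moreover have "sf_monomial (keys \<mu>) \<in> I"
    unfolding SR_ideal_def using R.genideal_self[OF gens_carrier] assms by blast
  moreover have "keys (\<mu> - ?s) \<subseteq> V"
    using assms(1) by (auto simp: in_keys_iff lookup_minus)
  then have "single (\<mu> - ?s) 1 \<in> carrier R" by (rule monomial_carrier)
  ultimately show ?thesis using I.I_l_closed by (simp del: poly_ring_simps(1))
qed

definition Ann_deg :: "('v \<Rightarrow> 'm \<Rightarrow> nat) \<Rightarrow> ('m \<Rightarrow> nat) \<Rightarrow> (('v \<Rightarrow>\<^sub>0 nat) \<Rightarrow> 'f) set" where
  "Ann_deg \<pi> b = {f \<in> Ann. \<forall>\<mu>. f \<mu> \<noteq> 0 \<longrightarrow> multidegree \<pi> \<mu> = b}"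

lemma lookup_const_mult: "lookup (single 0 c * p) \<mu> = c * lookup p \<mu>"
  by (simp add: mult_map_scale_conv_mult[symmetric] Poly_Mapping.map.rep_eq when_def)

text \<open>The other half of the duality. Separate the coefficients of \<open>p\<close> from the
  degree-\<open>b\<close> polynomials of zero class and let \<open>f\<close> record the functional
  on monomials; membership in \<open>Ann\<close> follows by pairing \<open>f\<close> with monomials
  and with monomial multiples of the forms.\<close>

lemma separating_functional:
  assumes hom: "\<And>k v. k < length \<Theta> \<Longrightarrow> v \<in> V \<Longrightarrow> th k v \<noteq> 0 \<Longrightarrow> \<pi> v = \<kappa> k"
    and p: "p \<in> poly_component V \<pi> b" and nz: "quo p \<noteq> \<zero>\<^bsub>QQ\<^esub>"
  obtains f where "f \<in> Ann_deg \<pi> b" "pairing f p \<noteq> 0"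
proof -
  let ?P = "poly_component V \<pi> b :: ('v, 'f) mpoly set"
  define U where "U = lookup ` {q \<in> ?P. quo q = \<zero>\<^bsub>QQ\<^esub>}"
  have PR: "q \<in> carrier R" if "q \<in> ?P" for q using that by (simp add: poly_component_def)
  have U: "fn.subspace U"
  proof (rule fn.subspaceI)
    have "(0 :: ('v, 'f) mpoly) \<in> ?P" by (simp add: poly_component_iff)
    moreover have "quo 0 = \<zero>\<^bsub>QQ\<^esub>" using quo.hom_zero by simp
    moreover have "0 = lookup (0 :: ('v, 'f) mpoly)" by (simp add: fun_eq_iff)
    ultimately show "0 \<in> U" unfolding U_def by blast
  next
    fix x y assume "x \<in> U" "y \<in> U"
    then obtain q r where q: "q \<in> ?P" "quo q = \<zero>\<^bsub>QQ\<^esub>" "x = lookup q"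
      and r: "r \<in> ?P" "quo r = \<zero>\<^bsub>QQ\<^esub>" "y = lookup r" unfolding U_def by blast
    have "quo (q \<oplus>\<^bsub>R\<^esub> r) = \<zero>\<^bsub>QQ\<^esub>" using quo.hom_add[OF PR[OF q(1)] PR[OF r(1)]] q r by simp
    moreover have "q + r \<in> ?P"
      using q(1) r(1) Poly_Mapping.keys_add[of q r] unfolding poly_component_iff by blast
    moreover have "x + y = lookup (q + r)" by (simp add: q r fun_eq_iff lookup_add)
    ultimately show "x + y \<in> U" unfolding U_def by auto
  next
    fix k x assume "x \<in> U"
    then obtain q where q: "q \<in> ?P" "quo q = \<zero>\<^bsub>QQ\<^esub>" "x = lookup q"
      unfolding U_def by blast
    let ?k = "single 0 k :: ('v, 'f) mpoly"
    have k: "?k \<in> carrier R" by (rule monomial_carrier) simp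
    have "quo (?k \<otimes>\<^bsub>R\<^esub> q) = \<zero>\<^bsub>QQ\<^esub>"
      using quo.hom_mult[OF k PR[OF q(1)]] q(2) quo.hom_closed[OF k] by simp
    moreover have "?k * q \<in> ?P"
      using q(1) unfolding poly_component_iff by (auto simp: in_keys_iff lookup_const_mult)
    moreover have "fscale k x = lookup (?k * q)"
      by (simp add: q(3) fun_eq_iff lookup_const_mult fscale_apply)
    ultimately show "fscale k x \<in> U" unfolding U_def by auto
  qed
  have "lookup p \<notin> U"
  proof
    assume "lookup p \<in> U"
    then obtain q where "quo q = \<zero>\<^bsub>QQ\<^esub>" "lookup p = lookup q"
      unfolding U_def by blast
    then show False using nz poly_mapping_eq_iff[of p q] by blast
  qed
  then obtain \<Phi> where \<Phi>: "Vector_Spaces.linear fscale (*) \<Phi>" "\<And>x. x \<in> U \<Longrightarrow> \<Phi> x = 0" "\<Phi> (lookup p) = 1"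
    using fn.functional_separating[OF U] by blast
  interpret \<Phi>: Vector_Spaces.linear fscale "(*)" \<Phi> by fact
  define f where "f \<mu> = (if keys \<mu> \<subseteq> V \<and> multidegree \<pi> \<mu> = b then \<Phi> (unit_fun \<mu>) else 0)" for \<mu>
  have pair: "pairing f q = \<Phi> (lookup q)" if q: "q \<in> ?P" for q
  proof -
    have "lookup q \<in> supported (keys q)" by (auto simp: supported_def in_keys_iff)
    then have "\<Phi> (lookup q) =
        \<Phi> (\<Sum>\<mu>\<in>keys q. fscale (lookup q \<mu>) (unit_fun \<mu>))"
      using supported_eq_sum[OF finite_keys] by metis
    also have "\<dots> = (\<Sum>\<mu>\<in>keys q. lookup q \<mu> * \<Phi> (unit_fun \<mu>))"
      by (simp add: \<Phi>.sum \<Phi>.scale)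
    also have "\<dots> = pairing f q"
      unfolding pairing_def using q by (intro sum.cong) (auto simp: f_def poly_component_iff)
    finally show ?thesis by simp
  qed
  have zero: "pairing f q = 0" if "q \<in> ?P" "quo q = \<zero>\<^bsub>QQ\<^esub>" for q
    using pair[OF that(1)] \<Phi>(2) that unfolding U_def by simp
  have "keys \<mu> \<in> \<Delta>" if "f \<mu> \<noteq> 0" for \<mu>
  proof (rule ccontr)
    assume n: "keys \<mu> \<notin> \<Delta>"
    have *: "keys \<mu> \<subseteq> V" "multidegree \<pi> \<mu> = b" using that by (auto simp: f_def split: if_splits)
    have "pairing f (single \<mu> 1) = 0"
      by (rule zero) (use * quo_I[OF monomial_in_I[OF *(1) n]] in \<open>auto simp: poly_component_iff\<close>)
    then show False using that by simp
  qed
  \<comment> \<open>All variables of a form have the same degree. So either every monomial in the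
    equation at \<open>\<mu>\<close> lies in \<open>V\<close> and in degree \<open>b\<close>, or
    every term of it vanishes.\<close>
  moreover have "(\<Sum>v\<in>V. th k v * f (\<mu> + var_exp v)) = 0" if k: "k < length \<Theta>" for k \<mu>
  proof (cases "keys \<mu> \<subseteq> V \<and> (\<forall>v\<in>V. th k v \<noteq> 0 \<longrightarrow> multidegree \<pi> (\<mu> + var_exp v) = b)")
    case True
    let ?q = "single \<mu> 1 * pk k"
    have e: "?q = (\<Sum>v\<in>V. single (\<mu> + var_exp v) (th k v))"
      by (subst pk_eq[OF k]) (simp add: sum_distrib_left mult_single)
    have "?q \<in> ?P"
      unfolding poly_component_iff
    proof
      fix \<nu> assume "\<nu> \<in> keys ?q"
      then have "(\<Sum>v\<in>V. if \<mu> + var_exp v = \<nu> then th k v else 0) \<noteq> 0"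
        unfolding e by (simp add: in_keys_iff lookup_sum lookup_single when_def)
      then obtain v where v: "v \<in> V" "(if \<mu> + var_exp v = \<nu> then th k v else 0) \<noteq> 0"
        by (rule sum.not_neutral_contains_not_neutral)
      then have "\<mu> + var_exp v = \<nu>" "th k v \<noteq> 0" by (auto split: if_splits)
      then show "keys \<nu> \<subseteq> V \<and> multidegree \<pi> \<nu> = b" using True v(1) by auto
    qed
    moreover have m: "single \<mu> 1 \<in> carrier R" using True by (intro monomial_carrier) simp
    have "quo (single \<mu> 1 \<otimes>\<^bsub>R\<^esub> pk k) = \<zero>\<^bsub>QQ\<^esub>"
      using quo.hom_mult[OF m pk_carrier[OF k]] quo_pk[OF k] quo.hom_closed[OF m] by simp
    then have "quo ?q = \<zero>\<^bsub>QQ\<^esub>" by simp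
    ultimately have "pairing f ?q = 0" by (rule zero)
    then show ?thesis unfolding e by (simp add: pairing_sum)
  next
    case False
    have "th k v * f (\<mu> + var_exp v) = 0" if v: "v \<in> V" for v
    proof (rule ccontr)
      assume "th k v * f (\<mu> + var_exp v) \<noteq> 0"
      then have t: "th k v \<noteq> 0" and "keys (\<mu> + var_exp v) \<subseteq> V"
        and d: "multidegree \<pi> (\<mu> + var_exp v) = b"
        by (auto simp: f_def split: if_splits)
      then obtain u where u: "u \<in> V" "th k u \<noteq> 0" "multidegree \<pi> (\<mu> + var_exp u) \<noteq> b"
        using False by auto
      have "\<pi> u = \<pi> v" using hom[OF k v t] hom[OF k u(1,2)] by simp
      then have "multidegree \<pi> (\<mu> + var_exp u) i = multidegree \<pi> (\<mu> + var_exp v) i" for i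
        by (simp add: multidegree_add)
      then show False using u(3) d by auto
    qed
    then show ?thesis by (intro sum.neutral) blast
  qed
  ultimately have "f \<in> Ann_deg \<pi> b"
    unfolding Ann_deg_def Ann_def by (auto simp: f_def split: if_splits)
  moreover have "pairing f p \<noteq> 0" using pair[OF p] \<Phi>(3) by simp
  ultimately show ?thesis using that by blast
qed

text \<open>This function reads off the constant coefficient. It shows that the quotient is nonzero,
  so that the ground field embeds in it.\<close>

lemma one_in_Ann: "unit_fun 0 \<in> Ann"
proof -
  have "{} \<in> \<Delta>" using complex by (simp add: simplicial_complex_def)
  moreover have "\<mu> + var_exp v \<noteq> 0" for \<mu> :: "'v \<Rightarrow>\<^sub>0 nat" and v
    by (metis insert_not_empty keys_plus_var_exp keys_zero)
  ultimately show ?thesis by (auto simp: Ann_def unit_fun_def)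
qed

lemma QQ_nontrivial: "\<one>\<^bsub>QQ\<^esub> \<noteq> \<zero>\<^bsub>QQ\<^esub>"
proof
  assume "\<one>\<^bsub>QQ\<^esub> = \<zero>\<^bsub>QQ\<^esub>"
  then have "quo 1 = \<zero>\<^bsub>QQ\<^esub>" using quo.hom_one by simp
  then have "pairing (unit_fun 0) (1 :: ('v, 'f) mpoly) = 0"
    by (intro pairing_kernel one_in_Ann) auto
  then show False by (simp flip: single_one) (simp add: unit_fun_def)
qed

section \<open>The ground field in the quotient and bases of monomials\<close>

lemma subfield_constants: "subfield poly_constants R"
proof (rule R.subfieldI)
  have carr: "poly_constants \<subseteq> carrier R" unfolding poly_constants_def by (auto intro: monomial_carrier)
  show "subcring poly_constants R"
  proof (rule R.subcringI')
    show "subring poly_constants R"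
    proof (rule R.subringI[OF carr])
      show "\<one>\<^bsub>R\<^esub> \<in> poly_constants" unfolding poly_constants_def by (simp flip: single_one)
      show "\<ominus>\<^bsub>R\<^esub> h \<in> poly_constants" if "h \<in> poly_constants" for h
      proof -
        have "\<ominus>\<^bsub>R\<^esub> h = - h" using that carr by (intro a_inv_R) blast
        then show ?thesis using that unfolding poly_constants_def by (auto simp flip: single_uminus)
      qed
      show "h1 \<otimes>\<^bsub>R\<^esub> h2 \<in> poly_constants" "h1 \<oplus>\<^bsub>R\<^esub> h2 \<in> poly_constants"
        if "h1 \<in> poly_constants" "h2 \<in> poly_constants" for h1 h2
        using that unfolding poly_constants_def by (auto simp: mult_single simp flip: single_add)
    qed
  qed
  show "Units (R\<lparr>carrier := poly_constants\<rparr>) = poly_constants - {\<zero>\<^bsub>R\<^esub>}"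
  proof
    show "Units (R\<lparr>carrier := poly_constants\<rparr>) \<subseteq> poly_constants - {\<zero>\<^bsub>R\<^esub>}"
      by (auto simp: Units_def)
    show "poly_constants - {\<zero>\<^bsub>R\<^esub>} \<subseteq> Units (R\<lparr>carrier := poly_constants\<rparr>)"
    proof
      fix x assume "x \<in> poly_constants - {\<zero>\<^bsub>R\<^esub>}"
      then obtain c where c: "x = single 0 c" and "x \<noteq> 0" by (auto simp: poly_constants_def)
      then have "c \<noteq> 0" by auto
      with c have "single 0 (inverse c) * x = 1" "x * single 0 (inverse c) = 1"
        by (simp_all add: mult_single)
      then show "x \<in> Units (R\<lparr>carrier := poly_constants\<rparr>)"
        unfolding Units_def using c by (auto simp: poly_constants_def intro!: bexI[of _ "single 0 (inverse c)"])
    qed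
  qed
qed

lemma K_eq: "K = quo ` poly_constants"
  unfolding SR_quot_constants_def quo_def by auto

lemma subfield_K: "subfield K QQ"
  unfolding K_eq by (rule quo.img_is_subfield(2)[OF subfield_constants QQ_nontrivial])

lemma combine_monomials:
  assumes "\<And>\<mu>. \<mu> \<in> set ms \<Longrightarrow> keys \<mu> \<subseteq> V" "length cs = length ms"
  shows "QQ.combine (map (\<lambda>c. quo (single 0 c)) cs) (map (\<lambda>\<mu>. quo (single \<mu> 1)) ms) =
    quo (\<Sum>i<length ms. single (ms ! i) (cs ! i))"
  using assms
proof (induction ms arbitrary: cs)
  case Nil
  then show ?case using quo.hom_zero by simp
next
  case (Cons \<mu> ms)
  obtain c ds where cs: "cs = c # ds" "length ds = length ms" using Cons.prems(2) by (cases cs) auto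
  let ?s = "\<Sum>i<length ms. single (ms ! i) (ds ! i)"
  have carr: "single \<nu> x \<in> carrier R" if "\<nu> \<in> set (\<mu> # ms)" for \<nu> x
    using that Cons.prems(1) by (intro monomial_carrier) auto
  have s: "?s \<in> carrier R"
  proof -
    have "(\<Sum>i\<in>N. single (ms ! i) (ds ! i)) \<in> carrier R" if "finite N" "N \<subseteq> {..<length ms}" for N
      using that
    proof (induction N rule: finite_induct)
      case empty
      then show ?case using R.zero_closed by simp
    next
      case (insert i N)
      have "single (ms ! i) (ds ! i) \<oplus>\<^bsub>R\<^esub> (\<Sum>i\<in>N. single (ms ! i) (ds ! i)) \<in> carrier R"
        using insert by (intro R.a_closed carr insert.IH) auto
      then show ?case using insert by (simp del: poly_ring_simps(1))
    qed
    then show ?thesis by blast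
  qed
  have c: "single 0 c \<in> carrier R" by (rule monomial_carrier) simp
  have "quo (single \<mu> c) = quo (single 0 c) \<otimes>\<^bsub>QQ\<^esub> quo (single \<mu> 1)"
    using quo.hom_mult[OF c carr[of \<mu> 1]] by (simp add: mult_single)
  moreover have "quo (single \<mu> c + ?s) = quo (single \<mu> c) \<oplus>\<^bsub>QQ\<^esub> quo ?s"
    using quo.hom_add[OF carr[of \<mu> c] s] by simp
  moreover have "(\<Sum>i<length (\<mu> # ms). single ((\<mu> # ms) ! i) (cs ! i)) = single \<mu> c + ?s"
    by (simp add: cs sum.lessThan_Suc_shift del: sum.lessThan_Suc)
  ultimately show ?case
    using Cons.IH[OF _ cs(2)] Cons.prems(1) cs by simp
qed

lemma monomial_sum_carrier:
  assumes "\<And>i. i \<in> N \<Longrightarrow> keys (m i) \<subseteq> V"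
  shows "(\<Sum>i\<in>N. single (m i) (c i)) \<in> carrier R"
  unfolding poly_ring_simps
proof
  fix \<nu> assume "\<nu> \<in> keys (\<Sum>i\<in>N. single (m i) (c i))"
  then have "(\<Sum>i\<in>N. if m i = \<nu> then c i else 0) \<noteq> 0"
    by (simp add: in_keys_iff lookup_sum lookup_single when_def)
  then obtain i where "i \<in> N" "(if m i = \<nu> then c i else 0) \<noteq> 0"
    by (rule sum.not_neutral_contains_not_neutral)
  then have "i \<in> N" "m i = \<nu>" by (auto split: if_splits)
  then show "keys \<nu> \<subseteq> V" using assms by auto
qed

lemma K_list:
  assumes "set Ks \<subseteq> K"
  obtains cs where "Ks = map (\<lambda>c. quo (single 0 c)) cs"
proof -
  have "\<exists>cs. Ks = map (\<lambda>c. quo (single 0 c)) cs"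
    using assms
  proof (induction Ks)
    case (Cons k Ks)
    then obtain cs c where "Ks = map (\<lambda>c. quo (single 0 c)) cs" "k = quo (single 0 c)"
      unfolding K_eq poly_constants_def by auto
    then show ?case by (intro exI[of _ "c # cs"]) simp
  qed simp
  then show ?thesis using that by blast
qed

text \<open>Pairing a relation with \<open>g \<mu>\<close> isolates the coefficient of
  \<open>\<mu>\<close>. Only a diagonal family in \<open>Ann\<close> is asked for, so the lemma
  covers both a dual basis and the powers of a single variable.\<close>

lemma independent_monomials:
  assumes V: "\<And>\<mu>. \<mu> \<in> set ms \<Longrightarrow> keys \<mu> \<subseteq> V" and "distinct ms"
    and g: "\<And>\<mu>. \<mu> \<in> set ms \<Longrightarrow> g \<mu> \<in> Ann" "\<And>\<mu>. \<mu> \<in> set ms \<Longrightarrow> g \<mu> \<mu> \<noteq> 0"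
      "\<And>\<mu> \<nu>. \<mu> \<in> set ms \<Longrightarrow> \<nu> \<in> set ms \<Longrightarrow> \<mu> \<noteq> \<nu> \<Longrightarrow> g \<mu> \<nu> = 0"
  shows "QQ.independent K (map (\<lambda>\<mu>. quo (single \<mu> 1)) ms)" (is "QQ.independent K ?Us")
proof (rule QQ.trivial_combine_imp_independent[OF subfield_K])
  show Us: "set ?Us \<subseteq> carrier QQ" using V by (auto intro!: quo.hom_closed monomial_carrier)
  fix Ks assume Ks: "set Ks \<subseteq> K" "QQ.combine Ks ?Us = \<zero>\<^bsub>QQ\<^esub>"
  have KQ: "K \<subseteq> carrier QQ" using subringE(1)[OF subfieldE(1)[OF subfield_K]] .
  \<comment> \<open>The criterion for independence admits coefficient lists of any length; they are
    first normalised to the length of \<open>?Us\<close>.\<close>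
  obtain Ls where Ls: "set (take (length ?Us) Ks) \<subseteq> set Ls" "length Ls = length ?Us" "set Ls \<subseteq> K"
    "QQ.combine Ls ?Us = \<zero>\<^bsub>QQ\<^esub>"
  proof -
    obtain Ks' where Ks': "set (take (length ?Us) Ks) \<subseteq> set Ks'"
      "set Ks' \<subseteq> set (take (length ?Us) Ks) \<union> {\<zero>\<^bsub>QQ\<^esub>}" "length Ks' = length ?Us"
      "QQ.combine Ks' ?Us = \<zero>\<^bsub>QQ\<^esub>"
      by (rule QQ.combine_normalize[OF subset_trans[OF Ks(1) KQ] Us Ks(2)])
    have "\<zero>\<^bsub>QQ\<^esub> \<in> K" using subringE(2)[OF subfieldE(1)[OF subfield_K]] .
    then have "set Ks' \<subseteq> K" using Ks'(2) Ks(1) set_take_subset[of "length ?Us" Ks] by blast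
    then show ?thesis using that Ks' by blast
  qed
  obtain cs where cs: "Ls = map (\<lambda>c. quo (single 0 c)) cs" using K_list[OF Ls(3)] .
  then have len: "length cs = length ms" using Ls(2) by simp
  let ?p = "\<Sum>i<length ms. single (ms ! i) (cs ! i)"
  have p: "?p \<in> carrier R" using V by (intro monomial_sum_carrier) auto
  have "quo ?p = \<zero>\<^bsub>QQ\<^esub>" using combine_monomials[OF V len] Ls(4) cs by simp
  then have z: "pairing (g (ms ! j)) ?p = 0" if "j < length ms" for j
    using that g(1) p by (intro pairing_kernel) auto
  have "cs ! j = 0" if j: "j < length ms" for j
  proof -
    have "pairing (g (ms ! j)) ?p = (\<Sum>i<length ms. cs ! i * g (ms ! j) (ms ! i))" by (simp add: pairing_sum)
    also have "\<dots> = (\<Sum>i<length ms. if i = j then cs ! j * g (ms ! j) (ms ! j) else 0)"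
    proof (rule sum.cong[OF refl])
      fix i assume "i \<in> {..<length ms}"
      then show "cs ! i * g (ms ! j) (ms ! i) = (if i = j then cs ! j * g (ms ! j) (ms ! j) else 0)"
        using g(3)[of "ms ! j" "ms ! i"] j assms(2) by (auto simp: nth_eq_iff_index_eq)
    qed
    also have "\<dots> = cs ! j * g (ms ! j) (ms ! j)" using j by simp
    finally show ?thesis using z[OF j] g(2)[of "ms ! j"] j by simp
  qed
  then have "set cs \<subseteq> {0}" using len by (auto simp: in_set_conv_nth)
  moreover have "quo (single 0 0) = \<zero>\<^bsub>QQ\<^esub>" using quo.hom_zero by simp
  ultimately have "set Ls \<subseteq> {\<zero>\<^bsub>QQ\<^esub>}" using cs by auto
  then show "set (take (length ?Us) Ks) \<subseteq> {\<zero>\<^bsub>QQ\<^esub>}" using Ls(1) by blast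
qed

lemma subspace_Ann_deg: "fn.subspace (Ann_deg \<pi> b)"
proof (rule fn.subspaceI)
  show "0 \<in> Ann_deg \<pi> b" by (simp add: Ann_deg_def Ann_def)
next
  fix f g assume fg: "f \<in> Ann_deg \<pi> b" "g \<in> Ann_deg \<pi> b"
  have "(\<Sum>v\<in>V. th k v * (f + g) (\<mu> + var_exp v)) = 0" if "k < length \<Theta>" for k \<mu>
    using fg that by (simp add: Ann_deg_def Ann_def distrib_left sum.distrib)
  moreover have "f \<mu> \<noteq> 0 \<or> g \<mu> \<noteq> 0" if "(f + g) \<mu> \<noteq> 0" for \<mu> using that by auto
  ultimately show "f + g \<in> Ann_deg \<pi> b" using fg unfolding Ann_deg_def Ann_def by blast
next
  fix c f assume f: "f \<in> Ann_deg \<pi> b"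
  have "(\<Sum>v\<in>V. th k v * fscale c f (\<mu> + var_exp v)) = 0" if "k < length \<Theta>" for k \<mu>
  proof -
    have "(\<Sum>v\<in>V. th k v * fscale c f (\<mu> + var_exp v)) = c * (\<Sum>v\<in>V. th k v * f (\<mu> + var_exp v))"
      by (simp add: fscale_apply sum_distrib_left mult.left_commute)
    then show ?thesis using f that by (simp add: Ann_deg_def Ann_def)
  qed
  moreover have "f \<mu> \<noteq> 0" if "fscale c f \<mu> \<noteq> 0" for \<mu> using that by (simp add: fscale_apply)
  ultimately show "fscale c f \<in> Ann_deg \<pi> b" using f unfolding Ann_deg_def Ann_def by blast
qed

text \<open>The monomials that carry a dual basis of \<open>Ann_deg \<pi> b\<close> form a basis of
  the component. Duality gives independence; a polynomial minus its expansion with coefficients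
  \<open>pairing (g \<mu>) p\<close> is killed by \<open>Ann_deg \<pi> b\<close>, so its class is
  zero by separation.\<close>

lemma dim_component:
  assumes hom: "\<And>k v. k < length \<Theta> \<Longrightarrow> v \<in> V \<Longrightarrow> th k v \<noteq> 0 \<Longrightarrow> \<pi> v = \<kappa> k"
    and fin: "finite {\<mu>. keys \<mu> \<in> \<Delta> \<and> multidegree \<pi> \<mu> = b}"
  shows "QQ.dim K (SR_quot_component \<Delta> \<pi> \<Theta> b) = fn.dim (Ann_deg \<pi> b)"
proof -
  let ?X = "{\<mu>. keys \<mu> \<in> \<Delta> \<and> multidegree \<pi> \<mu> = b}"
  let ?P = "poly_component V \<pi> b :: ('v, 'f) mpoly set"
  have E: "SR_quot_component \<Delta> \<pi> \<Theta> b = quo ` ?P"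
    unfolding SR_quot_component_def SR_component_def quo_def by auto
  have "Ann_deg \<pi> b \<subseteq> supported ?X" by (auto simp: Ann_deg_def Ann_def supported_def)
  then obtain B g where B: "B \<subseteq> ?X" "card B = fn.dim (Ann_deg \<pi> b)" "\<And>x. x \<in> B \<Longrightarrow> g x \<in> Ann_deg \<pi> b"
    "\<And>x y. x \<in> B \<Longrightarrow> y \<in> B \<Longrightarrow> g x y = (if x = y then 1 else 0)"
    "\<And>f. f \<in> Ann_deg \<pi> b \<Longrightarrow> f = (\<Sum>x\<in>B. fscale (f x) (g x))"
    by (rule dual_basis_on_points[OF fin subspace_Ann_deg]) (rule that)
  obtain ms where ms: "set ms = B" "distinct ms"
    using finite_distinct_list finite_subset[OF B(1) fin] by blast
  let ?Us = "map (\<lambda>\<mu>. quo (single \<mu> 1)) ms"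
  have V: "keys \<mu> \<subseteq> V" if "\<mu> \<in> set ms" for \<mu>
    using that ms B(1) face_subset by auto
  have ind: "QQ.independent K ?Us"
    by (rule independent_monomials[OF V ms(2), of g])
      (use B(3,4) ms in \<open>auto simp: Ann_deg_def\<close>)
  have sep: "\<exists>f\<in>Ann_deg \<pi> b. pairing f r \<noteq> 0" if r: "r \<in> ?P" "quo r \<noteq> \<zero>\<^bsub>QQ\<^esub>" for r
  proof (rule separating_functional[where \<kappa> = \<kappa> and \<pi> = \<pi> and b = b and p = r])
    show "\<pi> v = \<kappa> k" if "k < length \<Theta>" "v \<in> V" "th k v \<noteq> 0" for k v by (rule hom[OF that])
  qed (use r in blast)+
  have "QQ.Span K ?Us = quo ` ?P"
  proof
    have Us: "set ?Us \<subseteq> carrier QQ" using V by (auto intro!: quo.hom_closed monomial_carrier)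
    note Span = QQ.Span_eq_combine_set_length_version[OF subfield_K Us]
    show "QQ.Span K ?Us \<subseteq> quo ` ?P"
    proof
      fix x assume "x \<in> QQ.Span K ?Us"
      then obtain Ks where Ks: "length Ks = length ?Us" "set Ks \<subseteq> K" "x = QQ.combine Ks ?Us"
        unfolding Span by blast
      obtain cs where cs: "Ks = map (\<lambda>c. quo (single 0 c)) cs" using K_list[OF Ks(2)] .
      let ?p = "\<Sum>i<length ms. single (ms ! i) (cs ! i)"
      have "x = quo ?p" using combine_monomials[where ms = ms and cs = cs, OF V] Ks(1,3) cs by simp
      moreover have "?p \<in> ?P"
        unfolding poly_component_iff
      proof
        fix \<nu> assume "\<nu> \<in> keys ?p"
        then have "(\<Sum>i<length ms. if ms ! i = \<nu> then cs ! i else 0) \<noteq> 0"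
          by (simp add: in_keys_iff lookup_sum lookup_single when_def)
        then obtain i where "i \<in> {..<length ms}" "(if ms ! i = \<nu> then cs ! i else 0) \<noteq> 0"
          by (rule sum.not_neutral_contains_not_neutral)
        then have "i < length ms" "ms ! i = \<nu>" by (auto split: if_splits)
        then have "\<nu> \<in> set ms" by auto
        then show "keys \<nu> \<subseteq> V \<and> multidegree \<pi> \<nu> = b" using V ms B(1) by auto
      qed
      ultimately show "x \<in> quo ` ?P" by blast
    qed
    show "quo ` ?P \<subseteq> QQ.Span K ?Us"
    proof
      fix x assume "x \<in> quo ` ?P"
      then obtain p where p: "p \<in> ?P" "x = quo p" by blast
      let ?cs = "map (\<lambda>\<mu>. pairing (g \<mu>) p) ms"
      let ?q = "\<Sum>i<length ms. single (ms ! i) (?cs ! i)"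
      have q_eq: "?q = (\<Sum>\<mu>\<in>B. single \<mu> (pairing (g \<mu>) p))"
        using sum.reindex_bij_betw[OF bij_betw_nth[OF ms(2) refl ms(1)[symmetric]], of "\<lambda>\<mu>. single \<mu> (pairing (g \<mu>) p)"]
        by simp
      have q: "?q \<in> ?P"
        unfolding poly_component_iff q_eq
      proof
        fix \<nu> assume "\<nu> \<in> keys (\<Sum>\<mu>\<in>B. single \<mu> (pairing (g \<mu>) p))"
        then have "(\<Sum>\<mu>\<in>B. if \<mu> = \<nu> then pairing (g \<mu>) p else 0) \<noteq> 0"
          by (simp add: in_keys_iff lookup_sum lookup_single when_def)
        then obtain \<mu> where "\<mu> \<in> B" "(if \<mu> = \<nu> then pairing (g \<mu>) p else 0) \<noteq> 0"
          by (rule sum.not_neutral_contains_not_neutral)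
        then have "\<nu> \<in> B" by (auto split: if_splits)
        then show "keys \<nu> \<subseteq> V \<and> multidegree \<pi> \<nu> = b" using V ms B(1) by auto
      qed
      have pq: "p - ?q \<in> ?P"
        using p(1) q keys_diff[of p ?q] unfolding poly_component_iff by blast
      have PR: "r \<in> carrier R" if "r \<in> ?P" for r using that by (simp add: poly_component_def)
      have "quo (p - ?q) = \<zero>\<^bsub>QQ\<^esub>"
      proof (rule ccontr)
        assume "quo (p - ?q) \<noteq> \<zero>\<^bsub>QQ\<^esub>"
        then obtain f where f: "f \<in> Ann_deg \<pi> b" "pairing f (p - ?q) \<noteq> 0"
          using sep[OF pq] by blast
        have "pairing f p = (\<Sum>\<mu>\<in>keys p. lookup p \<mu> * (\<Sum>x\<in>B. f x * g x \<mu>))"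
        proof -
          have "f \<mu> = (\<Sum>x\<in>B. f x * g x \<mu>)" for \<mu>
            using fun_cong[OF B(5)[OF f(1)], of \<mu>] by (simp add: sum_fun_apply fscale_apply)
          then show ?thesis unfolding pairing_def by metis
        qed
        also have "\<dots> = (\<Sum>x\<in>B. f x * pairing (g x) p)"
          unfolding pairing_def sum_distrib_left by (subst sum.swap) (simp add: mult_ac)
        also have "\<dots> = pairing f ?q"
          unfolding q_eq by (simp add: pairing_sum mult.commute)
        finally show False using f(2) by (simp add: pairing_diff)
      qed
      moreover have "quo ((p - ?q) \<oplus>\<^bsub>R\<^esub> ?q) = quo (p - ?q) \<oplus>\<^bsub>QQ\<^esub> quo ?q"
        using PR[OF pq] PR[OF q] by (rule quo.hom_add)
      ultimately have "x = quo ?q" using p(2) quo.hom_closed[OF PR[OF q]] by simp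
      also have "\<dots> = QQ.combine (map (\<lambda>c. quo (single 0 c)) ?cs) ?Us"
        by (rule combine_monomials[OF V, symmetric]) auto
      finally have x: "x = QQ.combine (map (\<lambda>c. quo (single 0 c)) ?cs) ?Us" .
      have "set (map (\<lambda>c. quo (single 0 c)) ?cs) \<subseteq> K"
        unfolding K_eq poly_constants_def by auto
      moreover have "length (map (\<lambda>c. quo (single 0 c)) ?cs) = length ?Us" by simp
      ultimately show "x \<in> QQ.Span K ?Us" unfolding Span using x by blast
    qed
  qed
  then have "QQ.dimension (length ?Us) K (quo ` ?P)"
    using QQ.dimensionI[OF subfield_K ind] by blast
  then have "(QQ.dim over K) (quo ` ?P) = length ?Us" by (rule QQ.dimI[OF subfield_K])
  moreover have "length ms = card B" using ms distinct_card by metis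
  ultimately show ?thesis using B(2) E by (simp add: over_def)
qed

end

section \<open>Systems of parameters\<close>

context sr_forms
begin

text \<open>If a nonzero vector \<open>w\<close> supported on a face were a common zero of the forms, then the
  functionals \<open>x\<^sup>\<mu> \<mapsto> w\<^sup>\<mu>\<close> would be nonzero in every degree of the quotient.\<close>

lemma no_common_zero_on_face:
  assumes fd: "QQ.finite_dimension K (carrier QQ)" and \<sigma>: "\<sigma> \<in> \<Delta>"
    and w: "\<And>v. w v \<noteq> 0 \<Longrightarrow> v \<in> \<sigma>" "\<And>k. k < length \<Theta> \<Longrightarrow> (\<Sum>v\<in>V. th k v * w v) = 0"
  shows "w v = 0"
proof (rule ccontr)
  assume nz: "w v \<noteq> 0"
  have v: "v \<in> \<sigma>" "v \<in> V" using w(1)[OF nz] face_subset[OF \<sigma>] by auto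
  define tdeg where "tdeg \<mu> = (\<Sum>u\<in>V. lookup \<mu> u)" for \<mu> :: "'v \<Rightarrow>\<^sub>0 nat"
  define fw where "fw \<mu> = (if keys \<mu> \<subseteq> \<sigma> then \<Prod>u\<in>V. w u ^ lookup \<mu> u else 0)"
    for \<mu> :: "'v \<Rightarrow>\<^sub>0 nat"
  have fw_shift: "fw (\<mu> + var_exp u) = w u * fw \<mu>" if u: "u \<in> V" for \<mu> u
  proof (cases "keys \<mu> \<subseteq> \<sigma> \<and> u \<in> \<sigma>")
    case True
    have "(\<Prod>x\<in>V. w x ^ lookup (\<mu> + var_exp u) x) =
        (\<Prod>x\<in>V. w x ^ lookup \<mu> x * (if x = u then w x else 1))"
      by (rule prod.cong) (auto simp: lookup_add lookup_single when_def)
    also have "\<dots> = (\<Prod>x\<in>V. w x ^ lookup \<mu> x) * w u"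
      using u finite_V by (simp add: prod.distrib)
    finally show ?thesis using True by (simp add: fw_def mult.commute)
  next
    case False
    then show ?thesis using w(1)[of u] by (auto simp: fw_def)
  qed
  have tdeg_shift: "tdeg (\<mu> + var_exp u) = Suc (tdeg \<mu>)" if "u \<in> V" for \<mu> u
    using that finite_V by (simp add: tdeg_def lookup_add sum.distrib lookup_single when_def)
  define g where "g j \<mu> = (if tdeg \<mu> = j then fw \<mu> else 0)" for j \<mu>
  have g_Ann: "g j \<in> Ann" for j
  proof -
    have "keys \<mu> \<in> \<Delta>" if "g j \<mu> \<noteq> 0" for \<mu>
      using that subface[OF \<sigma>] by (auto simp: g_def fw_def split: if_splits)
    moreover have "(\<Sum>u\<in>V. th k u * g j (\<mu> + var_exp u)) = 0" if k: "k < length \<Theta>" for k \<mu>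
    proof -
      have "(\<Sum>u\<in>V. th k u * g j (\<mu> + var_exp u)) =
          (\<Sum>u\<in>V. (if Suc (tdeg \<mu>) = j then fw \<mu> else 0) * (th k u * w u))"
        by (rule sum.cong) (auto simp: g_def fw_shift tdeg_shift)
      also have "\<dots> = 0" using w(2)[OF k] by (simp flip: sum_distrib_left)
      finally show ?thesis .
    qed
    ultimately show ?thesis unfolding Ann_def by blast
  qed
  have tdeg_power: "tdeg (single v j) = j" for j
    using v(2) finite_V by (simp add: tdeg_def lookup_single when_def)
  have fw_power: "fw (single v j) \<noteq> 0" for j
  proof -
    have "(\<Prod>u\<in>V. w u ^ lookup (single v j) u) = (\<Prod>u\<in>V. if u = v then w v ^ j else 1)"
      by (rule prod.cong) (auto simp: lookup_single when_def)
    then show ?thesis using v finite_V nz by (simp add: fw_def)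
  qed
  obtain n where n: "QQ.dimension n K (carrier QQ)" using fd unfolding QQ.finite_dimension_def by blast
  \<comment> \<open>One power of the variable of \<open>v\<close> more than the dimension
    \<open>n\<close> allows; the powers are told apart by their degree.\<close>
  let ?ms = "map (single v) [0..<Suc n] :: ('v \<Rightarrow>\<^sub>0 nat) list"
  have inj: "inj (single v :: nat \<Rightarrow> _)" by (rule inj_single)
  have ind: "QQ.independent K (map (\<lambda>\<mu>. quo (single \<mu> 1)) ?ms)"
  proof (rule independent_monomials[where g = "\<lambda>\<mu>. g (tdeg \<mu>)"])
    show "distinct ?ms" unfolding distinct_map using inj_on_subset[OF inj subset_UNIV] distinct_upt by blast
    fix \<mu> assume "\<mu> \<in> set ?ms"
    then obtain j where j: "\<mu> = single v j" by auto
    show "keys \<mu> \<subseteq> V" using v(2) by (auto simp: j)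
    show "g (tdeg \<mu>) \<in> Ann" by (rule g_Ann)
    show "g (tdeg \<mu>) \<mu> \<noteq> 0" using fw_power by (simp add: g_def j)
    fix \<nu> assume "\<nu> \<in> set ?ms" "\<mu> \<noteq> \<nu>"
    then obtain i where "\<nu> = single v i" "i \<noteq> j" using j by auto
    then show "g (tdeg \<mu>) \<nu> = 0" by (simp add: g_def j tdeg_power)
  qed
  have "set (map (\<lambda>\<mu>. quo (single \<mu> 1)) ?ms) \<subseteq> carrier QQ"
    using v(2) by (auto intro!: quo.hom_closed monomial_carrier split: if_splits)
  from QQ.independent_length_le_dimension[OF subfield_K n ind this] show False by simp
qed

text \<open>Dual to the absence of common zeros: if the unit vector of \<open>v\<close> is not a
  combination of the restricted forms, a functional that kills them and is \<open>1\<close> on it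
  yields a nonzero common zero supported on the face.\<close>

lemma forms_span_on_face:
  assumes fd: "QQ.finite_dimension K (carrier QQ)" and \<sigma>: "\<sigma> \<in> \<Delta>" and v: "v \<in> \<sigma>"
  shows "\<exists>a. \<forall>u\<in>\<sigma>. (\<Sum>k<length \<Theta>. a k * th k u) = (if u = v then 1 else 0)"
proof -
  define r where "r k = (\<lambda>u. if u \<in> \<sigma> then th k u else 0)" for k
  define U where "U = range (\<lambda>a. \<Sum>k<length \<Theta>. fscale (a k) (r k))"
  have fin: "finite \<sigma>" using \<sigma> face_subset finite_V finite_subset by blast
  have U: "fn.subspace U"
  proof (rule fn.subspaceI)
    show "0 \<in> U" unfolding U_def by (rule range_eqI[where x = "\<lambda>_. 0"]) simp
  next
    fix x y assume "x \<in> U" "y \<in> U"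
    then obtain a b where "x = (\<Sum>k<length \<Theta>. fscale (a k) (r k))" "y = (\<Sum>k<length \<Theta>. fscale (b k) (r k))"
      unfolding U_def by blast
    then have "x + y = (\<Sum>k<length \<Theta>. fscale ((\<lambda>k. a k + b k) k) (r k))"
      by (simp add: sum.distrib fn.scale_left_distrib)
    then show "x + y \<in> U" unfolding U_def by (rule range_eqI[where x = "\<lambda>k. a k + b k"])
  next
    fix c x assume "x \<in> U"
    then obtain a where "x = (\<Sum>k<length \<Theta>. fscale (a k) (r k))" unfolding U_def by blast
    then have "fscale c x = (\<Sum>k<length \<Theta>. fscale ((\<lambda>k. c * a k) k) (r k))"
      by (simp add: fn.scale_sum_right)
    then show "fscale c x \<in> U" unfolding U_def by (rule range_eqI[where x = "\<lambda>k. c * a k"])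
  qed
  have rU: "r k \<in> U" if "k < length \<Theta>" for k
  proof -
    have "r k = (\<Sum>j<length \<Theta>. fscale (if j = k then 1 else 0) (r j))"
      using that by (simp add: if_distrib[of "\<lambda>c. fscale c _"] cong: if_cong)
    then show ?thesis unfolding U_def by (rule range_eqI[where x = "\<lambda>j. if j = k then 1 else 0"])
  qed
  have "unit_fun v \<in> U"
  proof (rule ccontr)
    assume "unit_fun v \<notin> U"
    then obtain \<Phi> where \<Phi>: "Vector_Spaces.linear fscale (*) \<Phi>" "\<And>x. x \<in> U \<Longrightarrow> \<Phi> x = 0" "\<Phi> (unit_fun v) = 1"
      using fn.functional_separating[OF U] by blast
    interpret \<Phi>: Vector_Spaces.linear fscale "(*)" \<Phi> by fact
    define w where "w u = (if u \<in> \<sigma> then \<Phi> (unit_fun u) else 0)" for u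
    have "w v = 0"
    proof (rule no_common_zero_on_face[OF fd \<sigma>])
      show "u \<in> \<sigma>" if "w u \<noteq> 0" for u using that by (auto simp: w_def split: if_splits)
      fix k assume k: "k < length \<Theta>"
      have "r k \<in> supported \<sigma>" by (auto simp: r_def supported_def)
      then have "0 = \<Phi> (\<Sum>u\<in>\<sigma>. fscale (r k u) (unit_fun u))"
        using \<Phi>(2)[OF rU[OF k]] supported_eq_sum[OF fin, of "r k"] by simp
      also have "\<dots> = (\<Sum>u\<in>\<sigma>. th k u * w u)"
        by (simp add: \<Phi>.sum \<Phi>.scale r_def w_def)
      also have "\<dots> = (\<Sum>u\<in>V. th k u * w u)"
        using face_subset[OF \<sigma>] finite_V by (intro sum.mono_neutral_left) (auto simp: w_def)
      finally show "(\<Sum>v\<in>V. th k v * w v) = 0" by simp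
    qed
    then show False using \<Phi>(3) v by (simp add: w_def)
  qed
  then obtain a where a: "unit_fun v = (\<Sum>k<length \<Theta>. fscale (a k) (r k))" unfolding U_def by blast
  have "(\<Sum>k<length \<Theta>. a k * th k u) = (if u = v then 1 else 0)" if "u \<in> \<sigma>" for u
    using fun_cong[OF a, of u] that by (simp add: sum_fun_apply fscale_apply r_def unit_fun_def)
  then show ?thesis by blast
qed

lemma I_lookup_face:
  assumes "p \<in> I" "keys \<mu> \<in> \<Delta>"
  shows "lookup p \<mu> = 0"
proof -
  let ?F = "{f :: ('v \<Rightarrow>\<^sub>0 nat) \<Rightarrow> 'f. \<forall>\<mu>. f \<mu> \<noteq> 0 \<longrightarrow> keys \<mu> \<in> \<Delta>}"
  have "(\<lambda>\<mu>. f (\<nu> + \<mu>)) \<in> ?F" if f: "f \<in> ?F" for f \<nu>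
  proof (intro CollectI allI impI)
    fix \<mu> assume "f (\<nu> + \<mu>) \<noteq> 0"
    then have "keys (\<nu> + \<mu>) \<in> \<Delta>" using f by blast
    then show "keys \<mu> \<in> \<Delta>" by (rule subface) (simp add: keys_plus_nat)
  qed
  moreover have "f \<mu> = 0" if "f \<in> ?F" "keys \<mu> \<notin> \<Delta>" for f \<mu> using that by blast
  ultimately have "I \<subseteq> {p \<in> carrier R. \<forall>f\<in>?F. pairing f p = 0}" by (rule I_killed)
  moreover have "unit_fun \<mu> \<in> ?F" using assms(2) by (auto simp: unit_fun_def)
  ultimately have "pairing (unit_fun \<mu>) p = 0" using assms(1) by blast
  moreover have "pairing (unit_fun \<mu>) p = lookup p \<mu>"
  proof -
    have "pairing (unit_fun \<mu>) p = (\<Sum>\<nu>\<in>keys p. if \<nu> = \<mu> then lookup p \<mu> else 0)"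
      unfolding pairing_def by (rule sum.cong) (auto simp: unit_fun_def)
    then show ?thesis by (auto simp: in_keys_iff)
  qed
  ultimately show ?thesis by simp
qed

text \<open>Homogeneity is given for the class, not for its representative \<open>pk k\<close>. Two
  representatives differ by an element of the Stanley-Reisner ideal, which has coefficient zero at
  every single vertex.\<close>

lemma homogeneous_form:
  assumes k: "k < length \<Theta>" and c: "\<Theta> ! k \<in> SR_component \<Delta> \<pi> c" and v: "v \<in> V" "th k v \<noteq> 0"
  shows "\<pi> v = c"
proof -
  obtain q where q: "q \<in> poly_component V \<pi> c" "\<Theta> ! k = SR_map \<Delta> q"
    using c unfolding SR_component_def by blast
  have "I +>\<^bsub>R\<^esub> pk k = I +>\<^bsub>R\<^esub> q" using q(2) theta[OF k] unfolding SR_map_def quot_map_def by simp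
  then have "pk k \<in> I +>\<^bsub>R\<^esub> q" using I.a_rcos_self[OF pk_carrier[OF k]] by simp
  then obtain i where i: "i \<in> I" "pk k = i + q" unfolding a_r_coset_def' by auto
  have "{v} \<in> \<Delta>" using v(1) subface unfolding vertices_def by blast
  then have "lookup i (var_exp v) = 0" using I_lookup_face[OF i(1), of "var_exp v"] by simp
  then have "lookup q (var_exp v) \<noteq> 0" using v(2) i(2) by (simp add: th_def lookup_add)
  then have "var_exp v \<in> keys q" by (simp add: in_keys_iff)
  then have "multidegree \<pi> (var_exp v) = c" using q(1) unfolding poly_component_iff by blast
  then show ?thesis by (auto simp: fun_eq_iff)
qed

end

text \<open>On vertices of degree \<open>e\<close> only forms of degree \<open>e\<close> are
  nonzero, and these still span all functions there.\<close>

lemma card_colored_forms_ge: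
  fixes th :: "nat \<Rightarrow> 'v \<Rightarrow> 'f::field"
  assumes sp: "\<And>v. v \<in> \<sigma> \<Longrightarrow> \<exists>a. \<forall>u\<in>\<sigma>. (\<Sum>k<d. a k * th k u) = (if u = v then 1 else 0)"
    and hom: "\<And>k v. k < d \<Longrightarrow> v \<in> \<sigma> \<Longrightarrow> th k v \<noteq> 0 \<Longrightarrow> \<pi> v = \<kappa> k"
  shows "card {v \<in> \<sigma>. \<pi> v = e} \<le> card {k. k < d \<and> \<kappa> k = e}"
proof -
  let ?S = "{v \<in> \<sigma>. \<pi> v = e}" and ?K = "{k. k < d \<and> \<kappa> k = e}"
  define r where "r k = (\<lambda>u. if u \<in> ?S then th k u else 0)" for k
  have "unit_fun v \<in> fn.span (r ` ?K)" if v: "v \<in> ?S" for v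
  proof -
    obtain a where a: "\<And>u. u \<in> \<sigma> \<Longrightarrow> (\<Sum>k<d. a k * th k u) = (if u = v then 1 else 0)"
      using sp[of v] v by auto
    have "unit_fun v = (\<Sum>k\<in>?K. fscale (a k) (r k))"
    proof
      fix u
      show "unit_fun v u = (\<Sum>k\<in>?K. fscale (a k) (r k)) u"
      proof (cases "u \<in> ?S")
        case True
        then have "(\<Sum>k\<in>?K. a k * th k u) = (\<Sum>k<d. a k * th k u)"
          using hom by (intro sum.mono_neutral_left) auto
        then show ?thesis using True a[of u] by (simp add: sum_fun_apply fscale_apply r_def unit_fun_def)
      next
        case False
        then show ?thesis using v by (auto simp: sum_fun_apply fscale_apply r_def unit_fun_def)
      qed
    qed
    moreover have "(\<Sum>k\<in>?K. fscale (a k) (r k)) \<in> fn.span (r ` ?K)"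
      by (intro fn.span_sum fn.span_scale fn.span_base imageI)
    ultimately show ?thesis by simp
  qed
  then have sub: "unit_fun ` ?S \<subseteq> fn.span (r ` ?K)" by blast
  have "finite (r ` ?K)" by simp
  from fn.independent_span_bound[OF this independent_unit_fun sub]
  have "card (unit_fun ` ?S :: ('v \<Rightarrow> 'f) set) \<le> card (r ` ?K)" by blast
  also have "\<dots> \<le> card ?K" by (rule card_image_le) simp
  finally show ?thesis by (simp add: card_image[OF inj_on_subset[OF inj_unit_fun]])
qed

section \<open>Comparison with reduced Betti numbers\<close>

global_interpretation chain_fn: vector_space_pair chain_scale fscale ..

lemma linear_lookup: "Vector_Spaces.linear chain_scale fscale lookup"
  by unfold_locales (auto simp: fun_eq_iff lookup_add lookup_chain_scale fscale_apply)

lemma chains_finite_span: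
  fixes X :: "'v set set"
  assumes "finite X"
  shows "{c. keys c \<subseteq> X} \<subseteq> chain.span ((\<lambda>\<tau>. single \<tau> (1 :: 'f::field)) ` X)"
proof
  fix c :: "'v set \<Rightarrow>\<^sub>0 'f" assume c: "c \<in> {c. keys c \<subseteq> X}"
  have s: "single \<tau> x = chain_scale x (single \<tau> 1)" for \<tau> :: "'v set" and x :: 'f
    by (rule poly_mapping_eqI) (simp add: lookup_chain_scale lookup_single when_def)
  have "c = (\<Sum>\<tau>\<in>keys c. chain_scale (lookup c \<tau>) (single \<tau> 1))"
    by (rule trans[OF poly_mapping_eq_sum sum.cong[OF refl s]])
  also have "\<dots> \<in> chain.span ((\<lambda>\<tau>. single \<tau> (1 :: 'f)) ` X)"
    using c by (intro chain.span_sum chain.span_scale chain.span_base) auto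
  finally show "c \<in> chain.span ((\<lambda>\<tau>. single \<tau> (1 :: 'f)) ` X)" .
qed

section \<open>Simplicial chains as functions\<close>

context complex_forms
begin

text \<open>The coefficient at \<open>\<rho>\<close> collects the faces
  \<open>insert v \<rho>\<close>; the sign taken in the larger face agrees with the one in
  \<open>\<rho>\<close> because \<open>sg\<close> does not count \<open>v\<close>.\<close>

lemma lookup_boundary:
  assumes "keys c \<subseteq> Pow V"
  shows "lookup (boundary c) = bdc (lookup c)"
proof
  fix \<rho>
  let ?l = "lookup c" and ?k = "keys c"
  have "lookup (boundary c) \<rho> =
      (\<Sum>\<tau>\<in>?k. \<Sum>v\<in>\<tau>. if \<tau> - {v} = \<rho> then sg v \<tau> * ?l \<tau> else 0)"
    unfolding boundary_def sg_def by (simp add: lookup_sum lookup_single when_def)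
  also have "\<dots> = (\<Sum>\<tau>\<in>?k. \<Sum>v\<in>V. if v \<in> \<tau> \<and> \<tau> - {v} = \<rho> then sg v \<tau> * ?l \<tau> else 0)"
  proof (rule sum.cong[OF refl])
    fix \<tau> assume "\<tau> \<in> ?k"
    then have "\<tau> \<subseteq> V" using assms by blast
    then show "(\<Sum>v\<in>\<tau>. if \<tau> - {v} = \<rho> then sg v \<tau> * ?l \<tau> else 0) =
        (\<Sum>v\<in>V. if v \<in> \<tau> \<and> \<tau> - {v} = \<rho> then sg v \<tau> * ?l \<tau> else 0)"
      using finite_V by (intro sum.mono_neutral_cong_left) auto
  qed
  also have "\<dots> = (\<Sum>v\<in>V. \<Sum>\<tau>\<in>?k. if v \<in> \<tau> \<and> \<tau> - {v} = \<rho> then sg v \<tau> * ?l \<tau> else 0)"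
    by (rule sum.swap)
  also have "\<dots> = (\<Sum>v\<in>V. if v \<in> \<rho> then 0 else sg v \<rho> * ?l (insert v \<rho>))"
  proof (rule sum.cong[OF refl])
    fix v
    have "(\<Sum>\<tau>\<in>?k. if v \<in> \<tau> \<and> \<tau> - {v} = \<rho> then sg v \<tau> * ?l \<tau> else 0) =
        (\<Sum>\<tau>\<in>?k. if \<tau> = insert v \<rho> then (if v \<in> \<rho> then 0 else sg v \<rho> * ?l (insert v \<rho>)) else 0)"
      by (rule sum.cong) auto
    also have "\<dots> = (if v \<in> \<rho> then 0 else sg v \<rho> * ?l (insert v \<rho>))"
      by (simp add: in_keys_iff)
    finally show "(\<Sum>\<tau>\<in>?k. if v \<in> \<tau> \<and> \<tau> - {v} = \<rho> then sg v \<tau> * ?l \<tau> else 0) =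
        (if v \<in> \<rho> then 0 else sg v \<rho> * ?l (insert v \<rho>))" .
  qed
  also have "\<dots> = bdc ?l \<rho>"
  proof (cases "\<rho> \<subseteq> V")
    case True
    then show ?thesis unfolding bdc_def using finite_V by (auto intro!: sum.mono_neutral_cong_right)
  next
    case False
    have "?l (insert v \<rho>) = 0" for v
    proof (rule ccontr)
      assume "?l (insert v \<rho>) \<noteq> 0"
      then have "insert v \<rho> \<in> ?k" by (simp add: in_keys_iff)
      then show False using False assms by blast
    qed
    then have "(\<Sum>v\<in>V. if v \<in> \<rho> then 0 else sg v \<rho> * ?l (insert v \<rho>)) = 0"
      by (intro sum.neutral) simp
    then show ?thesis using False by (simp add: bdc_def)
  qed
  finally show "lookup (boundary c) \<rho> = bdc ?l \<rho>" .
qed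

lemma lookup_chains:
  assumes "finite X"
  shows "lookup ` {c. keys c \<subseteq> X} = (supported X :: ('v set \<Rightarrow> 'f) set)"
proof
  show "lookup ` {c. keys c \<subseteq> X} \<subseteq> (supported X :: ('v set \<Rightarrow> 'f) set)"
    by (auto simp: supported_def in_keys_iff)
  show "(supported X :: ('v set \<Rightarrow> 'f) set) \<subseteq> lookup ` {c. keys c \<subseteq> X}"
  proof
    fix g :: "'v set \<Rightarrow> 'f" assume g: "g \<in> supported X"
    then have "finite {x. g x \<noteq> 0}" using assms by (auto simp: supported_def intro: finite_subset)
    then have "g = lookup (Abs_poly_mapping g)" by simp
    moreover from this have "keys (Abs_poly_mapping g) \<subseteq> X"
      using g by (auto simp: supported_def in_keys_iff)
    ultimately show "g \<in> lookup ` {c. keys c \<subseteq> X}" by blast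
  qed
qed

lemma dim_lookup_image:
  assumes "chain.subspace U" "U \<subseteq> {c. keys c \<subseteq> X}" "finite X"
  shows "fn.dim (lookup ` U) = chain.dim (U :: ('v set \<Rightarrow>\<^sub>0 'f) set)"
proof (rule chain_fn.dim_injective_image[OF linear_lookup assms(1)])
  show "U \<subseteq> chain.span ((\<lambda>\<tau>. single \<tau> 1) ` X)"
    using assms(2) chains_finite_span[OF assms(3)] by blast
  show "finite ((\<lambda>\<tau>. single \<tau> (1 :: 'f)) ` X)" using assms(3) by simp
  show "x = 0" if "lookup x = 0" for x :: "'v set \<Rightarrow>\<^sub>0 'f"
    by (rule poly_mapping_eqI) (simp add: that)
qed

lemma chains_link: "chains (link \<Delta> \<sigma>) (int p - 1) = {c. keys c \<subseteq> link_faces \<sigma> p}"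
proof -
  have "{\<tau> \<in> link \<Delta> \<sigma>. face_dim \<tau> = int p - 1} = link_faces \<sigma> p"
    using subface by (auto simp: link_def link_faces_def face_dim_def Un_commute)
  then show ?thesis unfolding chains_def by simp
qed

lemma link_faces_Pow: "link_faces \<sigma> p \<subseteq> Pow V"
  using face_subset by (auto simp: link_faces_def)

lemma linear_boundary_on:
  assumes "keys c \<subseteq> Pow V" "keys c' \<subseteq> Pow V"
  shows "boundary (c + c') = boundary c + boundary (c' :: 'v set \<Rightarrow>\<^sub>0 'f)"
    and "boundary (chain_scale k c) = chain_scale k (boundary (c :: 'v set \<Rightarrow>\<^sub>0 'f))"
proof -
  have k1: "keys (c + c') \<subseteq> Pow V"
    using assms Poly_Mapping.keys_add[of c c'] by blast
  have k2: "keys (chain_scale k c) \<subseteq> Pow V"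
    using assms(1) by (auto simp: in_keys_iff lookup_chain_scale)
  have l1: "lookup (c + c') = lookup c + lookup c'"
    by (simp add: fun_eq_iff lookup_add)
  have l2: "lookup (chain_scale k c) = fscale k (lookup c)"
    by (simp add: fun_eq_iff lookup_chain_scale fscale_apply)
  show "boundary (c + c') = boundary c + boundary c'"
    by (rule poly_mapping_eqI)
      (simp add: lookup_add lookup_boundary[OF k1] lookup_boundary[OF assms(1)] lookup_boundary[OF assms(2)] l1 bdc.add)
  show "boundary (chain_scale k c) = chain_scale k (boundary c)"
    by (rule poly_mapping_eqI)
      (simp add: lookup_chain_scale lookup_boundary[OF k2] lookup_boundary[OF assms(1)] l2 bdc.scale fscale_apply)
qed

lemma lookup_cycles: "lookup ` cycles (link \<Delta> \<sigma>) (int p - 1) = lcyc \<sigma> p"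
proof -
  have "boundary c = 0 \<longleftrightarrow> bdc (lookup c) = 0"
    if "keys c \<subseteq> link_faces \<sigma> p" for c
  proof -
    have "lookup (boundary c) = bdc (lookup c)"
      using that link_faces_Pow by (intro lookup_boundary) blast
    moreover have "boundary c = 0 \<longleftrightarrow> lookup (boundary c) = 0"
      unfolding poly_mapping_eq_iff by (simp add: fun_eq_iff)
    ultimately show ?thesis by simp
  qed
  then have "cycles (link \<Delta> \<sigma>) (int p - 1) =
      {c \<in> {c. keys c \<subseteq> link_faces \<sigma> p}. bdc (lookup c) = 0}"
    unfolding cycles_def chains_link by blast
  then have "lookup ` cycles (link \<Delta> \<sigma>) (int p - 1) =
      {g \<in> lookup ` {c. keys c \<subseteq> link_faces \<sigma> p}. bdc g = 0}" by blast
  then show ?thesis unfolding lookup_chains[OF finite_link_faces] lcyc_def .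
qed

lemma lookup_boundaries: "lookup ` boundaries (link \<Delta> \<sigma>) (int p - 1) = lbnd \<sigma> p"
proof -
  have e: "int p - 1 + 1 = int (Suc p) - 1" by simp
  have "lookup ` boundaries (link \<Delta> \<sigma>) (int p - 1) =
      (\<lambda>c. bdc (lookup c)) ` {c. keys c \<subseteq> link_faces \<sigma> (Suc p)}"
    unfolding boundaries_def e chains_link image_image
    by (rule image_cong[OF refl], rule lookup_boundary) (use link_faces_Pow in blast)
  also have "\<dots> = bdc ` lookup ` {c. keys c \<subseteq> link_faces \<sigma> (Suc p)}"
    by (simp add: image_image)
  finally show ?thesis unfolding lookup_chains[OF finite_link_faces] lbnd_def .
qed

lemma subspace_chains: "chain.subspace {c :: 'v set \<Rightarrow>\<^sub>0 'f. keys c \<subseteq> X}"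
proof (rule chain.subspaceI)
  fix x y :: "'v set \<Rightarrow>\<^sub>0 'f"
  assume "x \<in> {c. keys c \<subseteq> X}" "y \<in> {c. keys c \<subseteq> X}"
  then show "x + y \<in> {c. keys c \<subseteq> X}" using Poly_Mapping.keys_add[of x y] by blast
qed (auto simp: in_keys_iff lookup_chain_scale)

lemma reduced_betti_link:
  "reduced_betti TYPE('f) (link \<Delta> \<sigma>) (int p - 1) = fn.dim (lcyc \<sigma> p) - fn.dim (lbnd \<sigma> p)"
proof -
  let ?C = "{c :: 'v set \<Rightarrow>\<^sub>0 'f. keys c \<subseteq> link_faces \<sigma> p}"
  let ?C' = "{c :: 'v set \<Rightarrow>\<^sub>0 'f. keys c \<subseteq> link_faces \<sigma> (Suc p)}"
  have P: "keys c \<subseteq> Pow V" if "keys c \<subseteq> link_faces \<sigma> q" for c :: "'v set \<Rightarrow>\<^sub>0 'f" and q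
    using that link_faces_Pow by blast
  have b0: "boundary (0 :: 'v set \<Rightarrow>\<^sub>0 'f) = 0" by (simp add: boundary_def)
  have cyc: "cycles (link \<Delta> \<sigma>) (int p - 1) = {c \<in> ?C. boundary c = 0}"
    unfolding cycles_def chains_link ..
  have subc: "chain.subspace (cycles (link \<Delta> \<sigma>) (int p - 1) :: ('v set \<Rightarrow>\<^sub>0 'f) set)"
    unfolding cyc
  proof (rule chain.subspaceI)
    fix x y k assume x: "x \<in> {c \<in> ?C. boundary c = 0}"
    then show "chain_scale k x \<in> {c \<in> ?C. boundary c = 0}"
      using chain.subspace_scale[OF subspace_chains, of x] linear_boundary_on(2)[OF P P, of x p x p k] by simp
    assume y: "y \<in> {c \<in> ?C. boundary c = 0}"
    then show "x + y \<in> {c \<in> ?C. boundary c = 0}"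
      using x chain.subspace_add[OF subspace_chains, of x _ y] linear_boundary_on(1)[OF P P, of x p y p] by simp
  qed (simp add: b0)
  have "cycles (link \<Delta> \<sigma>) (int p - 1) \<subseteq> ?C" unfolding cyc by (rule Collect_subset)
  from dim_lookup_image[OF subc this finite_link_faces]
  have 1: "chain.dim (cycles (link \<Delta> \<sigma>) (int p - 1) :: ('v set \<Rightarrow>\<^sub>0 'f) set) = fn.dim (lcyc \<sigma> p)"
    unfolding lookup_cycles by (rule sym)
  have e: "int p - 1 + 1 = int (Suc p) - 1" by simp
  have bnd: "boundaries (link \<Delta> \<sigma>) (int p - 1) = boundary ` ?C'"
    unfolding boundaries_def e chains_link ..
  have sub: "chain.subspace (boundary ` ?C')"
  proof (rule chain.subspaceI)
    show "0 \<in> boundary ` ?C'" using b0 by (rule image_eqI[OF sym]) simp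
  next
    fix x y assume "x \<in> boundary ` ?C'" "y \<in> boundary ` ?C'"
    then obtain a b where ab: "a \<in> ?C'" "x = boundary a" "b \<in> ?C'" "y = boundary b" by blast
    then have "x + y = boundary (a + b)" using linear_boundary_on(1)[OF P P, of a _ b] by simp
    then show "x + y \<in> boundary ` ?C'" using chain.subspace_add[OF subspace_chains ab(1,3)] by blast
  next
    fix k x assume "x \<in> boundary ` ?C'"
    then obtain a where a: "a \<in> ?C'" "x = boundary a" by blast
    then have "chain_scale k x = boundary (chain_scale k a)" using linear_boundary_on(2)[OF P P, of a _ a] by simp
    then show "chain_scale k x \<in> boundary ` ?C'" using chain.subspace_scale[OF subspace_chains a(1)] by blast
  qed
  have subb: "boundary ` ?C' \<subseteq> ?C"
  proof (rule image_subsetI)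
    fix c assume c: "c \<in> ?C'"
    then have "lookup c \<in> supported (link_faces \<sigma> (Suc p))" by (auto simp: supported_def in_keys_iff)
    then have "lookup (boundary c) \<in> supported (link_faces \<sigma> p)"
      using bdc_supported lookup_boundary[OF P] c by simp
    then show "boundary c \<in> ?C" by (auto simp: supported_def in_keys_iff)
  qed
  from dim_lookup_image[OF sub subb finite_link_faces]
  have 2: "chain.dim (boundaries (link \<Delta> \<sigma>) (int p - 1) :: ('v set \<Rightarrow>\<^sub>0 'f) set) = fn.dim (lbnd \<sigma> p)"
    unfolding bnd[symmetric] lookup_boundaries by (rule sym)
  show ?thesis unfolding reduced_betti_def 1 2 ..
qed

text \<open>Guarantees that the natural-number subtraction in \<open>reduced_betti\<close> is the
  true difference.\<close>

lemma dim_lbnd_le: "fn.dim (lbnd \<sigma> p) \<le> fn.dim (lcyc \<sigma> p)"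
proof -
  let ?X = "unit_fun ` link_faces \<sigma> p :: ('v set \<Rightarrow> 'f) set"
  have fX: "finite ?X" using finite_link_faces by simp
  have cX: "lcyc \<sigma> p \<subseteq> fn.span ?X"
    using lcyc_supported supported_subset_span[OF finite_link_faces] by blast
  obtain C where C: "C \<subseteq> lcyc \<sigma> p" "lcyc \<sigma> p \<subseteq> fn.span C" "card C = fn.dim (lcyc \<sigma> p)" "finite C"
    using fn.finite_basis[OF cX fX] by metis
  have "lbnd \<sigma> p \<subseteq> fn.span C" using lbnd_subset_lcyc C(2) by blast
  from fn.dim_le_card[OF this C(4)] show ?thesis using C(3) by simp
qed

section \<open>Vanishing homology of links in Buchsbaum complexes\<close>

lemma link_exact_if_betti_0:
  assumes "reduced_betti TYPE('f) (link \<Delta> \<sigma>) (int p - 1) = 0"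
  shows "link_exact \<sigma> p"
proof -
  let ?X = "unit_fun ` link_faces \<sigma> p :: ('v set \<Rightarrow> 'f) set"
  have "lbnd \<sigma> p = lcyc \<sigma> p"
  proof (rule fn.subspace_eq_if_dim_le[OF subspace_lbnd lbnd_subset_lcyc, of _ _ ?X])
    show "lcyc \<sigma> p \<subseteq> fn.span ?X"
      using lcyc_supported supported_subset_span[OF finite_link_faces] by blast
    show "finite ?X" using finite_link_faces by simp
    show "fn.dim (lcyc \<sigma> p) \<le> fn.dim (lbnd \<sigma> p)" using assms unfolding reduced_betti_link by simp
  qed
  then have eq: "lcyc \<sigma> p \<subseteq> lbnd \<sigma> p" by simp
  show ?thesis
    unfolding link_exact_def
  proof (intro ballI impI)
    fix g assume "g \<in> supported (link_faces \<sigma> p)" "bdc g = 0"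
    then have "g \<in> lcyc \<sigma> p" unfolding lcyc_def by blast
    then have "g \<in> lbnd \<sigma> p" using eq by blast
    then show "\<exists>g'\<in>supported (link_faces \<sigma> (Suc p)). bdc g' = g" unfolding lbnd_def by blast
  qed
qed

text \<open>For a vertex \<open>v\<close> of \<open>\<sigma>\<close>, the link of
  \<open>\<sigma>\<close> is the link of \<open>\<sigma> - {v}\<close> inside the Cohen-Macaulay
  link of \<open>v\<close>. Purity makes its dimension \<open>d - card \<sigma> - 1\<close>, so the
  homology in dimension \<open>p - 1\<close> lies below the top.\<close>

lemma link_exact_if_buchsbaum:
  assumes bb: "buchsbaum TYPE('f) \<Delta>" and dim: "complex_dim \<Delta> = int d - 1"
    and \<sigma>: "\<sigma> \<in> \<Delta>" "\<sigma> \<noteq> {}" and p: "p < d - card \<sigma>"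
  shows "link_exact \<sigma> p"
proof (rule link_exact_if_betti_0)
  have fin\<Delta>: "finite \<Delta>" using complex by (simp add: simplicial_complex_def)
  obtain v where v: "v \<in> \<sigma>" using \<sigma>(2) by blast
  let ?L = "link \<Delta> {v}" and ?s = "\<sigma> - {v}"
  have vV: "v \<in> vertices \<Delta>" using v \<sigma>(1) by (auto simp: vertices_def)
  have ins: "insert v ?s = \<sigma>" using v by blast
  have sL: "?s \<in> ?L" using \<sigma>(1) subface[OF \<sigma>(1), of ?s] ins by (simp add: link_def)
  have lk: "link ?L ?s = link \<Delta> \<sigma>"
  proof
    show "link ?L ?s \<subseteq> link \<Delta> \<sigma>"
    proof
      fix \<tau> assume "\<tau> \<in> link ?L ?s"
      then have *: "\<tau> \<in> \<Delta>" "v \<notin> \<tau>" "\<tau> \<inter> ?s = {}" "\<tau> \<union> ?s \<union> {v} \<in> \<Delta>"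
        by (auto simp: link_def)
      moreover have "\<tau> \<union> ?s \<union> {v} = \<tau> \<union> \<sigma>" using v by blast
      ultimately show "\<tau> \<in> link \<Delta> \<sigma>" by (auto simp: link_def)
    qed
    show "link \<Delta> \<sigma> \<subseteq> link ?L ?s"
    proof
      fix \<tau> assume "\<tau> \<in> link \<Delta> \<sigma>"
      then have *: "\<tau> \<in> \<Delta>" "\<tau> \<inter> \<sigma> = {}" "\<tau> \<union> \<sigma> \<in> \<Delta>" by (auto simp: link_def)
      have "\<tau> \<union> {v} \<in> \<Delta>" "\<tau> \<union> ?s \<in> \<Delta>" using v by (auto intro: subface[OF *(3)])
      moreover have "\<tau> \<union> ?s \<union> {v} = \<tau> \<union> \<sigma>" using v by blast
      ultimately show "\<tau> \<in> link ?L ?s" using * v by (auto simp: link_def)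
    qed
  qed
  have pure: "\<exists>F\<in>\<Delta>. \<sigma> \<subseteq> F \<and> card F = d"
  proof -
    have "finite {F \<in> \<Delta>. \<sigma> \<subseteq> F}" "{F \<in> \<Delta>. \<sigma> \<subseteq> F} \<noteq> {}" using fin\<Delta> \<sigma>(1) by auto
    then obtain F where F: "F \<in> {F \<in> \<Delta>. \<sigma> \<subseteq> F}" "\<And>G. G \<in> {F \<in> \<Delta>. \<sigma> \<subseteq> F} \<Longrightarrow> F \<subseteq> G \<Longrightarrow> F = G"
      using finite_has_maximal[of "{F \<in> \<Delta>. \<sigma> \<subseteq> F}"] by blast
    then have "F \<in> facets \<Delta>" unfolding facets_def by blast
    then have "face_dim F = int d - 1"
      using bb dim unfolding buchsbaum_def pure_complex_def by simp
    then show ?thesis using F(1) by (auto simp: face_dim_def)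
  qed
  have "complex_dim (link \<Delta> \<sigma>) = int (d - card \<sigma>) - 1"
    unfolding complex_dim_def
  proof (rule Max_eqI)
    show "finite (face_dim ` link \<Delta> \<sigma>)" using fin\<Delta> by (simp add: link_def)
    fix y assume "y \<in> face_dim ` link \<Delta> \<sigma>"
    then obtain \<tau> where \<tau>: "y = face_dim \<tau>" "\<tau> \<inter> \<sigma> = {}" "\<tau> \<union> \<sigma> \<in> \<Delta>" by (auto simp: link_def)
    then have "card \<tau> + card \<sigma> = card (\<tau> \<union> \<sigma>)"
      using card_Un_disjoint[of \<tau> \<sigma>] finite_face[OF \<tau>(3)] by simp
    then show "y \<le> int (d - card \<sigma>) - 1" using card_face[OF \<tau>(3)] \<tau>(1) by (simp add: face_dim_def)
  next
    obtain F where F: "F \<in> \<Delta>" "\<sigma> \<subseteq> F" "card F = d" using pure by blast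
    have "F - \<sigma> \<in> link \<Delta> \<sigma>"
      using F subface[OF F(1), of "F - \<sigma>"] by (auto simp: link_def Un_absorb2)
    moreover have "face_dim (F - \<sigma>) = int (d - card \<sigma>) - 1"
      using F finite_face[OF \<sigma>(1)] by (simp add: face_dim_def card_Diff_subset)
    ultimately show "int (d - card \<sigma>) - 1 \<in> face_dim ` link \<Delta> \<sigma>" by (metis imageI)
  qed
  then have "int p - 1 < complex_dim (link \<Delta> \<sigma>)" using p by simp
  moreover have "cohen_macaulay TYPE('f) ?L" using bb vV unfolding buchsbaum_def by blast
  ultimately show "reduced_betti TYPE('f) (link \<Delta> \<sigma>) (int p - 1) = 0"
    using sL lk unfolding cohen_macaulay_def by metis
qed

text \<open>A vertex has the empty face as its boundary, so the cone with apex \<open>v\<close>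
  kills the homology in dimension -1.\<close>

lemma betti_empty_face:
  assumes "v \<in> V"
  shows "reduced_betti TYPE('f) (link \<Delta> {}) (int 0 - 1) = 0"
proof -
  have "{v} \<in> \<Delta>" using assms subface unfolding V_eq vertices_def by blast
  have "lcyc {} 0 \<subseteq> lbnd {} 0"
  proof
    fix g assume "g \<in> lcyc {} 0"
    then have g: "g \<in> supported (link_faces {} 0)" "bdc g = 0" by (auto simp: lcyc_def)
    have supp: "\<tau> = {}" if "g \<tau> \<noteq> 0" for \<tau>
      using g(1) that finite_face[of \<tau>] by (auto simp: supported_def link_faces_def)
    have "cone v g \<in> supported (link_faces {} (Suc 0))"
    proof -
      have "\<tau> = {v}" if "cone v g \<tau> \<noteq> 0" for \<tau>
      proof -
        have "v \<in> \<tau>" "g (\<tau> - {v}) \<noteq> 0" using that by (auto simp: cone_def split: if_splits)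
        then show ?thesis using supp by blast
      qed
      then show ?thesis using \<open>{v} \<in> \<Delta>\<close> by (fastforce simp: supported_def link_faces_def)
    qed
    moreover have "bdc (cone v g) = g"
    proof
      fix \<tau>
      show "bdc (cone v g) \<tau> = g \<tau>"
      proof (cases "\<tau> \<subseteq> V")
        case True
        have "cone v (bdc g) \<tau> = 0" by (simp add: g(2) cone_def)
        then show ?thesis using bdc_cone[OF assms True, of g] by simp
      next
        case False
        then show ?thesis using supp[of \<tau>] by (auto simp: bdc_def)
      qed
    qed
    ultimately show "g \<in> lbnd {} 0" unfolding lbnd_def by (metis imageI)
  qed
  then have "lbnd {} 0 = lcyc {} 0" using lbnd_subset_lcyc by blast
  then show ?thesis unfolding reduced_betti_link by simp
qed

end

section \<open>The corner of the double complex as inverse system\<close>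

context graded_forms
begin

lemma finite_monomials: "finite {\<mu>. keys \<mu> \<in> \<Delta> \<and> multidegree \<pi> \<mu> = b}"
proof (rule finite_subset)
  show "{\<mu>. keys \<mu> \<in> \<Delta> \<and> multidegree \<pi> \<mu> = b} \<subseteq> (\<lambda>(S, \<tau>, \<mu>). \<mu>) ` cells 0 0"
  proof
    fix \<mu> assume "\<mu> \<in> {\<mu>. keys \<mu> \<in> \<Delta> \<and> multidegree \<pi> \<mu> = b}"
    then have "({}, {}, \<mu>) \<in> cells 0 0" by (auto simp: cells_def cdeg_def)
    then show "\<mu> \<in> (\<lambda>(S, \<tau>, \<mu>). \<mu>) ` cells 0 0" by force
  qed
qed (use finite_cells in simp)

text \<open>In the corner only the empty set of forms and the empty face occur, so cochains are
  functions of the monomial alone; \<open>dl\<close> at the singletons \<open>{k}\<close> gives the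
  defining equations.\<close>

lemma dim_inverse_system:
  "fn.dim (cyc (D 0 0)) = fn.dim {f \<in> supported {\<mu>. keys \<mu> \<in> \<Delta> \<and> multidegree \<pi> \<mu> = b}.
     \<forall>k<d. \<forall>\<mu>. (\<Sum>v\<in>V. th k v * f (\<mu> + var_exp v)) = 0}" (is "_ = fn.dim ?A")
proof -
  let ?X = "{\<mu>. keys \<mu> \<in> \<Delta> \<and> multidegree \<pi> \<mu> = b}"
  let ?E = "\<lambda>(f :: ('v \<Rightarrow>\<^sub>0 nat) \<Rightarrow> 'f) (S :: nat set, \<tau> :: 'v set, \<mu>). if S = {} \<and> \<tau> = {} then f \<mu> else 0"
  have lin: "Vector_Spaces.linear fscale fscale ?E"
    by (rule linear_fscaleI) (auto simp: fscale_apply split: prod.splits)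
  interpret E: Vector_Spaces.linear fscale fscale ?E by (rule lin)
  have cell00: "(S, \<tau>, \<mu>) \<in> cells 0 0 \<longleftrightarrow> S = {} \<and> \<tau> = {} \<and> \<mu> \<in> ?X" for S \<tau> \<mu>
  proof
    assume c: "(S, \<tau>, \<mu>) \<in> cells 0 0"
    then have "finite S" "finite \<tau>"
      using finite_subset[of S "{..<d}"] finite_face[of "\<tau> \<union> keys \<mu>"] by (auto simp: cells_def)
    then show "S = {} \<and> \<tau> = {} \<and> \<mu> \<in> ?X" using c by (auto simp: cells_def cdeg_def)
  qed (auto simp: cells_def cdeg_def)
  have dlE: "dl (?E f) = 0 \<longleftrightarrow> (\<forall>k<d. \<forall>\<mu>. (\<Sum>v\<in>V. th k v * f (\<mu> + var_exp v)) = 0)" for f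
  proof
    assume z: "dl (?E f) = 0"
    show "\<forall>k<d. \<forall>\<mu>. (\<Sum>v\<in>V. th k v * f (\<mu> + var_exp v)) = 0"
    proof (intro allI impI)
      fix k \<mu> assume k: "k < d"
      have "dl (?E f) ({k}, {}, \<mu>) = sg k {k} * (\<Sum>v\<in>V. th k v * f (\<mu> + var_exp v))"
        using k by (simp add: dl_def)
      then have "sg k {k} * (\<Sum>v\<in>V. th k v * f (\<mu> + var_exp v)) = 0" using z by simp
      moreover have "sg k {k} \<noteq> (0 :: 'f)" using sg_sq[of k "{k}", where 'f='f] by auto
      ultimately show "(\<Sum>v\<in>V. th k v * f (\<mu> + var_exp v)) = 0" by simp
    qed
  next
    assume z: "\<forall>k<d. \<forall>\<mu>. (\<Sum>v\<in>V. th k v * f (\<mu> + var_exp v)) = 0"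
    show "dl (?E f) = 0"
    proof
      fix x :: "'v cell"
      obtain S \<tau> \<mu> where x: "x = (S, \<tau>, \<mu>)" by (cases x)
      have "(\<Sum>v\<in>V. th k v * ?E f (S - {k}, \<tau>, \<mu> + var_exp v)) = 0" if "k \<in> S" "S \<subseteq> {..<d}" for k
      proof (cases "S - {k} = {} \<and> \<tau> = {}")
        case True
        then show ?thesis using z that by auto
      next
        case False
        then show ?thesis by (intro sum.neutral) auto
      qed
      then show "dl (?E f) x = 0 x" by (simp add: x dl_def)
    qed
  qed
  have img: "cyc (D 0 0) = ?E ` ?A"
  proof
    show "?E ` ?A \<subseteq> cyc (D 0 0)"
    proof (rule image_subsetI)
      fix f assume f: "f \<in> ?A"
      then have "?E f \<in> D 0 0" by (auto simp: D_def supported_def cell00 split: if_splits)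
      then show "?E f \<in> cyc (D 0 0)" using f dlE unfolding cyc_def by blast
    qed
    show "cyc (D 0 0) \<subseteq> ?E ` ?A"
    proof
      fix c assume c: "c \<in> cyc (D 0 0)"
      define f where "f \<mu> = c ({}, {}, \<mu>)" for \<mu>
      have cell: "(S, \<tau>, \<mu>) \<in> cells 0 0" if "c (S, \<tau>, \<mu>) \<noteq> 0" for S \<tau> \<mu>
        using c that by (auto simp: cyc_def D_def supported_def)
      have e: "?E f = c"
      proof
        fix x :: "'v cell"
        obtain S \<tau> \<mu> where x: "x = (S, \<tau>, \<mu>)" by (cases x)
        show "?E f x = c x" using cell[of S \<tau> \<mu>] by (auto simp: x f_def cell00)
      qed
      have "dl (?E f) = 0" unfolding e using c by (auto simp: cyc_def)
      moreover have "f \<in> supported ?X" using cell by (auto simp: supported_def f_def cell00)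
      ultimately have "f \<in> ?A" using dlE by blast
      then show "c \<in> ?E ` ?A" using e by blast
    qed
  qed
  have A: "?A = {f \<in> supported ?X. (dl \<circ> ?E) f = 0}" using dlE by simp
  have "fn.dim (?E ` ?A) = fn.dim ?A"
  proof (rule fn_pair.dim_injective_image[OF lin])
    show "fn.subspace ?A"
      unfolding A by (rule subspace_kernel_in[OF subspace_supported Vector_Spaces.linear_compose[OF lin linear_dl]])
    show "?A \<subseteq> fn.span (unit_fun ` ?X)" using supported_subset_span[OF finite_monomials] by blast
    show "finite (unit_fun ` ?X :: (('v \<Rightarrow>\<^sub>0 nat) \<Rightarrow> 'f) set)" using finite_monomials by simp
    show "f = 0" if "?E f = 0" for f
    proof
      fix \<mu>
      have "?E f ({}, {}, \<mu>) = 0" unfolding that by simp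
      then show "f \<mu> = 0 \<mu>" by simp
    qed
  qed
  then show ?thesis using img by simp
qed

end

section \<open>The Hilbert series\<close>

lemma color_sum_eq_color_count:
  assumes "finite T" "\<kappa> ` T \<subseteq> range unit_vec"
  shows "color_sum \<kappa> T = color_count \<kappa> T"
proof
  fix i
  have "color_sum \<kappa> T i = (\<Sum>k\<in>T. if \<kappa> k = unit_vec i then 1 else 0)"
    unfolding color_sum_def
  proof (rule sum.cong[OF refl])
    fix k assume "k \<in> T"
    then obtain j where j: "\<kappa> k = unit_vec j" using assms(2) by blast
    have "unit_vec j i = (if j = i then 1 else 0)" by (simp add: unit_vec_def)
    then show "\<kappa> k i = (if \<kappa> k = unit_vec i then 1 else 0)" by (simp add: j)
  qed
  also have "\<dots> = color_count \<kappa> T i"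
    using assms(1) by (simp add: color_count_def flip: sum.inter_filter)
  finally show "color_sum \<kappa> T i = color_count \<kappa> T i" .
qed

lemma vsize_le_eq:
  assumes "f \<le> g" "vsize f = vsize g"
  shows "f = g"
proof (rule ccontr)
  assume "f \<noteq> g"
  then obtain i where "f i \<noteq> g i" by auto
  then have "f i < g i" using assms(1) by (metis le_fun_def order_le_imp_less_or_eq)
  then have "vsize f < vsize g"
    unfolding vsize_def using assms(1) by (intro sum_strict_mono_ex1) (auto simp: le_fun_def)
  then show False using assms(2) by simp
qed

lemma vbinom_eq_0:
  assumes "\<not> b \<le> a"
  shows "vbinom a b = 0"
proof -
  obtain i where "a i < b i" using assms by (auto simp: le_fun_def not_le)
  then have "(a i choose b i) = 0" by simp
  then show ?thesis unfolding vbinom_def by (intro prod_zero) auto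
qed

text \<open>If a face has colour vector \<open>c\<close>, then \<open>c \<le> a\<close>, and
  \<open>b - c\<close> exceeds \<open>a - c\<close> wherever \<open>b\<close> exceeds
  \<open>a\<close>, so the binomial vanishes. Thus a formula for each single degree restricts to a
  sum over \<open>b \<le> a\<close>.\<close>

lemma flag_h'_eq_0:
  assumes "\<not> b \<le> a" and bal: "\<And>\<sigma>. \<sigma> \<in> \<Delta> \<Longrightarrow> color_sum \<pi> \<sigma> \<le> a"
  shows "flag_h' F \<Delta> \<pi> a b = 0"
proof -
  have "vbinom (a - c) (b - c) * flag_f \<Delta> \<pi> c = 0" for c
  proof (cases "c \<le> a")
    case True
    obtain i where i: "a i < b i" using assms(1) by (auto simp: le_fun_def not_le)
    have "c i \<le> a i" using True by (simp add: le_fun_def)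
    then have "\<not> b i - c i \<le> a i - c i" using i by simp
    then have "\<not> b - c \<le> a - c" by (auto simp: le_fun_def)
    then show ?thesis by (simp add: vbinom_eq_0)
  next
    case False
    then have "{\<sigma> \<in> \<Delta>. color_sum \<pi> \<sigma> = c} = {}" using bal by auto
    then show ?thesis unfolding flag_f_def by (simp only: card.empty mult_0_right)
  qed
  then have "flag_h \<Delta> \<pi> a b = 0" unfolding flag_h_def
    by (intro sum.neutral) (simp add: mult.assoc flip: of_nat_mult)
  then show ?thesis using vbinom_eq_0[OF assms(1)] by (simp add: flag_h'_def)
qed

theorem theorem3p1:
  fixes \<Delta> :: "'v::linorder set set"
    and \<pi> :: "'v \<Rightarrow> 'm::finite \<Rightarrow> nat"
    and a :: "'m \<Rightarrow> nat"
    and \<Theta> :: "('v, 'f::field) mpoly set list"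
  assumes "infinite (UNIV :: 'f set)"
    and "simplicial_complex \<Delta>"
    and "balanced \<Delta> \<pi> a"
    and "length \<Theta> = vsize a"
    and "graded_lsop \<Delta> \<pi> \<Theta>"
    and "buchsbaum TYPE('f) \<Delta>"
  shows "hilbert_series (SR_quot \<Delta> \<Theta>) (SR_quot_constants \<Delta> \<Theta>) (SR_quot_component \<Delta> \<pi> \<Theta>) =
           (\<lambda>c. \<Sum>b | b \<le> a. flag_h' TYPE('f) \<Delta> \<pi> a b * t_monomial b c)"
proof -
  note complex = assms(2) and balanced = assms(3) and len = assms(4) and graded = assms(5)
  let ?V = "vertices \<Delta>"
  have bal: "color_sum \<pi> \<sigma> \<le> a" if "\<sigma> \<in> \<Delta>" for \<sigma> using balanced that by (simp add: balanced_def)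
  have unit_pi: "\<pi> v \<in> range unit_vec" if "v \<in> ?V" for v
    using balanced that by (auto simp: balanced_def)
  have lsop: "set \<Theta> \<subseteq> SR_map \<Delta> ` linear_polys ?V"
    "ring.finite_dimension (SR_quot \<Delta> \<Theta>) (SR_quot_constants \<Delta> \<Theta>) (carrier (SR_quot \<Delta> \<Theta>))"
    using graded by (auto simp: graded_lsop_def lsop_def)
  have "\<exists>p. p \<in> linear_polys ?V \<and> \<Theta> ! k = SR_map \<Delta> p" if "k < length \<Theta>" for k
    using lsop(1) nth_mem[OF that] by blast
  then obtain pk where pk: "\<And>k. k < length \<Theta> \<Longrightarrow> pk k \<in> linear_polys ?V"
    "\<And>k. k < length \<Theta> \<Longrightarrow> \<Theta> ! k = SR_map \<Delta> (pk k)" by metis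
  interpret A: sr_forms \<Delta> \<Theta> pk
    by unfold_locales (use complex pk in auto)
  let ?d = "length \<Theta>"
  have dim: "complex_dim \<Delta> = int ?d - 1" using balanced len by (simp add: balanced_def)
  have fin\<Delta>: "finite \<Delta>" "\<Delta> \<noteq> {}" using complex by (auto simp: simplicial_complex_def)
  have card_face: "card \<sigma> \<le> ?d" if "\<sigma> \<in> \<Delta>" for \<sigma>
  proof -
    have "face_dim \<sigma> \<le> complex_dim \<Delta>"
      unfolding complex_dim_def using fin\<Delta> that by (intro Max_ge) auto
    then show ?thesis using dim by (simp add: face_dim_def)
  qed
  interpret F: forms ?V ?d A.th by unfold_locales (rule A.finite_V)
  have spanning: "F.spanning \<sigma>" if "\<sigma> \<in> \<Delta>" for \<sigma>
    unfolding F.spanning_def using A.forms_span_on_face[OF lsop(2) that] by blast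
  interpret C: complex_forms ?V ?d A.th \<Delta>
    by unfold_locales (use complex card_face spanning in auto)
  have "\<exists>c. c \<in> range unit_vec \<and> (\<forall>v\<in>?V. A.th k v \<noteq> 0 \<longrightarrow> \<pi> v = c)" if k: "k < ?d" for k
  proof -
    obtain c where "\<Theta> ! k \<in> SR_component \<Delta> \<pi> c"
      using graded nth_mem[OF k] unfolding graded_lsop_def by blast
    then have c: "\<pi> v = c" if "v \<in> ?V" "A.th k v \<noteq> 0" for v
      using A.homogeneous_form[OF k _ that] by blast
    \<comment> \<open>A form without variables receives an arbitrary unit vector as its
      colour.\<close>
    show ?thesis
    proof (cases "\<exists>v\<in>?V. A.th k v \<noteq> 0")
      case True
      then have "c \<in> range unit_vec" using c unit_pi by blast
      then show ?thesis using c by blast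
    qed blast
  qed
  then obtain \<kappa> where unit_kappa: "\<And>k. k < ?d \<Longrightarrow> \<kappa> k \<in> range unit_vec"
    and hom: "\<And>k v. k < ?d \<Longrightarrow> v \<in> ?V \<Longrightarrow> A.th k v \<noteq> 0 \<Longrightarrow> \<pi> v = \<kappa> k" by metis
  obtain S where S: "S \<in> \<Delta>" "card S = ?d"
  proof -
    have "complex_dim \<Delta> \<in> face_dim ` \<Delta>" unfolding complex_dim_def using fin\<Delta> by (intro Max_in) auto
    then show ?thesis using that dim by (auto simp: face_dim_def)
  qed
  have piS: "\<pi> ` S \<subseteq> range unit_vec" using C.face_subset[OF S(1)] unit_pi by blast
  have "color_sum \<pi> S = a"
    using bal[OF S(1)] vsize_color_sum[OF piS] S(2) len by (intro vsize_le_eq) auto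
  then have colS: "color_count \<pi> S = a"
    using color_sum_eq_color_count[OF C.finite_face[OF S(1)] piS] by simp
  have kap: "\<kappa> ` {..<?d} \<subseteq> range unit_vec" using unit_kappa by blast
  \<comment> \<open>The facet \<open>S\<close> has exactly \<open>a i\<close> vertices of colour
    \<open>i\<close>, so there are at least that many forms of each colour. Both totals are the
    length of \<open>\<Theta>\<close>, which forces equality.\<close>
  have "a = color_count \<kappa> {..<?d}"
  proof (rule vsize_le_eq)
    have "color_count \<pi> S i \<le> color_count \<kappa> {..<?d} i" for i
    proof -
      have "card {v \<in> S. \<pi> v = unit_vec i} \<le> card {k. k < ?d \<and> \<kappa> k = unit_vec i}"
      proof (rule card_colored_forms_ge[where th = A.th])
        show "\<exists>c. \<forall>u\<in>S. (\<Sum>k<?d. c k * A.th k u) = (if u = v then 1 else 0)" if "v \<in> S" for v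
          using A.forms_span_on_face[OF lsop(2) S(1) that] .
        show "\<pi> v = \<kappa> k" if "k < ?d" "v \<in> S" "A.th k v \<noteq> 0" for k v
          using hom that C.face_subset[OF S(1)] by blast
      qed
      then show ?thesis by (simp add: color_count_def)
    qed
    then show "a \<le> color_count \<kappa> {..<?d}" by (simp add: colS[symmetric] le_fun_def)
    show "vsize a = vsize (color_count \<kappa> {..<?d})"
      using vsize_color_sum[OF kap] color_sum_eq_color_count[OF _ kap] len by simp
  qed
  then have count: "card {k. k < ?d \<and> \<kappa> k = unit_vec i} = a i" for i
    by (simp add: color_count_def)
  have main: "int (A.QQ.dim A.K (SR_quot_component \<Delta> \<pi> \<Theta> b)) = flag_h' TYPE('f) \<Delta> \<pi> a b" for b
  proof -
    interpret G: graded_forms ?V ?d A.th \<Delta> \<pi> \<kappa> b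
      by unfold_locales (use C.link_exact_if_buchsbaum[OF assms(6) dim] hom unit_pi unit_kappa in auto)
    let ?n = "vsize b"
    have "A.QQ.dim A.K (SR_quot_component \<Delta> \<pi> \<Theta> b) = fn.dim (A.Ann_deg \<pi> b)"
      by (rule A.dim_component[OF hom G.finite_monomials])
    also have "A.Ann_deg \<pi> b = {f \<in> supported {\<mu>. keys \<mu> \<in> \<Delta> \<and> multidegree \<pi> \<mu> = b}.
        \<forall>k<?d. \<forall>\<mu>. (\<Sum>v\<in>?V. A.th k v * f (\<mu> + var_exp v)) = 0}"
      unfolding A.Ann_deg_def A.Ann_def supported_def by blast
    finally have "int (A.QQ.dim A.K (SR_quot_component \<Delta> \<pi> \<Theta> b)) = int (fn.dim (G.cyc (G.D 0 0)))"
      unfolding G.dim_inverse_system by simp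
    also have "\<dots> = (\<Sum>j\<le>?n. (- 1) ^ j * int (fn.dim (G.D 0 j))) -
        int (card G.tops) * (\<Sum>p<?n. (- 1) ^ (?n - p) * G.rbetti p)"
      by (rule G.dim_cyc_D_0)
    also have "(\<Sum>j\<le>?n. (- 1) ^ j * int (fn.dim (G.D 0 j))) = flag_h \<Delta> \<pi> a b"
      by (rule G.euler_characteristic_flag_h) (fact count bal)+
    also have "card G.tops = vbinom a b" by (rule G.card_tops[OF count])
    also have "int (vbinom a b) * (\<Sum>p<?n. (- 1) ^ (?n - p) * G.rbetti p) =
        int (vbinom a b) * (\<Sum>j = 1..<?n. (- 1) ^ (?n - j) * int (reduced_betti TYPE('f) \<Delta> (int j - 1)))"
    proof (cases "?n = 0")
      case False
      have link: "link \<Delta> {} = \<Delta>" by (auto simp: link_def)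
      have betti: "G.rbetti p = int (reduced_betti TYPE('f) \<Delta> (int p - 1))" for p
        using C.reduced_betti_link[of "{}" p] C.dim_lbnd_le[of "{}" p]
        by (simp add: link G.rbetti_def of_nat_diff)
      \<comment> \<open>The correction sum starts at \<open>j = 1\<close>, so the term of the empty
        face must vanish. It does so if there is a vertex; without vertices \<open>a\<close> is
        zero, and the binomial vanishes because \<open>b\<close> is nonzero.\<close>
      have "int (vbinom a b) * G.rbetti 0 = 0"
      proof (cases "?V = {}")
        case True
        then have "S = {}" using C.face_subset[OF S(1)] by simp
        then have "vsize a = 0" using S(2) len by simp
        then have "\<not> b \<le> a" using False vsize_le_eq[of b a]
          by (auto simp: vsize_def le_fun_def)
        then show ?thesis by (simp add: vbinom_eq_0)
      next
        case False
        then obtain v where "v \<in> ?V" by blast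
        from C.betti_empty_face[OF this] have "G.rbetti 0 = 0" by (simp add: betti link)
        then show ?thesis by simp
      qed
      moreover have "(\<Sum>p<?n. (- 1) ^ (?n - p) * G.rbetti p) =
          (- 1) ^ ?n * G.rbetti 0 + (\<Sum>j = 1..<?n. (- 1) ^ (?n - j) * G.rbetti j)"
        using False by (simp add: lessThan_atLeast0 sum.atLeast_Suc_lessThan)
      ultimately show ?thesis by (simp add: distrib_left mult.left_commute betti)
    qed simp
    finally show ?thesis by (simp add: flag_h'_def)
  qed
  show ?thesis
  proof
    fix c
    have "(\<Sum>b | b \<le> a. flag_h' TYPE('f) \<Delta> \<pi> a b * t_monomial b c) =
        (\<Sum>b | b \<le> a. if b = c then flag_h' TYPE('f) \<Delta> \<pi> a c else 0)"
      by (rule sum.cong) (auto simp: t_monomial_def)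
    also have "\<dots> = flag_h' TYPE('f) \<Delta> \<pi> a c"
      using finite_fun_le[of a] flag_h'_eq_0[OF _ bal] by (auto simp: sum.delta)
    finally show "hilbert_series (SR_quot \<Delta> \<Theta>) (SR_quot_constants \<Delta> \<Theta>) (SR_quot_component \<Delta> \<pi> \<Theta>) c =
        (\<Sum>b | b \<le> a. flag_h' TYPE('f) \<Delta> \<pi> a b * t_monomial b c)"
      by (simp add: hilbert_series_def main)
  qed
qed

end
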